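(* There is an absolute constant $C\geq1$ such that the following holds. Let $f\colon\{0,1\}^n\to\{0,1\}$ be given, let $m,k$ be positive integers, and let $F=f\circ\mathrm{DISJ}_{m,k}$ be the $k$-party communication problem defined below. Then for all $\epsilon\in(0,1/2]$, \[ N(F)\geq\frac{\deg^+_\epsilon(f)}{2}\log\left(\frac{\sqrt m}{Ck2^k}\right)-\log\frac1\epsilon, \qquad \mathrm{MA}_{1/3}(F)^2\geq\frac{\deg^+_\epsilon(f)}{C}\log\left(\frac{\sqrt m}{Ck2^k}\right)-\left(\log\frac2\epsilon\right)^2. \]
   Context: Logarithms are to base 2. $\mathrm{DISJ}_{m,k}\colon(\{0,1\}^m)^k\to\{0,1\}$ is $\mathrm{DISJ}_{m,k}(y_1,\dots,y_k)=\bigwedge_{j=1}^m\bigvee_{i=1}^k\overline{y_{i,j}}$. The problem $F=f\circ\mathrm{DISJ}_{m,k}$ takes inputs $(w_1,\dots,w_n)$ with each $w_t=(y_{t,1},\dots,y_{t,k})\in(\{0,1\}^m)^k$, and $F(w_1,\dots,w_n)=f(\mathrm{DISJ}_{m,k}(w_1),\dots,\mathrm{DISJ}_{m,k}(w_n))$; the $i$-th player's argument is $(y_{1,i},\dots,y_{n,i})$. Number-on-the-forehead model: player $i$ sees all arguments except the $i$-th; players broadcast bits; cost is total bits broadcast in the worst case. Nondeterministic protocol: a guess string (length counted in cost) followed by a deterministic protocol, correct for all guesses on $F^{-1}(0)$ and for some guess on $F^{-1}(1)$; $N(F)$ is the least cost. Merlin–Arthur protocol: a guess string (counted in cost) followed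 by a randomized protocol that is correct with probability at least $2/3$ for all guesses on $F^{-1}(0)$ and for some guess on $F^{-1}(1)$; $\mathrm{MA}_{1/3}(F)$ is the least cost. For Boolean $f$ and $\epsilon\geq0$, $\deg^+_\epsilon(f)$ is the minimum total degree of a real polynomial $p$ with $|p(x)-f(x)|\leq\epsilon$ whenever $f(x)=0$ and $p(x)\geq1-\epsilon$ whenever $f(x)=1$. *)

theory Defs
  imports
    "HOL-Probability.Probability_Mass_Function"
    "HOL-Library.Poly_Mapping"
begin

section \<open>Boolean functions and polynomial approximation\<close>

text \<open>The cube \<open>{0,1}\<^sup>n\<close> is the set of extensional functions on \<open>{..<n}\<close>; a Boolean function
  on it is a HOL function of which only the values on the cube matter.\<close>

definition cube :: "nat \<Rightarrow> (nat \<Rightarrow> bool) set" where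
  "cube n = {..<n} \<rightarrow>\<^sub>E UNIV"

text \<open>Multivariate real polynomials: finitely supported maps from monomials (exponent vectors) to
  coefficients.\<close>

type_synonym real_mpoly = "(nat \<Rightarrow>\<^sub>0 nat) \<Rightarrow>\<^sub>0 real"

definition mpoly_eval :: "real_mpoly \<Rightarrow> (nat \<Rightarrow> real) \<Rightarrow> real" where
  "mpoly_eval p x =
     (\<Sum>a\<in>Poly_Mapping.keys p.
        Poly_Mapping.lookup p a * (\<Prod>i\<in>Poly_Mapping.keys a. x i ^ Poly_Mapping.lookup a i))"

definition mpoly_vars :: "real_mpoly \<Rightarrow> nat set" where
  "mpoly_vars p = (\<Union>a\<in>Poly_Mapping.keys p. Poly_Mapping.keys a)"

text \<open>The zero polynomial gets degree \<open>0\<close>.\<close>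

definition mpoly_degree :: "real_mpoly \<Rightarrow> nat" where
  "mpoly_degree p =
     Max (insert 0 ((\<lambda>a. \<Sum>i\<in>Poly_Mapping.keys a. Poly_Mapping.lookup a i) ` Poly_Mapping.keys p))"

definition onesided_approx ::
    "nat \<Rightarrow> ((nat \<Rightarrow> bool) \<Rightarrow> bool) \<Rightarrow> real \<Rightarrow> real_mpoly \<Rightarrow> bool" where
  "onesided_approx n f \<epsilon> p \<longleftrightarrow>
     (\<forall>x\<in>cube n.
        (\<not> f x \<longrightarrow> \<bar>mpoly_eval p (\<lambda>i. of_bool (x i)) - of_bool (f x)\<bar> \<le> \<epsilon>) \<and>
        (f x \<longrightarrow> mpoly_eval p (\<lambda>i. of_bool (x i)) \<ge> 1 - \<epsilon>))"

text \<open>\<open>deg\<^sup>+\<^sub>\<epsilon>(f)\<close>. For \<open>\<epsilon> \<ge> 0\<close> the minimum is over a nonempty set, since \<open>f\<close> itself is represented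
  exactly by a polynomial on the cube.\<close>

definition deg_plus :: "nat \<Rightarrow> ((nat \<Rightarrow> bool) \<Rightarrow> bool) \<Rightarrow> real \<Rightarrow> nat" where
  "deg_plus n f \<epsilon> =
     (LEAST d. \<exists>p. mpoly_vars p \<subseteq> {..<n} \<and> mpoly_degree p = d \<and> onesided_approx n f \<epsilon> p)"

section \<open>Number-on-the-forehead communication\<close>

text \<open>An input of a \<open>k\<close>-party problem is \<open>x \<in> PiE {..<k} X\<close>, with \<open>x i \<in> X i\<close> the argument on the
  forehead of player \<open>i\<close>. In a deterministic protocol tree, an inner node \<open>Speak i b P\<^sub>0 P\<^sub>1\<close> says that
  player \<open>i\<close> broadcasts the bit \<open>b x\<close>, after which the protocol continues with \<open>P\<^sub>1\<close> or \<open>P\<^sub>0\<close>.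
  The output is determined by the transcript.\<close>

datatype 'a protocol =
    Output bool
  | Speak nat "(nat \<Rightarrow> 'a) \<Rightarrow> bool" "'a protocol" "'a protocol"

primrec nof_protocol :: "nat \<Rightarrow> (nat \<Rightarrow> 'a set) \<Rightarrow> 'a protocol \<Rightarrow> bool" where
  "nof_protocol k X (Output c) \<longleftrightarrow> True"
| "nof_protocol k X (Speak i b P0 P1) \<longleftrightarrow>
     i < k \<and>
     (\<forall>x \<in> PiE {..<k} X. \<forall>y \<in> PiE {..<k} X. (\<forall>j\<in>{..<k} - {i}. x j = y j) \<longrightarrow> b x = b y) \<and>
     nof_protocol k X P0 \<and> nof_protocol k X P1"

primrec run :: "'a protocol \<Rightarrow> (nat \<Rightarrow> 'a) \<Rightarrow> bool" where
  "run (Output c) x = c"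
| "run (Speak i b P0 P1) x = (if b x then run P1 x else run P0 x)"

primrec bits_sent :: "'a protocol \<Rightarrow> (nat \<Rightarrow> 'a) \<Rightarrow> nat" where
  "bits_sent (Output c) x = 0"
| "bits_sent (Speak i b P0 P1) x = Suc (if b x then bits_sent P1 x else bits_sent P0 x)"

definition protocol_cost :: "nat \<Rightarrow> (nat \<Rightarrow> 'a set) \<Rightarrow> 'a protocol \<Rightarrow> enat" where
  "protocol_cost k X P = (SUP x \<in> PiE {..<k} X. enat (bits_sent P x))"

definition guesses :: "nat \<Rightarrow> bool list set" where
  "guesses l = {g. length g = l}"

text \<open>A nondeterministic protocol is a guess length \<open>l\<close> with a deterministic protocol for each guess.\<close>

definition nondet_computes ::
    "nat \<Rightarrow> (nat \<Rightarrow> 'a set) \<Rightarrow> ((nat \<Rightarrow> 'a) \<Rightarrow> bool) \<Rightarrow> nat \<Rightarrow> (bool list \<Rightarrow> 'a protocol) \<Rightarrow> bool" where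
  "nondet_computes k X F l P \<longleftrightarrow>
     (\<forall>g\<in>guesses l. nof_protocol k X (P g)) \<and>
     (\<forall>x \<in> PiE {..<k} X.
        (\<not> F x \<longrightarrow> (\<forall>g\<in>guesses l. run (P g) x = F x)) \<and>
        (F x \<longrightarrow> (\<exists>g\<in>guesses l. run (P g) x = F x)))"

definition nondet_cost ::
    "nat \<Rightarrow> (nat \<Rightarrow> 'a set) \<Rightarrow> nat \<Rightarrow> (bool list \<Rightarrow> 'a protocol) \<Rightarrow> enat" where
  "nondet_cost k X l P = enat l + (SUP g\<in>guesses l. protocol_cost k X (P g))"

text \<open>The least cost is an \<open>enat\<close>: it is \<open>\<infinity>\<close> when no protocol exists, as happens for nonconstant
  problems when \<open>k = 1\<close>, where the only player sees nothing.\<close>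

definition nondet_complexity :: "nat \<Rightarrow> (nat \<Rightarrow> 'a set) \<Rightarrow> ((nat \<Rightarrow> 'a) \<Rightarrow> bool) \<Rightarrow> enat" where
  "nondet_complexity k X F = Inf {nondet_cost k X l P | l P. nondet_computes k X F l P}"

text \<open>A randomized (public-coin) protocol is a probability distribution on deterministic protocols;
  its cost is the worst case over the support. A Merlin--Arthur protocol is a guess length with a
  randomized protocol for each guess.\<close>

definition ma_computes ::
    "real \<Rightarrow> nat \<Rightarrow> (nat \<Rightarrow> 'a set) \<Rightarrow> ((nat \<Rightarrow> 'a) \<Rightarrow> bool) \<Rightarrow> nat \<Rightarrow>
      (bool list \<Rightarrow> 'a protocol pmf) \<Rightarrow> bool" where
  "ma_computes \<delta> k X F l R \<longleftrightarrow>
     (\<forall>g\<in>guesses l. \<forall>P\<in>set_pmf (R g). nof_protocol k X P) \<and>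
     (\<forall>x \<in> PiE {..<k} X.
        (\<not> F x \<longrightarrow> (\<forall>g\<in>guesses l. measure_pmf.prob (R g) {P. run P x = F x} \<ge> 1 - \<delta>)) \<and>
        (F x \<longrightarrow> (\<exists>g\<in>guesses l. measure_pmf.prob (R g) {P. run P x = F x} \<ge> 1 - \<delta>)))"

definition ma_cost ::
    "nat \<Rightarrow> (nat \<Rightarrow> 'a set) \<Rightarrow> nat \<Rightarrow> (bool list \<Rightarrow> 'a protocol pmf) \<Rightarrow> enat" where
  "ma_cost k X l R =
     enat l + (SUP g\<in>guesses l. SUP P\<in>set_pmf (R g). protocol_cost k X P)"

definition ma_complexity :: "real \<Rightarrow> nat \<Rightarrow> (nat \<Rightarrow> 'a set) \<Rightarrow> ((nat \<Rightarrow> 'a) \<Rightarrow> bool) \<Rightarrow> enat" where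
  "ma_complexity \<delta> k X F = Inf {ma_cost k X l R | l R. ma_computes \<delta> k X F l R}"

section \<open>Composition with set disjointness\<close>

definition DISJ :: "nat \<Rightarrow> nat \<Rightarrow> (nat \<Rightarrow> nat \<Rightarrow> bool) \<Rightarrow> bool" where
  "DISJ m k y \<longleftrightarrow> (\<forall>j<m. \<exists>i<k. \<not> y i j)"

text \<open>The argument of each player in \<open>f \<circ> DISJ\<^sub>m\<^sub>,\<^sub>k\<close> is an element of \<open>({0,1}\<^sup>m)\<^sup>n\<close>; the argument of
  player \<open>i\<close> holds, for each \<open>t < n\<close>, the \<open>i\<close>-th string \<open>x i t\<close> of the \<open>t\<close>-th copy of disjointness.\<close>

definition disj_args :: "nat \<Rightarrow> nat \<Rightarrow> nat \<Rightarrow> (nat \<Rightarrow> nat \<Rightarrow> bool) set" where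
  "disj_args n m i = {..<n} \<rightarrow>\<^sub>E cube m"

definition comp_DISJ ::
    "nat \<Rightarrow> ((nat \<Rightarrow> bool) \<Rightarrow> bool) \<Rightarrow> nat \<Rightarrow> nat \<Rightarrow> (nat \<Rightarrow> nat \<Rightarrow> nat \<Rightarrow> bool) \<Rightarrow> bool" where
  "comp_DISJ n f m k x = f (\<lambda>t\<in>{..<n}. DISJ m k (\<lambda>i. x i t))"

end

theory Submission
  imports Defs "HOL-Combinatorics.Permutations"
begin

text \<open>A linear functional on functions of the rows of a matrix is called good if iterated
  Cauchy--Schwarz, one row at a time, certifies that it is at most 1 in modulus on every product of
  functions each ignoring one row. Goodness is stable under absolutely convex combinations and under
  tensor products. The main point is to find distributions \<open>H\<close> and \<open>T\<close> on disjointness matrices with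
  DISJ equal to 0 and to 1 for which \<open>(1 - s) T + s H\<close> is good for all complex \<open>s\<close> in a disc of radius
  \<open>N/4\<close>, at the price of \<open>O(N k\<^sup>2 4\<^sup>k)\<close> columns. The \<open>n\<close>-fold product of such a pair turns the
  acceptance function of a protocol into a polynomial in the values of DISJ whose homogeneous part of
  degree \<open>j\<close> is at most (number of cylinder intersections) \<open>\<times> (N/4 - 1)\<^sup>-\<^sup>j\<close>; truncation then gives a
  one-sided approximation of \<open>f\<close> of low degree. A Merlin--Arthur protocol is treated in the same way,
  replacing the acceptance probability \<open>p\<close> for each guess by \<open>(3p/2)\<^sup>T\<close> with \<open>T\<close> large.

  The matrix with columns of an even number of zeros has exactly one all-ones column, the one with
  columns of an odd number of zeros has none; \<open>H\<close> and \<open>T\<close> hide these two sets of columns among random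
  columns. Adding a row splits a multiset of columns into a part with bit 1, of unchanged type, and a
  part with bit 0, of opposite type; the random columns are chosen so that the pair law produced by
  Cauchy--Schwarz is again made of such hidden multisets. The loss in the radius of the disc is \<open>1/k\<close>
  per row. Hiding one block of type \<open>H\<close> among \<open>N\<close> blocks of type \<open>T\<close> multiplies the radius by \<open>N/2\<close>.\<close>

section \<open>Finite weighted sums of evaluations\<close>

text \<open>The obstacle is the size of the disc. In \<open>half + s dif\<close> the two parities
  sit at s = 1 and s = -1, but a bare unit over rows 0..n is certified only for |s| at most
  1/(2^(n+1) - 1). The random columns must push this radius to 2, so that a disc of radius 1 around
  s = -1 fits. In the row step one of 2q + 2 units is live, with weight (1 + \<theta> t)/(2q + 2)
  for type t = 1 or -1. Because the types are balanced, these weights add up to 1 for every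
  \<theta>, and the pair law becomes a combination of good laws whose coefficients have moduli
  summing to exactly 1. The types of two distinct live units are negatively correlated, by b = 1/(2q
  + 1), which costs the order of sqrt b in the radius; k rows can afford this when q has order k^2.
  Each live unit also leaves a partner of opposite type among the columns that are dead in both
  copies; halves mask it. Parts multiply by four per row, whence 4^k. The parameter s is complex
  since both the hiding of one block among N and the final truncation read off coefficients from
  values on a circle.\<close>

definition fsum :: "(complex \<times> 'x) list \<Rightarrow> ('x \<Rightarrow> complex) \<Rightarrow> complex" where
  "fsum A f = (\<Sum>(c, x)\<leftarrow>A. c * f x)"

definition lin :: "(('x \<Rightarrow> complex) \<Rightarrow> complex) \<Rightarrow> bool" where
  "lin L \<longleftrightarrow> (\<forall>f g. L (\<lambda>x. f x + g x) = L f + L g) \<and> (\<forall>c f. L (\<lambda>x. c * f x) = c * L f)"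

definition subprob :: "'x set \<Rightarrow> (('x \<Rightarrow> complex) \<Rightarrow> complex) \<Rightarrow> bool" where
  "subprob X P \<longleftrightarrow> (\<exists>A :: (real \<times> 'x) list. (\<forall>(c, x)\<in>set A. 0 \<le> c \<and> x \<in> X) \<and>
     (\<Sum>(c, x)\<leftarrow>A. c) \<le> 1 \<and> P = (\<lambda>f. \<Sum>(c, x)\<leftarrow>A. of_real c * f x))"

lemma fsum_simps [simp]: "fsum [] f = 0" "fsum ((c, x) # A) f = c * f x + fsum A f"
  "fsum (A @ B) f = fsum A f + fsum B f"
  by (simp_all add: fsum_def)

lemma linD: "lin L \<Longrightarrow> L (\<lambda>x. f x + g x) = L f + L g" "lin L \<Longrightarrow> L (\<lambda>x. c * f x) = c * L f"
  by (simp_all add: lin_def)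

lemma lin_zero: "lin L \<Longrightarrow> L (\<lambda>x. 0) = 0"
  using linD(2)[of L 0 "\<lambda>_. 0"] by simp

lemma lin_multr: "lin L \<Longrightarrow> L (\<lambda>x. f x * c) = L f * c"
  using linD(2)[of L c f] by (simp add: mult.commute)

lemma lin_sum: "lin L \<Longrightarrow> L (\<lambda>x. \<Sum>i\<in>I. f i x) = (\<Sum>i\<in>I. L (f i))"
proof (induction I rule: infinite_finite_induct)
  case (insert i I)
  then show ?case using linD(1)[of L "f i" "\<lambda>x. \<Sum>i\<in>I. f i x"] by simp
qed (simp_all add: lin_zero)

lemma lin_sum_scaled: "lin L \<Longrightarrow> L (\<lambda>x. \<Sum>i\<in>I. c i * f i x) = (\<Sum>i\<in>I. c i * L (f i))"
  using lin_sum[of L "\<lambda>i x. c i * f i x" I] linD(2)[of L] by simp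

lemma lin_fsum: "lin (fsum A)"
  unfolding lin_def by (induction A) (auto simp: algebra_simps)

lemma fsum_swap: "lin L \<Longrightarrow> L (\<lambda>x. fsum A (f x)) = fsum A (\<lambda>y. L (\<lambda>x. f x y))"
proof (induction A)
  case (Cons a A)
  obtain c y where "a = (c, y)" by force
  then show ?case
    using Cons linD(1)[of L "\<lambda>x. c * f x y" "\<lambda>x. fsum A (f x)"] linD(2)[of L c "\<lambda>x. f x y"] by simp
qed (simp add: lin_zero)

lemma subprob_fsum: "subprob X P \<Longrightarrow> \<exists>A. P = fsum A"
proof -
  assume "subprob X P"
  then obtain A :: "(real \<times> _) list" where "P = (\<lambda>f. \<Sum>(c, x)\<leftarrow>A. of_real c * f x)"
    by (auto simp: subprob_def)
  then have "P = fsum (map (\<lambda>(c, x). (of_real c, x)) A)"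
    by (auto simp: fun_eq_iff fsum_def case_prod_unfold comp_def)
  then show ?thesis by blast
qed

lemma lin_subprob: "subprob X P \<Longrightarrow> lin P"
  using subprob_fsum lin_fsum by blast

lemma subprob_swap:
  assumes "subprob X P" "lin L"
  shows "L (\<lambda>y. P (\<lambda>x. f x y)) = P (\<lambda>x. L (f x))"
proof -
  obtain A where P: "P = fsum A" using subprob_fsum[OF assms(1)] by blast
  show ?thesis unfolding P using fsum_swap[OF assms(2), of A "\<lambda>y x. f x y"] by simp
qed

lemma subprob_cong:
  assumes "subprob X P" "\<And>x. x \<in> X \<Longrightarrow> f x = g x"
  shows "P f = P g"
  using assms unfolding subprob_def
  by (auto intro!: arg_cong[where f = sum_list] map_cong)

lemma subprob_mono: "subprob X P \<Longrightarrow> X \<subseteq> Y \<Longrightarrow> subprob Y P"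
  unfolding subprob_def by blast

lemma subprob_point: "x \<in> X \<Longrightarrow> subprob X (\<lambda>f. f x)"
  unfolding subprob_def by (intro exI[of _ "[(1, x)]"]) auto

lemma subprob_zero: "subprob X (\<lambda>f. 0)"
  unfolding subprob_def by (intro exI[of _ "[]"]) auto

lemma subprob_convex:
  assumes "finite I" "\<And>i. i \<in> I \<Longrightarrow> 0 \<le> c i" "sum c I \<le> 1"
    and "\<And>i. i \<in> I \<Longrightarrow> c i \<noteq> 0 \<Longrightarrow> subprob X (P i)"
  shows "subprob X (\<lambda>f. \<Sum>i\<in>I. of_real (c i) * P i f)"
proof -
  have "\<exists>A :: (real \<times> _) list. (\<forall>(c, x)\<in>set A. 0 \<le> c \<and> x \<in> X) \<and>
     (\<Sum>(c, x)\<leftarrow>A. c) \<le> sum c I \<and> (\<forall>f. (\<Sum>i\<in>I. of_real (c i) * P i f) = (\<Sum>(c, x)\<leftarrow>A. of_real c * f x))"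
    using assms(1,2,4)
  proof (induction I rule: finite_induct)
    case empty
    show ?case by (intro exI[of _ "[]"]) auto
  next
    case (insert i I)
    have "\<exists>A :: (real \<times> _) list. (\<forall>(c, x)\<in>set A. 0 \<le> c \<and> x \<in> X) \<and> (\<Sum>(c, x)\<leftarrow>A. c) \<le> sum c I \<and>
      (\<forall>f. (\<Sum>i\<in>I. of_real (c i) * P i f) = (\<Sum>(c, x)\<leftarrow>A. of_real c * f x))"
      by (rule insert.IH) (use insert.prems in auto)
    then obtain A :: "(real \<times> _) list" where A: "\<forall>(c, x)\<in>set A. 0 \<le> c \<and> x \<in> X"
      "(\<Sum>(c, x)\<leftarrow>A. c) \<le> sum c I"
      "\<And>f. (\<Sum>i\<in>I. of_real (c i) * P i f) = (\<Sum>(c, x)\<leftarrow>A. of_real c * f x)"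
      by (elim exE conjE) blast
    show ?case
    proof (cases "c i = 0")
      case True
      then show ?thesis using A insert by (intro exI[of _ A]) auto
    next
      case False
      then obtain B :: "(real \<times> _) list" where B: "\<forall>(c, x)\<in>set B. 0 \<le> c \<and> x \<in> X" "(\<Sum>(c, x)\<leftarrow>B. c) \<le> 1"
        "\<And>f. P i f = (\<Sum>(c, x)\<leftarrow>B. of_real c * f x)"
        using insert.prems(2)[of i] by (auto simp: subprob_def)
      let ?B = "map (\<lambda>(b, x). (c i * b, x)) B"
      have ci: "0 \<le> c i" using insert by simp
      have 1: "(\<Sum>(c, x)\<leftarrow>?B. c) = c i * (\<Sum>(c, x)\<leftarrow>B. c)"
        by (simp add: case_prod_unfold comp_def sum_list_const_mult)
      have 2: "(\<Sum>(c, x)\<leftarrow>?B. of_real c * f x) = of_real (c i) * P i f" for f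
        by (simp add: B(3) case_prod_unfold comp_def sum_list_const_mult mult.assoc)
      have "(\<Sum>(c, x)\<leftarrow>?B. c) \<le> c i"
        unfolding 1 using mult_left_mono[OF B(2) ci] by simp
      then show ?thesis
        using A B(1) insert(1,2) ci 2 by (intro exI[of _ "?B @ A"]) auto
    qed
  qed
  then show ?thesis using assms(3) unfolding subprob_def by (elim exE, intro exI) auto
qed

lemma subprob_bind:
  assumes "subprob X P" "\<And>x. x \<in> X \<Longrightarrow> subprob Y (K x)"
  shows "subprob Y (\<lambda>f. P (\<lambda>x. K x f))"
proof -
  obtain A :: "(real \<times> _) list" where A: "\<forall>(c, x)\<in>set A. 0 \<le> c \<and> x \<in> X" "(\<Sum>(c, x)\<leftarrow>A. c) \<le> 1"
    "P = (\<lambda>f. \<Sum>(c, x)\<leftarrow>A. of_real c * f x)" using assms(1) by (auto simp: subprob_def)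
  have *: "(\<Sum>(c, x)\<leftarrow>A. g c x) = (\<Sum>i\<in>{..<length A}. g (fst (A ! i)) (snd (A ! i)))"
    for g :: "real \<Rightarrow> _ \<Rightarrow> 'z :: comm_monoid_add"
    by (simp add: sum_list_sum_nth atLeast0LessThan case_prod_unfold)
  have nth: "0 \<le> fst (A ! i)" "snd (A ! i) \<in> X" if "i < length A" for i
    using bspec[OF A(1) nth_mem[OF that]] by (auto simp: case_prod_unfold)
  have "subprob Y (\<lambda>f. \<Sum>i\<in>{..<length A}. of_real (fst (A ! i)) * K (snd (A ! i)) f)"
  proof (rule subprob_convex)
    show "(\<Sum>i<length A. fst (A ! i)) \<le> 1" using A(2) *[of "\<lambda>c x. c"] by simp
  qed (auto intro: nth assms(2))
  moreover have "P (\<lambda>x. K x f) = (\<Sum>i<length A. of_real (fst (A ! i)) * K (snd (A ! i)) f)" for f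
    using *[of "\<lambda>c x. of_real c * K x f"] A(3) by metis
  ultimately show ?thesis by presburger
qed

lemma subprob_map: "subprob X P \<Longrightarrow> (\<And>x. x \<in> X \<Longrightarrow> h x \<in> Y) \<Longrightarrow> subprob Y (\<lambda>f. P (\<lambda>x. f (h x)))"
  using subprob_bind[of X P Y "\<lambda>x f. f (h x)"] subprob_point by metis

lemma subprob_norm_le:
  assumes P: "subprob X P" and f: "\<And>x. x \<in> X \<Longrightarrow> norm (f x) \<le> 1"
  shows "norm (P f) \<le> 1"
proof -
  obtain A :: "(real \<times> _) list" where A: "\<forall>(c, x)\<in>set A. 0 \<le> c \<and> x \<in> X" "(\<Sum>(c, x)\<leftarrow>A. c) \<le> 1"
    "P = (\<lambda>f. \<Sum>(c, x)\<leftarrow>A. of_real c * f x)" using P by (auto simp: subprob_def)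
  have "norm (\<Sum>(c, x)\<leftarrow>B. of_real c * f x) \<le> (\<Sum>(c, x)\<leftarrow>B. c)"
    if "\<forall>(c, x)\<in>set B. 0 \<le> c \<and> x \<in> X" for B
    using that
  proof (induction B)
    case (Cons a B)
    have "norm (of_real (fst a) * f (snd a)) \<le> fst a"
      using Cons.prems f[of "snd a"] by (auto simp: norm_mult case_prod_unfold intro: mult_left_le)
    then show ?case using Cons by (auto simp: case_prod_unfold intro!: norm_triangle_le)
  qed simp
  then show ?thesis using A by fastforce
qed

text \<open>The Cauchy--Schwarz inequality in a form without square roots: \<open>2\<bar>v\<bar> \<le> 1 + \<bar>v\<bar>\<^sup>2\<close>.\<close>

lemma subprob_Cauchy_Schwarz:
  assumes P: "subprob X P" and u: "\<And>x. norm (u x) \<le> 1"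
  shows "norm (P (\<lambda>x. u x * v x)) \<le> (1 + norm (P (\<lambda>x. v x * cnj (v x)))) / 2"
proof -
  obtain A :: "(real \<times> _) list" where A: "\<forall>(c, x)\<in>set A. 0 \<le> c \<and> x \<in> X" "(\<Sum>(c, x)\<leftarrow>A. c) \<le> 1"
    "P = (\<lambda>f. \<Sum>(c, x)\<leftarrow>A. of_real c * f x)" using P by (auto simp: subprob_def)
  have 1: "2 * norm (\<Sum>(c, x)\<leftarrow>B. of_real c * (u x * v x)) \<le>
      (\<Sum>(c, x)\<leftarrow>B. c) + (\<Sum>(c, x)\<leftarrow>B. c * (norm (v x))\<^sup>2)"
    if "\<forall>(c, x)\<in>set B. 0 \<le> c \<and> x \<in> X" for B
    using that
  proof (induction B)
    case (Cons a B)
    obtain c x where a: "a = (c, x)" by force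
    have c: "0 \<le> c" using Cons.prems a by auto
    have "norm (u x * v x) \<le> norm (v x)"
      using u[of x] by (simp add: norm_mult mult_left_le_one_le)
    moreover have "2 * norm (v x) \<le> 1 + (norm (v x))\<^sup>2"
      using zero_le_power2[of "norm (v x) - 1"] by (simp add: power2_eq_square algebra_simps)
    ultimately have "2 * norm (of_real c * (u x * v x)) \<le> c * (1 + (norm (v x))\<^sup>2)"
      using c mult_left_mono[of "2 * norm (u x * v x)" "1 + (norm (v x))\<^sup>2" c] by (simp add: norm_mult)
    moreover have "2 * norm (\<Sum>(c, x)\<leftarrow>B. of_real c * (u x * v x)) \<le>
      (\<Sum>(c, x)\<leftarrow>B. c) + (\<Sum>(c, x)\<leftarrow>B. c * (norm (v x))\<^sup>2)" using Cons by simp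
    ultimately show ?case
      using norm_triangle_ineq[of "of_real c * (u x * v x)" "\<Sum>(c, x)\<leftarrow>B. of_real c * (u x * v x)"]
      by (simp add: a algebra_simps)
  qed simp
  have 2: "(\<Sum>(c, x)\<leftarrow>B. of_real c * (v x * cnj (v x))) = of_real (\<Sum>(c, x)\<leftarrow>B. c * (norm (v x))\<^sup>2)"
    for B :: "(real \<times> 'a) list"
    by (induction B) (auto simp: complex_norm_square[symmetric] simp del: of_real_power)
  have "0 \<le> (\<Sum>(c, x)\<leftarrow>A. c * (norm (v x))\<^sup>2)" using A(1) by (intro sum_list_nonneg) auto
  then have "norm (P (\<lambda>x. v x * cnj (v x))) = (\<Sum>(c, x)\<leftarrow>A. c * (norm (v x))\<^sup>2)"
    unfolding A(3) 2 by (simp only: norm_of_real abs_of_nonneg)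
  with 1[OF A(1)] A(2) show ?thesis unfolding A(3) by simp
qed

section \<open>Functionals bounded on cylinder functions\<close>

definition cnj_weights :: "(complex \<times> 'x) list \<Rightarrow> (complex \<times> 'x) list" where
  "cnj_weights es = map (\<lambda>(w, z). (cnj w, z)) es"

text \<open>The label \<open>\<xi>\<close> is drawn together with \<open>N\<close> and the test
  function may depend on it: a bound for \<open>N\<close> is applied separately for each value of
  the label. In a pair law the label is the pair of candidate rows.\<close>

definition mix :: "((('y \<Rightarrow> complex) \<Rightarrow> complex) \<Rightarrow> bool) \<Rightarrow> (('y \<times> 'l \<Rightarrow> complex) \<Rightarrow> complex) \<Rightarrow> bool" where
  "mix G R \<longleftrightarrow> (\<exists>Q. subprob {(N, \<xi>). G N} Q \<and> R = (\<lambda>g. Q (\<lambda>(N, \<xi>). N (\<lambda>x. g (x, \<xi>)))))"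

text \<open>The law \<open>P\<close> draws the other rows \<open>Y\<close> together with a weighted list \<open>es\<close> of candidates for row \<open>n\<close>.
  Cauchy--Schwarz over \<open>P\<close> eliminates the factor which ignores row \<open>n\<close> and leaves \<open>pair_law P\<close>.\<close>

definition present :: "nat \<Rightarrow> (((nat \<Rightarrow> 'r) \<times> (complex \<times> 'r) list \<Rightarrow> complex) \<Rightarrow> complex) \<Rightarrow>
    ((nat \<Rightarrow> 'r) \<Rightarrow> complex) \<Rightarrow> complex" where
  "present n P f = P (\<lambda>(Y, es). fsum es (\<lambda>z. f (Y(n := z))))"

definition pair_law :: "(((nat \<Rightarrow> 'r) \<times> (complex \<times> 'r) list \<Rightarrow> complex) \<Rightarrow> complex) \<Rightarrow>
    ((nat \<Rightarrow> 'r) \<times> ('r \<times> 'r) \<Rightarrow> complex) \<Rightarrow> complex" where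
  "pair_law P g = P (\<lambda>(Y, es). fsum es (\<lambda>z. fsum (cnj_weights es) (\<lambda>z'. g (Y, (z, z')))))"

text \<open>A certificate rather than the bound that it implies: tensor products can then be treated
  by multiplying certificates row by row. In the base case a function that ignores the only row is
  constant, so only the total mass counts.\<close>

primrec good :: "nat \<Rightarrow> (((nat \<Rightarrow> 'r) \<Rightarrow> complex) \<Rightarrow> complex) \<Rightarrow> bool" where
  "good 0 L \<longleftrightarrow> lin L \<and> norm (L (\<lambda>_. 1)) \<le> 1"
| "good (Suc n) L \<longleftrightarrow> (\<exists>P. subprob UNIV P \<and> L = present (Suc n) P \<and> mix (good n) (pair_law P))"

lemma fsum_cnj_weights: "fsum (cnj_weights es) f = cnj (fsum es (\<lambda>z. cnj (f z)))"
  by (induction es) (auto simp: cnj_weights_def)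

lemma lin_present: "subprob X P \<Longrightarrow> lin (present n P)"
  unfolding present_def lin_def
  by (simp add: linD[OF lin_fsum] case_prod_unfold) (intro conjI allI linD lin_subprob; assumption)

lemma lin_good: "good n L \<Longrightarrow> lin L"
  by (cases n) (auto intro: lin_present)

definition cylinder :: "nat \<Rightarrow> ((nat \<Rightarrow> 'r) \<Rightarrow> complex) \<Rightarrow> bool" where
  "cylinder n F \<longleftrightarrow> (\<exists>\<phi>. (\<forall>i\<le>n. \<forall>x. norm (\<phi> i x) \<le> 1) \<and>
     (\<forall>i\<le>n. \<forall>x y. (\<forall>j\<le>n. j \<noteq> i \<longrightarrow> x j = y j) \<longrightarrow> \<phi> i x = \<phi> i y) \<and> F = (\<lambda>x. \<Prod>i\<le>n. \<phi> i x))"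

text \<open>The factor that ignores the last row comes out of the sum over candidates, and
  Cauchy--Schwarz replaces it by two copies of the other factors. Once the two candidates are fixed,
  each remaining factor is paired with its conjugate copy, and the result is a cylinder function of
  one row fewer.\<close>

theorem good_cylinder: "good n L \<Longrightarrow> cylinder n F \<Longrightarrow> norm (L F) \<le> 1"
proof (induction n arbitrary: L F)
  case 0
  then obtain \<phi> :: "nat \<Rightarrow> (nat \<Rightarrow> 'a) \<Rightarrow> complex" where \<phi>: "\<And>x. norm (\<phi> 0 x) \<le> 1"
      "\<And>x y. \<phi> 0 x = \<phi> 0 y" "F = \<phi> 0"
    by (auto simp: cylinder_def)
  have "F = (\<lambda>x. \<phi> 0 undefined * 1)" using \<phi>(2,3) by auto
  then have "L F = \<phi> 0 undefined * L (\<lambda>_. 1)" using 0(1) linD(2)[of L "\<phi> 0 undefined" "\<lambda>_. 1"] by simp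
  then show ?case using 0(1) \<phi>(1) by (auto simp: norm_mult intro: mult_le_one)
next
  case (Suc n)
  obtain \<phi> :: "nat \<Rightarrow> (nat \<Rightarrow> 'a) \<Rightarrow> complex" where \<phi>0: "\<forall>i\<le>Suc n. \<forall>x. norm (\<phi> i x) \<le> 1"
      "\<forall>i\<le>Suc n. \<forall>x y. (\<forall>j\<le>Suc n. j \<noteq> i \<longrightarrow> x j = y j) \<longrightarrow> \<phi> i x = \<phi> i y"
      "F = (\<lambda>x. \<Prod>i\<le>Suc n. \<phi> i x)"
    using Suc.prems(2) unfolding cylinder_def by (elim exE conjE)
  have \<phi>: "\<And>i x. i \<le> Suc n \<Longrightarrow> norm (\<phi> i x) \<le> 1"
      "\<And>i x y. i \<le> Suc n \<Longrightarrow> (\<forall>j\<le>Suc n. j \<noteq> i \<longrightarrow> x j = y j) \<Longrightarrow> \<phi> i x = \<phi> i y"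
      "F = (\<lambda>x. \<Prod>i\<le>Suc n. \<phi> i x)"
    by (use \<phi>0(1) in blast, use \<phi>0(2) in blast, rule \<phi>0(3))
  obtain P where P: "subprob UNIV P" "L = present (Suc n) P" "mix (good n) (pair_law P)"
    using Suc.prems(1) by auto
  define v where "v = (\<lambda>(Y, es). fsum es (\<lambda>z. \<Prod>i\<le>n. \<phi> i (Y(Suc n := z))))"
  define g where "g = (\<lambda>(Y, (z, z')). (\<Prod>i\<le>n. \<phi> i (Y(Suc n := z))) * cnj (\<Prod>i\<le>n. \<phi> i (Y(Suc n := z'))))"
  have LF: "L F = P (\<lambda>x. \<phi> (Suc n) (fst x) * v x)"
    unfolding P(2) present_def \<phi>(3) v_def
  proof (intro arg_cong[where f = P] ext, clarsimp)
    fix Y :: "nat \<Rightarrow> 'a" and es :: "(complex \<times> 'a) list"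
    have "\<phi> (Suc n) (Y(Suc n := z)) = \<phi> (Suc n) Y" for z by (intro \<phi>(2)) auto
    then show "fsum es (\<lambda>z. (\<Prod>i\<le>n. \<phi> i (Y(Suc n := z))) * \<phi> (Suc n) (Y(Suc n := z))) =
      \<phi> (Suc n) Y * fsum es (\<lambda>z. \<Prod>i\<le>n. \<phi> i (Y(Suc n := z)))"
      by (simp add: lin_multr[OF lin_fsum])
  qed
  have vv: "P (\<lambda>x. v x * cnj (v x)) = pair_law P g"
    unfolding pair_law_def
  proof (intro arg_cong[where f = P] ext, clarsimp)
    fix Y es
    show "v (Y, es) * cnj (v (Y, es)) = fsum es (\<lambda>z. fsum (cnj_weights es) (\<lambda>z'. g (Y, z, z')))"
      unfolding v_def g_def by (simp add: linD[OF lin_fsum] lin_multr[OF lin_fsum] fsum_cnj_weights)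
  qed
  obtain Q where Q: "subprob {(N, \<xi>). good n N} Q"
    "pair_law P = (\<lambda>g. Q (\<lambda>(N, \<xi>). N (\<lambda>x. g (x, \<xi>))))"
    using P(3) by (auto simp: mix_def)
  have "norm (pair_law P g) \<le> 1"
    unfolding Q(2)
  proof (rule subprob_norm_le[OF Q(1)], clarify)
    fix N :: "((nat \<Rightarrow> 'a) \<Rightarrow> complex) \<Rightarrow> complex" and \<xi> \<xi>' assume N: "good n N"
    define \<psi> where "\<psi> i Y = \<phi> i (Y(Suc n := \<xi>)) * cnj (\<phi> i (Y(Suc n := \<xi>')))" for i Y
    have "cylinder n (\<lambda>Y. g (Y, (\<xi>, \<xi>')))"
      unfolding cylinder_def
    proof (intro exI[of _ \<psi>] conjI allI impI)
      fix i x assume "i \<le> n"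
      then show "norm (\<psi> i x) \<le> 1" using \<phi>(1)[of i] by (auto simp: \<psi>_def norm_mult intro: mult_le_one)
    next
      fix i and x y :: "nat \<Rightarrow> 'a" assume *: "i \<le> n" "\<forall>j\<le>n. j \<noteq> i \<longrightarrow> x j = y j"
      have "\<phi> i (x(Suc n := z)) = \<phi> i (y(Suc n := z))" for z
        using * by (intro \<phi>(2)) (auto simp: le_Suc_eq)
      then show "\<psi> i x = \<psi> i y" by (simp add: \<psi>_def)
    qed (auto simp: g_def \<psi>_def prod.distrib)
    then show "norm (N (\<lambda>x. g (x, \<xi>, \<xi>'))) \<le> 1" using Suc.IH[OF N] by simp
  qed
  then show ?case
    using subprob_Cauchy_Schwarz[OF P(1), of "\<lambda>x. \<phi> (Suc n) (fst x)" v] \<phi>(1)[of "Suc n"]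
    unfolding LF vv by simp
qed

section \<open>Goodness under averages, phases and absolutely convex combinations\<close>

lemma mixI: "subprob {(N, \<xi>). G N} Q \<Longrightarrow> (\<And>g. R g = Q (\<lambda>(N, \<xi>). N (\<lambda>x. g (x, \<xi>)))) \<Longrightarrow> mix G R"
  unfolding mix_def by blast

lemma mix_bind:
  assumes "subprob X Q" "\<And>x. x \<in> X \<Longrightarrow> mix G (R x)"
  shows "mix G (\<lambda>g. Q (\<lambda>x. R x g))"
proof -
  obtain q where q: "\<And>x. x \<in> X \<Longrightarrow> subprob {(N, \<xi>). G N} (q x)"
    "\<And>x. x \<in> X \<Longrightarrow> R x = (\<lambda>g. q x (\<lambda>(N, \<xi>). N (\<lambda>x. g (x, \<xi>))))"
    using assms(2) unfolding mix_def by metis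
  show ?thesis
  proof (rule mixI[OF subprob_bind[OF assms(1) q(1)]])
    show "Q (\<lambda>x. R x g) = Q (\<lambda>x. q x (\<lambda>(N, \<xi>). N (\<lambda>x. g (x, \<xi>))))" for g
      by (rule subprob_cong[OF assms(1)]) (simp add: q(2))
  qed
qed

lemma mix_const: "G L \<Longrightarrow> mix G (\<lambda>g. L (\<lambda>x. g (x, l)))"
  by (rule mixI[OF subprob_point[of "(L, l)"]]) auto

lemma good_bind:
  assumes Q: "subprob X Q" and K: "\<And>x. x \<in> X \<Longrightarrow> good n (K x)"
  shows "good n (\<lambda>f. Q (\<lambda>x. K x f))"
proof (cases n)
  case 0
  have "lin (\<lambda>f. Q (\<lambda>x. K x f))"
    unfolding lin_def
  proof (intro conjI allI)
    show "Q (\<lambda>x. K x (\<lambda>y. f y + g y)) = Q (\<lambda>x. K x f) + Q (\<lambda>x. K x g)" for f g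
      unfolding linD(1)[OF lin_subprob[OF Q], symmetric]
      by (rule subprob_cong[OF Q]) (simp add: linD(1)[OF lin_good[OF K]])
    show "Q (\<lambda>x. K x (\<lambda>y. c * f y)) = c * Q (\<lambda>x. K x f)" for c f
      unfolding linD(2)[OF lin_subprob[OF Q], symmetric]
      by (rule subprob_cong[OF Q]) (simp add: linD(2)[OF lin_good[OF K]])
  qed
  moreover have "norm (Q (\<lambda>x. K x (\<lambda>_. 1))) \<le> 1"
    by (rule subprob_norm_le[OF Q]) (use K 0 in auto)
  ultimately show ?thesis using 0 by simp
next
  case (Suc m)
  obtain P where P: "\<And>x. x \<in> X \<Longrightarrow> subprob UNIV (P x)" "\<And>x. x \<in> X \<Longrightarrow> K x = present (Suc m) (P x)"
    "\<And>x. x \<in> X \<Longrightarrow> mix (good m) (pair_law (P x))"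
    using K unfolding Suc good.simps by metis
  have 1: "subprob UNIV (\<lambda>\<phi>. Q (\<lambda>x. P x \<phi>))" by (rule subprob_bind[OF Q P(1)])
  have 2: "(\<lambda>f. Q (\<lambda>x. K x f)) = present (Suc m) (\<lambda>\<phi>. Q (\<lambda>x. P x \<phi>))"
    unfolding present_def by (intro ext subprob_cong[OF Q]) (simp add: P(2) present_def)
  have 3: "pair_law (\<lambda>\<phi>. Q (\<lambda>x. P x \<phi>)) = (\<lambda>g. Q (\<lambda>x. pair_law (P x) g))"
    unfolding pair_law_def by simp
  have "mix (good m) (pair_law (\<lambda>\<phi>. Q (\<lambda>x. P x \<phi>)))"
    unfolding 3 by (rule mix_bind[OF Q P(3)])
  with 1 2 show ?thesis unfolding Suc good.simps by blast
qed

text \<open>The unimodular constant moves into the weights of the candidates. The pair law carries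
  it once plain and once conjugated, so it disappears there.\<close>

lemma good_phase:
  assumes "good n L" "norm c = 1"
  shows "good n (\<lambda>f. c * L f)"
proof (cases n)
  case 0
  then show ?thesis using assms by (auto simp: lin_def norm_mult algebra_simps)
next
  case (Suc m)
  obtain P where P: "subprob UNIV P" "L = present (Suc m) P" "mix (good m) (pair_law P)"
    using assms(1) unfolding Suc good.simps by blast
  define h :: "(nat \<Rightarrow> 'a) \<times> (complex \<times> 'a) list \<Rightarrow> (nat \<Rightarrow> 'a) \<times> (complex \<times> 'a) list"
    where "h = (\<lambda>(Y, es). (Y, map (\<lambda>(w, z). (c * w, z)) es))"
  have f: "fsum (map (\<lambda>(w, z). (c * w, z)) es) f = c * fsum es f" for c es and f :: "'a \<Rightarrow> complex"
    by (induction es) (auto simp: algebra_simps)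
  have cc: "cnj_weights (map (\<lambda>(w, z). (c * w, z)) es) = map (\<lambda>(w, z). (cnj c * w, z)) (cnj_weights es)"
    for es :: "(complex \<times> 'a) list"
    by (auto simp: cnj_weights_def)
  have "c * cnj c = 1" using assms(2) by (metis complex_norm_square of_real_1 power_one)
  then have g: "cnj c * (c * z) = z" for z by (simp add: mult.left_commute flip: mult.assoc)
  have 1: "subprob UNIV (\<lambda>\<phi>. P (\<lambda>x. \<phi> (h x)))" by (rule subprob_map[OF P(1)]) simp
  have 2: "(\<lambda>f. c * L f) = present (Suc m) (\<lambda>\<phi>. P (\<lambda>x. \<phi> (h x)))"
    unfolding P(2) present_def h_def
    by (simp add: case_prod_unfold f[unfolded case_prod_unfold] linD(2)[OF lin_subprob[OF P(1)]])
  have 3: "pair_law (\<lambda>\<phi>. P (\<lambda>x. \<phi> (h x))) = pair_law P"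
    unfolding pair_law_def h_def
    by (simp add: case_prod_unfold cc[unfolded case_prod_unfold] f[unfolded case_prod_unfold]
        linD(2)[OF lin_fsum] g)
  have "mix (good m) (pair_law (\<lambda>\<phi>. P (\<lambda>x. \<phi> (h x))))"
    unfolding 3 by (rule P(3))
  with 1 2 show ?thesis unfolding Suc good.simps by blast
qed

lemma mix_phase:
  assumes "mix (good n) R" "norm c = 1"
  shows "mix (good n) (\<lambda>g. c * R g)"
proof -
  obtain Q where Q: "subprob {(N, \<xi>). good n N} Q" "R = (\<lambda>g. Q (\<lambda>(N, \<xi>). N (\<lambda>x. g (x, \<xi>))))"
    using assms(1) unfolding mix_def by blast
  show ?thesis
  proof (rule mixI)
    show "subprob {(N, \<xi>). good n N} (\<lambda>f. Q (\<lambda>x. f (case x of (N, \<xi>) \<Rightarrow> (\<lambda>f. c * N f, \<xi>))))"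
      by (rule subprob_map[OF Q(1)]) (auto intro: good_phase assms(2))
  qed (simp add: Q(2) case_prod_unfold linD(2)[OF lin_subprob[OF Q(1)]])
qed

text \<open>Each coefficient is split into its modulus and its phase.\<close>

lemma mix_combination:
  assumes I: "finite I" "(\<Sum>i\<in>I. norm (c i)) \<le> 1" and R: "\<And>i. i \<in> I \<Longrightarrow> c i \<noteq> 0 \<Longrightarrow> mix (good n) (R i)"
  shows "mix (good n) (\<lambda>g. \<Sum>i\<in>I. c i * R i g)"
proof -
  have "subprob {i \<in> I. c i \<noteq> 0} (\<lambda>f. \<Sum>i\<in>I. of_real (norm (c i)) * f i)"
    by (rule subprob_convex) (use I in \<open>auto intro: subprob_point\<close>)
  then have "mix (good n) (\<lambda>g. \<Sum>i\<in>I. of_real (norm (c i)) * (sgn (c i) * R i g))"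
    by (rule mix_bind) (auto intro: mix_phase R simp: norm_sgn)
  moreover have "of_real (norm (c i)) * (sgn (c i) * z) = c i * z" for i z
    by (cases "c i = 0") (auto simp: sgn_eq)
  ultimately show ?thesis by simp
qed

lemma good_combination:
  assumes I: "finite I" "(\<Sum>i\<in>I. norm (c i)) \<le> 1" and L: "\<And>i. i \<in> I \<Longrightarrow> c i \<noteq> 0 \<Longrightarrow> good n (L i)"
  shows "good n (\<lambda>f. \<Sum>i\<in>I. c i * L i f)"
proof -
  have "subprob {i \<in> I. c i \<noteq> 0} (\<lambda>f. \<Sum>i\<in>I. of_real (norm (c i)) * f i)"
    by (rule subprob_convex) (use I in \<open>auto intro: subprob_point\<close>)
  then have "good n (\<lambda>g. \<Sum>i\<in>I. of_real (norm (c i)) * (sgn (c i) * L i g))"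
    by (rule good_bind) (auto intro: good_phase L simp: norm_sgn)
  moreover have "of_real (norm (c i)) * (sgn (c i) * z) = c i * z" for i z
    by (cases "c i = 0") (auto simp: sgn_eq)
  ultimately show ?thesis by simp
qed

lemma good_point: "good n (\<lambda>f. f x)"
proof (induction n)
  case (Suc n)
  let ?P = "\<lambda>\<phi>. \<phi> (x, [(1 :: complex, x (Suc n))])"
  have "subprob UNIV ?P" by (rule subprob_point) simp
  moreover have "(\<lambda>f. f x) = present (Suc n) ?P" by (simp add: present_def fun_upd_idem fun_eq_iff)
  moreover have "pair_law ?P = (\<lambda>g. g (x, (x (Suc n), x (Suc n))))"
    by (simp add: pair_law_def cnj_weights_def fun_eq_iff)
  ultimately show ?case using mix_const[of "good n" "\<lambda>f. f x", OF Suc] unfolding good.simps by metis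
qed (simp add: lin_def)

section \<open>Tensor products of good functionals\<close>

definition glue :: "(nat \<Rightarrow> 'a \<Rightarrow> 'b \<Rightarrow> 'c) \<Rightarrow> (nat \<Rightarrow> 'a) \<Rightarrow> (nat \<Rightarrow> 'b) \<Rightarrow> nat \<Rightarrow> 'c" where
  "glue h x y = (\<lambda>r. h r (x r) (y r))"

lemma mix_glue:
  assumes glue: "\<And>N N'. good n N \<Longrightarrow> good n N' \<Longrightarrow> good n (\<lambda>f. N (\<lambda>x. N' (\<lambda>y. f (glue h x y))))"
    and "mix (good n) R" "mix (good n) R'"
  shows "mix (good n) (\<lambda>g. R (\<lambda>(x, l). R' (\<lambda>(y, l'). g (glue h x y, H l l'))))"
proof -
  obtain Q where Q: "subprob {(N, \<xi>). good n N} Q" "R = (\<lambda>g. Q (\<lambda>(N, \<xi>). N (\<lambda>x. g (x, \<xi>))))"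
    using assms(2) unfolding mix_def by blast
  obtain Q' where Q': "subprob {(N, \<xi>). good n N} Q'" "R' = (\<lambda>g. Q' (\<lambda>(N, \<xi>). N (\<lambda>x. g (x, \<xi>))))"
    using assms(3) unfolding mix_def by blast
  show ?thesis
  proof (rule mixI)
    show "subprob {(N, \<xi>). good n N} (\<lambda>\<phi>. Q (\<lambda>(N, \<xi>). Q' (\<lambda>(N', \<xi>').
        \<phi> (\<lambda>f. N (\<lambda>x. N' (\<lambda>y. f (glue h x y))), H \<xi> \<xi>'))))"
      unfolding case_prod_unfold
      by (intro subprob_bind[OF Q(1)] subprob_map[OF Q'(1)]) (auto intro: glue)
    fix g
    have "N (\<lambda>x. Q' (\<lambda>p. fst p (\<lambda>y. g (glue h x y, H \<xi> (snd p))))) =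
      Q' (\<lambda>p. N (\<lambda>x. fst p (\<lambda>y. g (glue h x y, H \<xi> (snd p)))))" if "good n N" for N \<xi>
      by (rule subprob_swap[OF Q'(1) lin_good[OF that]])
    then show "R (\<lambda>(x, l). R' (\<lambda>(y, l'). g (glue h x y, H l l'))) = Q (\<lambda>(N, \<xi>). Q' (\<lambda>(N', \<xi>').
        (\<lambda>(N, \<xi>). N (\<lambda>x. g (x, \<xi>))) (\<lambda>f. N (\<lambda>x. N' (\<lambda>y. f (glue h x y))), H \<xi> \<xi>')))"
      unfolding Q(2) Q'(2) case_prod_unfold
      by (intro subprob_cong[OF Q(1)]) auto
  qed
qed

lemma fsum_product:
  "fsum (concat (map (\<lambda>(w, z). map (\<lambda>(w', z'). (w * w', h z z')) es') es)) f =
   fsum es (\<lambda>z. fsum es' (\<lambda>z'. f (h z z')))"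
proof -
  have *: "fsum (map (\<lambda>(w', z'). (w * w', h z z')) es') f = w * fsum es' (\<lambda>z'. f (h z z'))" for w z
    by (induction es') (auto simp: algebra_simps)
  show ?thesis by (induction es) (auto simp: *)
qed

lemma cnj_weights_product:
  "cnj_weights (concat (map (\<lambda>(w, z). map (\<lambda>(w', z'). (w * w', h z z')) es') es)) =
   concat (map (\<lambda>(w, z). map (\<lambda>(w', z'). (w * w', h z z')) (cnj_weights es')) (cnj_weights es))"
  by (induction es) (auto simp: cnj_weights_def)

text \<open>Two certificates run independently: candidates are paired and their weights multiplied,
  so the pair law of the product is the product of the pair laws, to which the induction hypothesis
  applies.\<close>

lemma good_glue: "good n L \<Longrightarrow> good n M \<Longrightarrow> good n (\<lambda>f. L (\<lambda>x. M (\<lambda>y. f (glue h x y))))"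
proof (induction n arbitrary: L M)
  case 0
  have "lin (\<lambda>f. L (\<lambda>x. M (\<lambda>y. f (glue h x y))))" using 0 by (simp add: lin_def)
  moreover have "L (\<lambda>x. M (\<lambda>y. 1)) = L (\<lambda>_. 1) * M (\<lambda>_. 1)" using 0 lin_multr[of L "\<lambda>_. 1" "M (\<lambda>_. 1)"] by simp
  ultimately show ?case using 0 by (auto simp: norm_mult intro: mult_le_one)
next
  case (Suc n)
  obtain P where P: "subprob UNIV P" "L = present (Suc n) P" "mix (good n) (pair_law P)"
    using Suc.prems(1) by auto
  obtain P' where P': "subprob UNIV P'" "M = present (Suc n) P'" "mix (good n) (pair_law P')"
    using Suc.prems(2) by auto
  define pr where "pr es es' = concat (map (\<lambda>(w, z). map (\<lambda>(w', z'). (w * w', h (Suc n) z z')) es') es)"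
    for es :: "(complex \<times> 'a) list" and es' :: "(complex \<times> 'b) list"
  define P'' where "P'' = (\<lambda>\<phi>. P (\<lambda>u. P' (\<lambda>v. \<phi> (glue h (fst u) (fst v), pr (snd u) (snd v)))))"
  note fp = fsum_product[of "h (Suc n)", folded pr_def] and cp = cnj_weights_product[of "h (Suc n)", folded pr_def]
  note sw = subprob_swap[OF P'(1) lin_fsum]
  have 1: "subprob UNIV P''" unfolding P''_def
    by (rule subprob_bind[OF P(1)], rule subprob_map[OF P'(1)]) auto
  have upd: "glue h (Y(Suc n := z)) (Y'(Suc n := z')) = (glue h Y Y')(Suc n := h (Suc n) z z')" for Y Y' z z'
    by (auto simp: glue_def)
  have 2: "(\<lambda>f. L (\<lambda>x. M (\<lambda>y. f (glue h x y)))) = present (Suc n) P''"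
    unfolding P''_def P(2) P'(2) present_def by (simp add: case_prod_unfold fp upd sw)
  have 3: "pair_law P'' = (\<lambda>g. pair_law P (\<lambda>(x, l). pair_law P' (\<lambda>(y, l').
      g (glue h x y, (\<lambda>(z, u) (z', u'). (h (Suc n) z z', h (Suc n) u u')) l l'))))"
  proof
    fix g
    have "fsum A (\<lambda>z. fsum B (\<lambda>z'. fsum C (\<lambda>u. f z z' u))) = fsum A (\<lambda>z. fsum C (\<lambda>u. fsum B (\<lambda>z'. f z z' u)))"
      for A B C and f :: "'a \<Rightarrow> 'b \<Rightarrow> 'a \<Rightarrow> complex"
      by (rule arg_cong[where f = "fsum A"], rule ext, rule fsum_swap[OF lin_fsum])
    note sw2 = this
    show "pair_law P'' g = pair_law P (\<lambda>(x, l). pair_law P' (\<lambda>(y, l').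
      g (glue h x y, (\<lambda>(z, u) (z', u'). (h (Suc n) z z', h (Suc n) u u')) l l')))"
      unfolding P''_def pair_law_def case_prod_unfold
      by (simp add: fp cp sw sw2)
  qed
  have "mix (good n) (pair_law P'')"
    unfolding 3 by (rule mix_glue[OF Suc.IH P(3) P'(3)])
  with 1 2 show ?case unfolding good.simps by blast
qed

lemmas mix_good_glue = mix_glue[OF good_glue]

lemma good_rowwise: "good n L \<Longrightarrow> good n (\<lambda>f. L (\<lambda>x. f (\<lambda>r. h r (x r))))"
  using good_glue[OF _ good_point, of n L "\<lambda>r z _. h r z" undefined] by (simp add: glue_def)

lemma mix_map:
  assumes "mix (good n) R"
  shows "mix (good n) (\<lambda>g. R (\<lambda>(x, l). g (\<lambda>r. h r (x r), H l)))"
proof -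
  obtain Q where Q: "subprob {(N, \<xi>). good n N} Q" "R = (\<lambda>g. Q (\<lambda>(N, \<xi>). N (\<lambda>x. g (x, \<xi>))))"
    using assms(1) unfolding mix_def by blast
  show ?thesis
  proof (rule mixI)
    show "subprob {(N, \<xi>). good n N} (\<lambda>f. Q (\<lambda>x. f (case x of (N, \<xi>) \<Rightarrow> (\<lambda>f. N (\<lambda>x. f (\<lambda>r. h r (x r))), H \<xi>))))"
      by (rule subprob_map[OF Q(1)]) (auto intro: good_rowwise)
  qed (simp add: Q(2) case_prod_unfold)
qed

lemma good_of_mix: "mix (good n) R \<Longrightarrow> good n (\<lambda>f. R (\<lambda>(x, l). f x))"
proof -
  assume "mix (good n) R"
  then obtain Q where Q: "subprob {(N, \<xi>). good n N} Q" "R = (\<lambda>g. Q (\<lambda>(N, \<xi>). N (\<lambda>x. g (x, \<xi>))))"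
    unfolding mix_def by blast
  have "good n (\<lambda>f. Q (\<lambda>x. (\<lambda>(N, \<xi>). N) x f))"
    by (rule good_bind[OF Q(1)]) auto
  then show ?thesis unfolding Q(2) by (simp add: case_prod_unfold)
qed

section \<open>The convolution ring of random multisets\<close>

text \<open>The product of finitely supported functions on an additive monoid is convolution, here
  the law of the sum of independent multisets. Regrouping independent batches of columns thus
  becomes computation in a commutative ring.\<close>

type_synonym 'c law = "'c multiset \<Rightarrow>\<^sub>0 complex"

abbreviation mon :: "'c multiset \<Rightarrow> 'c law" where "mon M \<equiv> Poly_Mapping.single M 1"
abbreviation sc :: "complex \<Rightarrow> 'c law" where "sc c \<equiv> Poly_Mapping.single 0 c"

definition ext :: "('c multiset \<Rightarrow> complex) \<Rightarrow> 'c law \<Rightarrow> complex" where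
  "ext \<phi> \<mu> = (\<Sum>M\<in>Poly_Mapping.keys \<mu>. Poly_Mapping.lookup \<mu> M * \<phi> M)"

definition push :: "('c \<Rightarrow> 'd) \<Rightarrow> 'c law \<Rightarrow> 'd law" where
  "push h \<mu> = (\<Sum>M\<in>Poly_Mapping.keys \<mu>. Poly_Mapping.single (image_mset h M) (Poly_Mapping.lookup \<mu> M))"

lemma law_induct [case_names single add]:
  assumes "\<And>M c. P (Poly_Mapping.single M c)" "\<And>\<mu> \<nu>. P \<mu> \<Longrightarrow> P \<nu> \<Longrightarrow> P (\<mu> + \<nu>)"
  shows "P (\<mu> :: 'c law)"
proof -
  have "\<mu> = (\<Sum>M\<in>Poly_Mapping.keys \<mu>. Poly_Mapping.single M (Poly_Mapping.lookup \<mu> M))"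
    by (rule poly_mapping_eqI) (simp add: lookup_sum lookup_single when_def in_keys_iff)
  moreover have "P (\<Sum>M\<in>K. Poly_Mapping.single M (Poly_Mapping.lookup \<mu> M))" if "finite K" for K
    using that
  proof (induction K)
    case empty
    show ?case using assms(1)[of 0 0] by simp
  qed (simp add: assms)
  ultimately show ?thesis by (metis finite_keys)
qed

lemma ext_single [simp]: "ext \<phi> (Poly_Mapping.single M c) = c * \<phi> M"
  by (cases "c = 0") (simp_all add: ext_def)

lemma ext_add [simp]: "ext \<phi> (\<mu> + \<nu>) = ext \<phi> \<mu> + ext \<phi> \<nu>"
  unfolding ext_def by (rule setsum_keys_plus_distrib) (simp_all add: algebra_simps)

lemma ext_zero [simp]: "ext \<phi> 0 = 0"
  by (simp add: ext_def)

lemma ext_sum: "ext \<phi> (\<Sum>i\<in>I. \<mu> i) = (\<Sum>i\<in>I. ext \<phi> (\<mu> i))"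
  by (induction I rule: infinite_finite_induct) simp_all

lemma ext_mult: "ext \<phi> (\<mu> * \<nu>) = ext (\<lambda>M. ext (\<lambda>N. \<phi> (M + N)) \<nu>) \<mu>"
proof (induction \<mu> rule: law_induct)
  case (single M c)
  show ?case
    by (induction \<nu> rule: law_induct) (simp_all add: mult_single algebra_simps)
qed (simp add: algebra_simps)

lemma ext_scale [simp]: "ext \<phi> (sc c * \<mu>) = c * ext \<phi> \<mu>"
  by (simp add: ext_mult)

lemma lin_ext: "lin (\<lambda>\<phi>. ext \<phi> \<mu>)"
  by (simp add: lin_def ext_def algebra_simps sum.distrib sum_distrib_left)

lemma ext_swap: "lin L \<Longrightarrow> L (\<lambda>x. ext (\<phi> x) \<mu>) = ext (\<lambda>M. L (\<lambda>x. \<phi> x M)) \<mu>"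
  unfolding ext_def using lin_sum_scaled[of L "Poly_Mapping.lookup \<mu>" "\<lambda>M x. \<phi> x M"] by simp

lemma push_single [simp]: "push h (Poly_Mapping.single M c) = Poly_Mapping.single (image_mset h M) c"
  by (cases "c = 0") (simp_all add: push_def)

lemma push_add [simp]: "push h (\<mu> + \<nu>) = push h \<mu> + push h \<nu>"
  unfolding push_def by (rule setsum_keys_plus_distrib) (simp_all add: single_add)

lemma push_zero [simp]: "push h 0 = 0"
  by (simp add: push_def)

lemma push_mult [simp]: "push h (\<mu> * \<nu>) = push h \<mu> * push h \<nu>"
proof (induction \<mu> rule: law_induct)
  case (single M c)
  show ?case
    by (induction \<nu> rule: law_induct) (simp_all add: mult_single algebra_simps)
qed (simp add: algebra_simps)

lemma push_one [simp]: "push h 1 = 1"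
  using push_single[of h 0 1] by (simp del: push_single)

lemma push_power [simp]: "push h (\<mu> ^ m) = push h \<mu> ^ m"
  by (induction m) simp_all

lemma push_uminus [simp]: "push h (- \<mu>) = - push h \<mu>"
  using push_add[of h \<mu> "- \<mu>"] by (simp add: eq_neg_iff_add_eq_0 add.commute)

lemma push_diff [simp]: "push h (\<mu> - \<nu>) = push h \<mu> - push h \<nu>"
  using push_add[of h \<mu> "- \<nu>"] by simp

lemma push_prod: "push h (\<Prod>i\<in>I. \<mu> i) = (\<Prod>i\<in>I. push h (\<mu> i))"
  by (induction I rule: infinite_finite_induct) simp_all

lemma push_push [simp]: "push g (push h \<mu>) = push (\<lambda>x. g (h x)) \<mu>"
  by (induction \<mu> rule: law_induct) (simp_all add: image_mset.compositionality comp_def)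

lemma ext_push: "ext \<phi> (push h \<mu>) = ext (\<lambda>M. \<phi> (image_mset h M)) \<mu>"
  by (induction \<mu> rule: law_induct) simp_all

lemma sc_mult_sc [simp]: "sc a * sc b = (sc (a * b) :: 'c law)"
  by (simp add: mult_single)

section \<open>Laws on multisets of one size, and nonnegative laws\<close>

definition homog :: "nat \<Rightarrow> 'c law \<Rightarrow> bool" where
  "homog a \<mu> \<longleftrightarrow> (\<forall>M\<in>Poly_Mapping.keys \<mu>. size M = a)"

lemma homog_single: "size M = a \<Longrightarrow> homog a (Poly_Mapping.single M c)"
  by (simp add: homog_def)

lemma homog_add: "homog a \<mu> \<Longrightarrow> homog a \<nu> \<Longrightarrow> homog a (\<mu> + \<nu>)"
  unfolding homog_def using keys_add[of \<mu> \<nu>] by blast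

lemma homog_mult: "homog a \<mu> \<Longrightarrow> homog b \<nu> \<Longrightarrow> homog (a + b) (\<mu> * \<nu>)"
  unfolding homog_def using keys_mult[of \<mu> \<nu>] by force

lemma homog_scale: "homog a \<mu> \<Longrightarrow> homog a (sc c * \<mu>)"
  using homog_mult[OF homog_single[of 0 0 c]] by fastforce

lemma homog_zero: "homog a 0"
  by (simp add: homog_def)

lemma homog_sum: "(\<And>i. i \<in> I \<Longrightarrow> homog a (\<mu> i)) \<Longrightarrow> homog a (\<Sum>i\<in>I. \<mu> i)"
  by (induction I rule: infinite_finite_induct) (auto intro: homog_add homog_zero)

lemma homog_one: "homog 0 1"
  using homog_single[of 0 0 1] by simp

lemma homog_power: "homog a \<mu> \<Longrightarrow> homog (m * a) (\<mu> ^ m)"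
  by (induction m) (auto intro: homog_one homog_mult)

lemma homog_prod: "(\<And>i. i \<in> I \<Longrightarrow> homog (a i) (\<mu> i)) \<Longrightarrow> homog (\<Sum>i\<in>I. a i) (\<Prod>i\<in>I. \<mu> i)"
  by (induction I rule: infinite_finite_induct) (auto intro: homog_one homog_mult)

lemma homog_push: "homog a \<mu> \<Longrightarrow> homog a (push h \<mu>)"
  unfolding push_def by (rule homog_sum) (simp add: homog_def)

lemma ext_cong_homog: "homog a \<mu> \<Longrightarrow> (\<And>M. size M = a \<Longrightarrow> \<phi> M = \<psi> M) \<Longrightarrow> ext \<phi> \<mu> = ext \<psi> \<mu>"
  unfolding ext_def homog_def by (rule sum.cong) auto

definition prob_law :: "'c multiset set \<Rightarrow> 'c law \<Rightarrow> bool" where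
  "prob_law X \<mu> \<longleftrightarrow> subprob X (\<lambda>\<phi>. ext \<phi> \<mu>)"

lemma prob_law_mon: "M \<in> X \<Longrightarrow> prob_law X (mon M)"
  unfolding prob_law_def by (simp add: subprob_point)

lemma prob_law_one: "0 \<in> X \<Longrightarrow> prob_law X 1"
  using prob_law_mon[of 0 X] by simp

lemma prob_law_mult:
  assumes "prob_law X \<mu>" "prob_law Y \<nu>" "\<And>M N. M \<in> X \<Longrightarrow> N \<in> Y \<Longrightarrow> M + N \<in> Z"
  shows "prob_law Z (\<mu> * \<nu>)"
  unfolding prob_law_def ext_mult
proof (rule subprob_bind[of X "\<lambda>\<phi>. ext \<phi> \<mu>" Z "\<lambda>M \<phi>. ext (\<lambda>N. \<phi> (M + N)) \<nu>"])
  show "subprob X (\<lambda>\<phi>. ext \<phi> \<mu>)" using assms(1) by (simp only: prob_law_def)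
  show "subprob Z (\<lambda>\<phi>. ext (\<lambda>N. \<phi> (M + N)) \<nu>)" if "M \<in> X" for M
    by (rule subprob_map[of Y "\<lambda>\<phi>. ext \<phi> \<nu>" "\<lambda>N. M + N" Z]) (use assms(2,3) that in \<open>auto simp: prob_law_def\<close>)
qed

lemma prob_law_power:
  assumes "prob_law X \<mu>" "0 \<in> X" "\<And>M N. M \<in> X \<Longrightarrow> N \<in> X \<Longrightarrow> M + N \<in> X"
  shows "prob_law X (\<mu> ^ m)"
proof (induction m)
  case (Suc m)
  show ?case unfolding power_Suc by (rule prob_law_mult[OF assms(1) Suc assms(3)])
qed (simp add: prob_law_one assms(2))

lemma prob_law_prod:
  assumes "\<And>i. i \<in> I \<Longrightarrow> prob_law X (\<mu> i)" "0 \<in> X" "\<And>M N. M \<in> X \<Longrightarrow> N \<in> X \<Longrightarrow> M + N \<in> X"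
  shows "prob_law X (\<Prod>i\<in>I. \<mu> i)"
  using assms(1)
proof (induction I rule: infinite_finite_induct)
  case (insert i I)
  have "prob_law X (\<mu> i * (\<Prod>i\<in>I. \<mu> i))"
    by (rule prob_law_mult[OF _ _ assms(3)]) (use insert in auto)
  then show ?case using insert.hyps by simp
qed (simp_all add: prob_law_one assms(2))

lemma prob_law_push: "prob_law X \<mu> \<Longrightarrow> (\<And>M. M \<in> X \<Longrightarrow> image_mset h M \<in> Y) \<Longrightarrow> prob_law Y (push h \<mu>)"
  unfolding prob_law_def ext_push by (rule subprob_map[of X "\<lambda>\<phi>. ext \<phi> \<mu>"])

lemma prob_law_mono: "prob_law X \<mu> \<Longrightarrow> X \<subseteq> Y \<Longrightarrow> prob_law Y \<mu>"
  unfolding prob_law_def by (rule subprob_mono)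

lemma prob_law_avg:
  assumes "prob_law X \<mu>" "prob_law X \<nu>"
  shows "prob_law X (sc (1/2) * (\<mu> + \<nu>))"
proof -
  have "subprob X (\<lambda>\<phi>. if i then ext \<phi> \<mu> else ext \<phi> \<nu>)" for i
    using assms by (cases i) (auto simp: prob_law_def)
  then show ?thesis
    using subprob_convex[of "UNIV :: bool set" "\<lambda>_. 1/2" X "\<lambda>b \<phi>. if b then ext \<phi> \<mu> else ext \<phi> \<nu>"]
    by (auto simp: prob_law_def UNIV_bool add_divide_distrib add.commute)
qed

section \<open>Uniformly random arrangements\<close>

text \<open>The value 0 for a multiset of the wrong size is harmless because \<open>subprob\<close>
  and \<open>good\<close> are upper bounds; it allows goodness to be stated for all finite
  \<open>S\<close> at once.\<close>

definition arr :: "'p set \<Rightarrow> 'c multiset \<Rightarrow> (('p \<Rightarrow> 'c) \<Rightarrow> complex) \<Rightarrow> complex" where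
  "arr S M f = (if size M = card S then
     \<Sum>\<pi> | \<pi> permutes S. of_real (1 / fact (card S)) *
       f (restrict ((SOME x. image_mset x (mset_set S) = M) \<circ> \<pi>) S) else 0)"

lemma ex_arrangement: "finite S \<Longrightarrow> size M = card S \<Longrightarrow> \<exists>x. image_mset x (mset_set S) = M"
proof (induction S arbitrary: M rule: finite_induct)
  case (insert p S)
  then obtain c N where M: "M = add_mset c N" "size N = card S"
    by (metis card_insert_disjoint size_eq_Suc_imp_eq_union size_add_mset nat.inject)
  from insert.IH[OF M(2)] obtain x where x: "image_mset x (mset_set S) = N" by blast
  have "image_mset (x(p := c)) (mset_set S) = image_mset x (mset_set S)"
    using insert.hyps by (intro image_mset_cong) auto
  then have "image_mset (x(p := c)) (mset_set (insert p S)) = M" using insert.hyps x M(1)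
    by (simp del: fun_upd_apply) simp
  then show ?case by blast
qed simp

text \<open>The representative picked by \<open>SOME\<close> does not matter: two arrangements of
  the same multiset differ by a permutation of the positions, which the average absorbs.\<close>

lemma arr_eq:
  assumes S: "finite S" and x: "image_mset x (mset_set S) = M"
  shows "arr S M f = (\<Sum>\<pi> | \<pi> permutes S. of_real (1 / fact (card S)) * f (restrict (x \<circ> \<pi>) S))"
proof -
  define x0 where "x0 = (SOME x. image_mset x (mset_set S) = M)"
  have x0: "image_mset x0 (mset_set S) = M" unfolding x0_def by (rule someI[of _ x]) (rule x)
  have M: "size M = card S" using x by (metis size_image_mset size_mset_set)
  obtain q where q: "q permutes S" "\<forall>s\<in>S. x0 s = x (q s)"
    using image_mset_eq_implies_permutes[OF S, of x0 x] x x0 by auto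
  have "restrict (x0 \<circ> \<pi>) S = restrict (x \<circ> (q \<circ> \<pi>)) S" if "\<pi> permutes S" for \<pi>
    using q(2) permutes_in_image[OF that] by (auto simp: restrict_def)
  then have "arr S M f = (\<Sum>\<pi> | \<pi> permutes S. of_real (1 / fact (card S)) * f (restrict (x \<circ> (q \<circ> \<pi>)) S))"
    unfolding arr_def x0_def[symmetric] using M by (auto intro!: sum.cong)
  also have "\<dots> = (\<Sum>\<pi> | \<pi> permutes S. of_real (1 / fact (card S)) * f (restrict (x \<circ> \<pi>) S))"
    by (rule setum_permutations_compose_left[OF q(1), symmetric])
  finally show ?thesis .
qed

lemma image_mset_permuted:
  assumes "\<pi> permutes S" "image_mset x (mset_set S) = M"
  shows "image_mset (restrict (x \<circ> \<pi>) S) (mset_set S) = M"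
proof (cases "finite S")
  case True
  have "image_mset (restrict (x \<circ> \<pi>) S) (mset_set S) = image_mset (x \<circ> \<pi>) (mset_set S)"
    using True by (intro image_mset_cong) auto
  also have "\<dots> = image_mset x (image_mset \<pi> (mset_set S))"
    by (simp add: image_mset.compositionality)
  finally show ?thesis using permutes_image_mset[OF assms(1)] assms(2) by simp
qed (use assms in simp)

lemma sum_permutes_weights: "finite S \<Longrightarrow> (\<Sum>\<pi> | \<pi> permutes S. 1 / fact (card S)) = (1 :: real)"
  using card_permutations[of S "card S"] by simp

lemma subprob_arr:
  assumes "finite S"
  shows "subprob {x. image_mset x (mset_set S) = M} (arr S M)"
proof (cases "size M = card S")
  case True
  obtain x where x: "image_mset x (mset_set S) = M" using ex_arrangement[OF assms True] by blast
  have "subprob {x. image_mset x (mset_set S) = M}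
    (\<lambda>f. \<Sum>\<pi> | \<pi> permutes S. of_real (1 / fact (card S)) * f (restrict (x \<circ> \<pi>) S))"
    using assms x
    by (intro subprob_convex)
      (auto simp: card_permutations finite_permutations intro!: subprob_point image_mset_permuted)
  then show ?thesis using arr_eq[OF assms x] by (metis (no_types, lifting) ext)
next
  case False
  then show ?thesis by (simp add: arr_def[abs_def] subprob_zero)
qed

lemmas lin_arr = lin_subprob[OF subprob_arr]

lemma arr_const: "finite S \<Longrightarrow> size M = card S \<Longrightarrow> arr S M (\<lambda>_. c) = c"
  using sum_permutes_weights[of S] by (simp add: arr_def card_permutations)

lemma arr_size: "size M \<noteq> card S \<Longrightarrow> arr S M f = 0"
  by (simp add: arr_def)

lemma arr_image:
  assumes S: "finite S"
  shows "arr S (image_mset h M) f = arr S M (\<lambda>x. f (restrict (h \<circ> x) S))"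
proof (cases "size M = card S")
  case True
  obtain x where x: "image_mset x (mset_set S) = M" using ex_arrangement[OF S True] by blast
  then have hx: "image_mset (h \<circ> x) (mset_set S) = image_mset h M"
    by (simp flip: image_mset.compositionality)
  have "restrict (h \<circ> restrict (x \<circ> \<pi>) S) S = restrict (h \<circ> x \<circ> \<pi>) S" for \<pi>
    by (auto simp: restrict_def)
  then show ?thesis unfolding arr_eq[OF S x] arr_eq[OF S hx] by simp
qed (simp add: arr_size)

definition merge_at :: "'p set \<Rightarrow> ('p \<Rightarrow> 'c) \<Rightarrow> ('p \<Rightarrow> 'c) \<Rightarrow> 'p \<Rightarrow> 'c" where
  "merge_at U x y = (\<lambda>p. if p \<in> U then x p else y p)"

text \<open>Averaging over the permutations of \<open>S\<close> makes the choice of the set \<open>U\<close> of positions of \<open>M\<close> irrelevant.\<close>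

lemma arr_union:
  assumes S: "finite S" and U: "U \<subseteq> S" and M: "size M = card U"
  shows "arr S (M + N) f = (\<Sum>\<pi> | \<pi> permutes S. of_real (1 / fact (card S)) *
    arr U M (\<lambda>x. arr (S - U) N (\<lambda>y. f (restrict (merge_at U x y \<circ> \<pi>) S))))"
proof (cases "size N = card (S - U)")
  case True
  have fin: "finite U" "finite (S - U)" using S U by (auto intro: finite_subset)
  have *: "(\<Sum>\<pi> | \<pi> permutes S. of_real (1 / fact (card S)) * f (restrict (merge_at U x y \<circ> \<pi>) S)) = arr S (M + N) f"
    if x: "image_mset x (mset_set U) = M" and y: "image_mset y (mset_set (S - U)) = N" for x y
  proof -
    have "mset_set S = mset_set U + mset_set (S - U)"
      using fin U by (simp flip: mset_set_Union) (metis Un_Diff_cancel Un_absorb1)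
    moreover have "image_mset (merge_at U x y) (mset_set U) = M"
      using fin unfolding x[symmetric] by (intro image_mset_cong) (auto simp: merge_at_def)
    moreover have "image_mset (merge_at U x y) (mset_set (S - U)) = N"
      using fin unfolding y[symmetric] by (intro image_mset_cong) (auto simp: merge_at_def)
    ultimately have "image_mset (merge_at U x y) (mset_set S) = M + N" by simp
    from arr_eq[OF S this] show ?thesis by simp
  qed
  note la = lin_arr[OF fin(1), of M] and lb = lin_arr[OF fin(2), of N]
  have "(\<Sum>\<pi> | \<pi> permutes S. of_real (1 / fact (card S)) *
    arr U M (\<lambda>x. arr (S - U) N (\<lambda>y. f (restrict (merge_at U x y \<circ> \<pi>) S)))) =
    arr U M (\<lambda>x. arr (S - U) N (\<lambda>y. \<Sum>\<pi> | \<pi> permutes S. of_real (1 / fact (card S)) *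
      f (restrict (merge_at U x y \<circ> \<pi>) S)))"
    by (subst lin_sum_scaled[OF lb], subst lin_sum_scaled[OF la]) simp
  also have "\<dots> = arr U M (\<lambda>x. arr (S - U) N (\<lambda>y. arr S (M + N) f))"
    by (intro subprob_cong[OF subprob_arr[OF fin(1)]] subprob_cong[OF subprob_arr[OF fin(2)]])
      (use * in simp)
  finally show ?thesis using fin M True by (simp add: arr_const)
next
  case False
  have "card S = card U + card (S - U)"
    using S U by (metis card_Diff_subset card_mono finite_subset le_add_diff_inverse)
  then have "size (M + N) \<noteq> card S" using False M by simp
  moreover have "arr U M (\<lambda>x. 0) = 0"
    using lin_zero[OF lin_arr[of U M]] S U finite_subset by blast
  ultimately show ?thesis using False by (simp add: arr_size)
qed

section \<open>Arrangements of labelled columns\<close>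

text \<open>A row is the set of positions that carry a 1, so rows over disjoint sets of positions
  are glued by union.\<close>

definition rows_of :: "nat set \<Rightarrow> (nat \<Rightarrow> (nat \<Rightarrow> bool) \<times> 'l) \<Rightarrow> nat \<Rightarrow> nat set" where
  "rows_of S x = (\<lambda>r. {p \<in> S. fst (x p) r})"

definition labels :: "nat set \<Rightarrow> (nat \<Rightarrow> (nat \<Rightarrow> bool) \<times> 'l) \<Rightarrow> nat \<Rightarrow> 'l" where
  "labels S x = restrict (\<lambda>p. snd (x p)) S"

definition arrangement :: "nat set \<Rightarrow> ((nat \<Rightarrow> bool) \<times> 'l) law \<Rightarrow>
    ((nat \<Rightarrow> nat set) \<times> (nat \<Rightarrow> 'l) \<Rightarrow> complex) \<Rightarrow> complex" where
  "arrangement S \<mu> g = ext (\<lambda>M. arr S M (\<lambda>x. g (rows_of S x, labels S x))) \<mu>"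

text \<open>The labels are those of \<open>mix\<close>: they are handed out together with a good
  functional for the bits. Quantifying over \<open>S\<close> lets a batch of columns be placed on
  any set of positions, as \<open>tgood_mult\<close> requires.\<close>

definition tgood :: "nat \<Rightarrow> nat \<Rightarrow> ((nat \<Rightarrow> bool) \<times> 'l) law \<Rightarrow> bool" where
  "tgood n a \<mu> \<longleftrightarrow> homog a \<mu> \<and> (\<forall>S. finite S \<longrightarrow> mix (good n) (arrangement S \<mu>))"

definition ugood :: "nat \<Rightarrow> nat \<Rightarrow> (nat \<Rightarrow> bool) law \<Rightarrow> bool" where
  "ugood n a \<mu> \<longleftrightarrow> homog a \<mu> \<and>
     (\<forall>S :: nat set. finite S \<longrightarrow> good n (\<lambda>f. ext (\<lambda>M. arr S M (\<lambda>x. f (\<lambda>r. {p \<in> S. x p r}))) \<mu>))"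

lemma homog_push_iff: "homog a (push (\<lambda>c. (c, l)) \<mu>) \<longleftrightarrow> homog a \<mu>"
proof
  assume "homog a (push (\<lambda>c. (c, l)) \<mu>)"
  then have "homog a (push fst (push (\<lambda>c. (c, l)) \<mu>))" by (rule homog_push)
  moreover have "push (\<lambda>x. x) \<mu> = \<mu>" by (induction \<mu> rule: law_induct) simp_all
  ultimately show "homog a \<mu>" by simp
qed (rule homog_push)

lemma arrangement_tag:
  assumes "finite S"
  shows "arrangement S (push (\<lambda>c. (c, l)) \<mu>) g =
    ext (\<lambda>M. arr S M (\<lambda>x. g (\<lambda>r. {p \<in> S. x p r}, restrict (\<lambda>_. l) S))) \<mu>"
proof -
  have "rows_of S (restrict ((\<lambda>c. (c, l)) \<circ> x) S) = (\<lambda>r. {p \<in> S. x p r})" for x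
    by (auto simp: rows_of_def)
  moreover have "labels S (restrict ((\<lambda>c. (c, l)) \<circ> x) S) = restrict (\<lambda>_. l) S" for x
    by (auto simp: labels_def)
  ultimately show ?thesis by (simp add: arrangement_def ext_push arr_image[OF assms])
qed

lemma tgood_tag:
  assumes "ugood n a \<mu>"
  shows "tgood n a (push (\<lambda>c. (c, l)) \<mu>)"
  unfolding tgood_def homog_push_iff
proof (intro conjI allI impI)
  show "homog a \<mu>" using assms by (simp add: ugood_def)
  fix S :: "nat set" assume S: "finite S"
  have "good n (\<lambda>f. ext (\<lambda>M. arr S M (\<lambda>x. f (\<lambda>r. {p \<in> S. x p r}))) \<mu>)"
    using assms S by (simp add: ugood_def)
  from mix_const[of "good n", OF this, of "restrict (\<lambda>_. l) S"]
  show "mix (good n) (arrangement S (push (\<lambda>c. (c, l)) \<mu>))"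
    unfolding arrangement_tag[OF S, abs_def] .
qed

lemma ugood_of_tgood:
  assumes "tgood n a (push (\<lambda>c. (c, l)) \<mu>)"
  shows "ugood n a \<mu>"
  unfolding ugood_def
proof (intro conjI allI impI)
  show "homog a \<mu>" using assms by (simp add: tgood_def homog_push_iff)
  fix S :: "nat set" assume S: "finite S"
  have "good n (\<lambda>f. arrangement S (push (\<lambda>c. (c, l)) \<mu>) (\<lambda>(x, l). f x))"
    using assms S by (intro good_of_mix) (simp add: tgood_def)
  then show "good n (\<lambda>f. ext (\<lambda>M. arr S M (\<lambda>x. f (\<lambda>r. {p \<in> S. x p r}))) \<mu>)"
    by (simp add: arrangement_tag[OF S])
qed

lemma tgood_combination:
  assumes "finite I" "(\<Sum>i\<in>I. norm (c i)) \<le> 1" "\<And>i. i \<in> I \<Longrightarrow> tgood n a (\<mu> i)"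
  shows "tgood n a (\<Sum>i\<in>I. sc (c i) * \<mu> i)"
  unfolding tgood_def
proof (intro conjI allI impI)
  show "homog a (\<Sum>i\<in>I. sc (c i) * \<mu> i)"
    by (intro homog_sum homog_scale) (use assms(3) in \<open>auto simp: tgood_def\<close>)
  fix S :: "nat set" assume "finite S"
  then show "mix (good n) (arrangement S (\<Sum>i\<in>I. sc (c i) * \<mu> i))"
    using mix_combination[OF assms(1,2), of n "\<lambda>i. arrangement S (\<mu> i)"] assms(3)
    by (simp add: arrangement_def[abs_def] ext_sum tgood_def)
qed

lemma tgood_combination2:
  assumes "norm c + norm d \<le> 1" "tgood n a \<mu>" "tgood n a \<nu>"
  shows "tgood n a (sc c * \<mu> + sc d * \<nu>)"
  using tgood_combination[of "UNIV :: bool set" "\<lambda>b. if b then c else d" n a "\<lambda>b. if b then \<mu> else \<nu>"] assms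
  by (auto simp: UNIV_bool add.commute)

text \<open>A nonnegative law is an average of single matrices, and a point evaluation is good. Only
  signed and complex weights require an argument.\<close>

lemma tgood_prob:
  assumes "prob_law X \<mu>" "homog a \<mu>"
  shows "tgood n a \<mu>"
  unfolding tgood_def
proof (intro conjI allI impI)
  fix S :: "nat set" assume S: "finite S"
  show "mix (good n) (arrangement S \<mu>)"
    unfolding arrangement_def[abs_def]
  proof (rule mix_bind[of X "\<lambda>\<phi>. ext \<phi> \<mu>"])
    show "subprob X (\<lambda>\<phi>. ext \<phi> \<mu>)" using assms(1) by (simp add: prob_law_def)
    show "mix (good n) (\<lambda>g. arr S M (\<lambda>x. g (rows_of S x, labels S x)))" for M
      by (rule mix_bind[OF subprob_arr[OF S]], rule mix_const[of "good n"], rule good_point)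
  qed
qed (rule assms)

text \<open>The two multisets are placed on fixed complementary sets of positions and glued there;
  then one averages over the permutations of \<open>S\<close>, which act row by row.\<close>

lemma tgood_mult:
  fixes \<mu> \<nu> :: "((nat \<Rightarrow> bool) \<times> 'l) law"
  assumes "tgood n a \<mu>" "tgood n b \<nu>"
  shows "tgood n (a + b) (\<mu> * \<nu>)"
proof -
  have h: "homog a \<mu>" "homog b \<nu>" using assms by (auto simp: tgood_def)
  have "mix (good n) (arrangement S (\<mu> * \<nu>))" if S: "finite S" for S
  proof (cases "card S = a + b")
    case False
    have "arrangement S (\<mu> * \<nu>) = (\<lambda>g. 0)"
    proof
      fix g
      have "arrangement S (\<mu> * \<nu>) g = ext (\<lambda>_. 0) (\<mu> * \<nu>)"
        unfolding arrangement_def by (rule ext_cong_homog[OF homog_mult[OF h]]) (use False in \<open>simp add: arr_size\<close>)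
      then show "arrangement S (\<mu> * \<nu>) g = 0" by (simp add: ext_def)
    qed
    then show ?thesis using mix_combination[of "{} :: nat set" "\<lambda>_. 0"] by simp
  next
    case True
    then obtain U where U: "U \<subseteq> S" "card U = a" using obtain_subset_with_card_n[of a S] by auto
    have fin: "finite U" "finite (S - U)" using S U by (auto intro: finite_subset)
    define h where "h \<pi> = (\<lambda>(r :: nat) X Y. {p \<in> S. \<pi> p \<in> X \<union> Y})" for \<pi> :: "nat \<Rightarrow> nat"
    define H where "H \<pi> l l' = restrict (merge_at U l l' \<circ> \<pi>) S" for \<pi> and l l' :: "nat \<Rightarrow> 'l"
    define R where "R \<pi> g = arrangement U \<mu> (\<lambda>(x, l). arrangement (S - U) \<nu> (\<lambda>(y, l').
      g (glue (h \<pi>) x y, H \<pi> l l')))" for \<pi> g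
    have rl: "rows_of S (restrict (merge_at U x y \<circ> \<pi>) S) = glue (h \<pi>) (rows_of U x) (rows_of (S - U) y)"
      "labels S (restrict (merge_at U x y \<circ> \<pi>) S) = H \<pi> (labels U x) (labels (S - U) y)"
      if "\<pi> permutes S" for \<pi> x y
      using permutes_in_image[OF that]
      by (auto simp: rows_of_def labels_def glue_def h_def H_def merge_at_def fun_eq_iff)
    have eq: "arr S (M + N) (\<lambda>x. g (rows_of S x, labels S x)) =
        (\<Sum>\<pi> | \<pi> permutes S. of_real (1 / fact (card S)) *
          arr U M (\<lambda>x. arr (S - U) N (\<lambda>y. g (glue (h \<pi>) (rows_of U x) (rows_of (S - U) y),
            H \<pi> (labels U x) (labels (S - U) y)))))" if "size M = a" for M N g
      unfolding arr_union[OF S U(1) that[folded U(2)]] by (rule sum.cong) (simp_all add: rl)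
    have "arrangement S (\<mu> * \<nu>) g = (\<Sum>\<pi> | \<pi> permutes S. of_real (1 / fact (card S)) * R \<pi> g)" for g
    proof -
      have "arrangement S (\<mu> * \<nu>) g = ext (\<lambda>M. ext (\<lambda>N. \<Sum>\<pi> | \<pi> permutes S. of_real (1 / fact (card S)) *
          arr U M (\<lambda>x. arr (S - U) N (\<lambda>y. g (glue (h \<pi>) (rows_of U x) (rows_of (S - U) y),
            H \<pi> (labels U x) (labels (S - U) y))))) \<nu>) \<mu>"
        unfolding arrangement_def ext_mult
        by (intro ext_cong_homog[OF h(1)] arg_cong[where f = "\<lambda>\<phi>. ext \<phi> \<nu>"] ext eq)
      also have "\<dots> = (\<Sum>\<pi> | \<pi> permutes S. of_real (1 / fact (card S)) *
          ext (\<lambda>M. ext (\<lambda>N. arr U M (\<lambda>x. arr (S - U) N (\<lambda>y. g (glue (h \<pi>) (rows_of U x) (rows_of (S - U) y),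
            H \<pi> (labels U x) (labels (S - U) y))))) \<nu>) \<mu>)"
        by (simp only: lin_sum_scaled[OF lin_ext])
      finally show ?thesis
        by (simp add: R_def arrangement_def ext_swap[OF lin_arr[OF fin(1)]])
    qed
    moreover have "mix (good n) (\<lambda>g. \<Sum>\<pi> | \<pi> permutes S. of_real (1 / fact (card S)) * R \<pi> g)"
    proof (rule mix_combination)
      fix \<pi>
      show "mix (good n) (R \<pi>)"
        unfolding R_def by (rule mix_good_glue) (use assms fin in \<open>auto simp: tgood_def\<close>)
    qed (use S in \<open>auto simp: finite_permutations card_permutations norm_divide\<close>)
    ultimately show ?thesis by presburger
  qed
  then show ?thesis using homog_mult[OF h] by (simp add: tgood_def)
qed

lemma tgood_one: "tgood n 0 1"
  by (rule tgood_prob[OF prob_law_one[of UNIV] homog_one]) simp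

lemma tgood_power: "tgood n a \<mu> \<Longrightarrow> tgood n (m * a) (\<mu> ^ m)"
  by (induction m) (auto intro: tgood_one tgood_mult)

section \<open>Discs of good laws; hiding one factor among many\<close>

definition mdisc :: "nat \<Rightarrow> nat \<Rightarrow> ((nat \<Rightarrow> bool) \<times> 'l) law \<Rightarrow> ((nat \<Rightarrow> bool) \<times> 'l) law \<Rightarrow> real \<Rightarrow> bool" where
  "mdisc n a \<mu> \<nu> r \<longleftrightarrow> (\<forall>s. norm s \<le> r \<longrightarrow> tgood n a (\<mu> + sc s * \<nu>))"

lemma mdiscD: "mdisc n a \<mu> \<nu> r \<Longrightarrow> norm s \<le> r \<Longrightarrow> tgood n a (\<mu> + sc s * \<nu>)"
  by (simp add: mdisc_def)

text \<open>Averaging the products at (\<gamma> + x, \<beta> + y) and (\<gamma> - x, \<beta> - y)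
  cancels the terms linear in x and y and leaves the correction x y B B'. Each radius is spent
  partly on the centre and partly on the displacement.\<close>

lemma tgood_bilinear:
  assumes "mdisc n a A B \<rho>" "mdisc n b A' B' \<rho>'"
    and "norm \<gamma> + norm x \<le> \<rho>" "norm \<beta> + norm y \<le> \<rho>'"
  shows "tgood n (a + b) ((A + sc \<gamma> * B) * (A' + sc \<beta> * B') + sc (x * y) * (B * B'))"
proof -
  have 1: "tgood n (a + b) ((A + sc (\<gamma> + x) * B) * (A' + sc (\<beta> + y) * B'))"
    using norm_triangle_ineq[of \<gamma> x] norm_triangle_ineq[of \<beta> y] assms(3,4)
    by (intro tgood_mult mdiscD[OF assms(1)] mdiscD[OF assms(2)]) auto
  have 2: "tgood n (a + b) ((A + sc (\<gamma> - x) * B) * (A' + sc (\<beta> - y) * B'))"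
    using norm_triangle_ineq4[of \<gamma> x] norm_triangle_ineq4[of \<beta> y] assms(3,4)
    by (intro tgood_mult mdiscD[OF assms(1)] mdiscD[OF assms(2)]) auto
  have half: "sc (1/2) * (z + d) + sc (1/2) * (z - d) = (z :: ((nat \<Rightarrow> bool) \<times> 'c) law)" for z d
  proof -
    have "sc (1/2) * (z + d) + sc (1/2) * (z - d) = (sc (1/2) + sc (1/2)) * z" by (simp add: algebra_simps)
    then show ?thesis by (simp flip: single_add)
  qed
  have "(A + sc (\<gamma> + x) * B) * (A' + sc (\<beta> + y) * B') =
      ((A + sc \<gamma> * B) * (A' + sc \<beta> * B') + sc (x * y) * (B * B')) +
      (sc x * B * (A' + sc \<beta> * B') + sc y * B' * (A + sc \<gamma> * B))"
    by (simp add: single_add sc_mult_sc[symmetric] algebra_simps del: sc_mult_sc)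
  moreover have "(A + sc (\<gamma> - x) * B) * (A' + sc (\<beta> - y) * B') =
      ((A + sc \<gamma> * B) * (A' + sc \<beta> * B') + sc (x * y) * (B * B')) -
      (sc x * B * (A' + sc \<beta> * B') + sc y * B' * (A + sc \<gamma> * B))"
    by (simp add: single_diff sc_mult_sc[symmetric] algebra_simps del: sc_mult_sc)
  ultimately have "sc (1/2) * ((A + sc (\<gamma> + x) * B) * (A' + sc (\<beta> + y) * B')) +
      sc (1/2) * ((A + sc (\<gamma> - x) * B) * (A' + sc (\<beta> - y) * B')) =
      (A + sc \<gamma> * B) * (A' + sc \<beta> * B') + sc (x * y) * (B * B')" (is "?l = ?r")
    by (simp only: half)
  then show ?thesis using tgood_combination2[OF _ 1 2, of "1/2" "1/2"] by simp
qed

text \<open>The law in question is (A + s B)(A' - s B') + (s^2 - 1) B B'. At s = 1 and s = -1 the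
  correction vanishes and two factors of opposite types remain; elsewhere
  \<open>tgood_bilinear\<close> pays for it.\<close>

lemma mdisc_anti:
  assumes A: "mdisc n a A B \<rho>" "mdisc n b A' B' \<rho>'"
    and r: "r < \<rho>" "r \<le> \<rho>'" "1 + r\<^sup>2 \<le> (\<rho> - r) * (\<rho>' - r)"
  shows "mdisc n (a + b) (A * A' - B * B') (B * A' - A * B') r"
  unfolding mdisc_def
proof (intro allI impI)
  fix s :: complex assume s: "norm s \<le> r"
  \<comment> \<open>All the slack of the first factor goes into x; then y is forced by x y = s^2 -
    1.\<close>
  define x where "x = complex_of_real (\<rho> - r)"
  define y where "y = (s\<^sup>2 - 1) / x"
  have x: "norm x = \<rho> - r" "x \<noteq> 0" using r(1) by (simp_all add: x_def del: of_real_diff)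
  have "norm (s\<^sup>2 - 1) \<le> (norm s)\<^sup>2 + 1" using norm_triangle_ineq4[of "s\<^sup>2" 1] by (simp add: norm_power)
  also have "\<dots> \<le> (\<rho> - r) * (\<rho>' - r)" using r(3) power_mono[OF s norm_ge_zero, of 2] by simp
  finally have "norm y \<le> \<rho>' - r"
    unfolding y_def norm_divide x(1) using r(1) by (simp add: pos_divide_le_eq mult.commute)
  then have t: "tgood n (a + b) ((A + sc s * B) * (A' + sc (- s) * B') + sc (x * y) * (B * B'))"
    using s r(1) x(1) by (intro tgood_bilinear[OF A]) auto
  have "x * y = s * s - 1" using x(2) by (simp add: y_def power2_eq_square)
  then have xy: "sc (x * y) = (sc s * sc s - 1 :: ((nat \<Rightarrow> bool) \<times> 'c) law)"
    by (simp add: single_diff)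
  have "(A + sc s * B) * (A' + sc (- s) * B') + sc (x * y) * (B * B') =
      (A * A' - B * B') + sc s * (B * A' - A * B')"
    unfolding xy by (simp only: single_uminus) (simp add: algebra_simps del: sc_mult_sc)
  with t show "tgood n (a + b) (A * A' - B * B' + sc s * (B * A' - A * B'))" by simp
qed

lemma sum_roots_of_unity:
  assumes "0 < K"
  shows "(\<Sum>k<K. cis (2 * pi * real k / real K) ^ j) = (if K dvd j then of_nat K else 0)"
proof -
  define x where "x = cis (2 * pi * real j / real K)"
  have *: "cis (2 * pi * real k / real K) ^ j = x ^ k" for k
    unfolding x_def Complex.DeMoivre by (simp add: mult.commute mult.left_commute)
  have xK: "x ^ K = 1" using assms by (simp add: x_def Complex.DeMoivre)
  have "K dvd j" if "x = 1"
  proof -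
    from that have "cos (2 * pi * real j / real K) = 1" by (simp add: x_def complex_eq_iff)
    then obtain i where "2 * pi * real j / real K = of_int i * 2 * pi"
      unfolding cos_one_2pi_int by blast
    then have "real j = of_int i * real K" using assms by (simp add: field_simps)
    then have "int j = i * int K" by (metis of_int_eq_iff of_int_mult of_int_of_nat_eq)
    then show ?thesis by (metis dvd_triv_right int_dvd_int_iff)
  qed
  moreover have "x = 1" if "K dvd j"
  proof -
    from that obtain i where "j = K * i" by auto
    then have "x = cis (2 * pi * real i)" using assms unfolding x_def by (intro arg_cong[where f = cis]) simp
    then show ?thesis by (simp only: cis_multiple_2pi Ints_of_nat)
  qed
  moreover have "(\<Sum>k<K. x ^ k) = 0" if "x \<noteq> 1"
    using geometric_sum[OF that, of K] xK by simp
  ultimately show ?thesis unfolding * by auto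
qed

lemma sc_power [simp]: "sc c ^ j = (sc (c ^ j) :: 'c law)"
  by (induction j) simp_all

lemma sc_sum: "(\<Sum>i\<in>I. sc (c i)) = (sc (\<Sum>i\<in>I. c i) :: 'c law)"
  by (induction I rule: infinite_finite_induct) (simp_all add: single_add)

text \<open>The weights \<open>1 + 2 Re (c / w)\<close> on the roots of unity \<open>w\<close> extract from the \<open>N\<close>-th power of
  \<open>\<mu> + r w \<nu>\<close> its constant and linear terms.\<close>

lemma mdisc_among:
  assumes m: "mdisc n a \<mu> \<nu> r" and N: "0 < N"
  shows "mdisc n (N * a) (\<mu> ^ N) (\<mu> ^ (N - 1) * \<nu>) (real N * r / 2)"
  unfolding mdisc_def
proof (intro allI impI)
  fix s :: complex assume s: "norm s \<le> real N * r / 2"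
  show "tgood n (N * a) (\<mu> ^ N + sc s * (\<mu> ^ (N - 1) * \<nu>))"
  proof (cases "r > 0")
    case False
    have "0 \<le> real N * r" using s norm_ge_zero[of s] by linarith
    then have "r = 0" using N False by (simp add: zero_le_mult_iff)
    then have "s = 0" using s by simp
    then show ?thesis using tgood_power[OF mdiscD[OF m, of 0], of N] \<open>r = 0\<close> by simp
  next
    case True
    \<comment> \<open>The exponents run up to N and the weights contain the frequencies -1, 0 and 1;
      with N + 2 points no unwanted frequency is congruent to 0.\<close>
    define K where "K = N + 2"
    \<comment> \<open>The linear term of the power is N r w, so \<open>c\<close> has to be the first
      moment of the weights. They are nonnegative since |c| is at most 1/2, which is where the
      factor 1/2 in the radius comes from.\<close>
    define c where "c = s / of_real (real N * r)"
    define w where "w k = cis (2 * pi * real k / real K)" for k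
    define p where "p k = (1 + 2 * Re (c * cnj (w k))) / real K" for k
    have K: "0 < K" "1 < K" by (auto simp: K_def)
    have c: "norm c \<le> 1/2" unfolding c_def norm_divide norm_of_real using s True N by (simp add: field_simps)
    have p0: "0 \<le> p k" for k
    proof -
      have "\<bar>Re (c * cnj (w k))\<bar> \<le> norm (c * cnj (w k))" by (rule abs_Re_le_cmod)
      also have "\<dots> \<le> 1/2" using c by (simp add: norm_mult w_def)
      finally have "0 \<le> 1 + 2 * Re (c * cnj (w k))" by linarith
      then show ?thesis unfolding p_def by (intro divide_nonneg_nonneg) simp_all
    qed
    have wK: "w k * w k ^ (K - 1) = 1" for k
    proof -
      have "w k * w k ^ (K - 1) = w k ^ K" using K by (simp flip: power_Suc)
      also have "\<dots> = 1" using K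
        by (simp add: w_def Complex.DeMoivre)
      finally show ?thesis .
    qed
    have cw: "cnj (w k) = w k ^ (K - 1)" for k
    proof -
      have "cnj (w k) * (w k * w k ^ (K - 1)) = w k ^ (K - 1)"
        by (simp add: w_def cis_cnj cis_mult flip: mult.assoc)
      then show ?thesis by (simp only: wK mult_1_right)
    qed
    have pk: "of_real (p k) = (1 + c * w k ^ (K - 1) + cnj c * w k) / of_nat K" for k
    proof -
      have "of_real (2 * Re (c * cnj (w k))) = c * cnj (w k) + cnj (c * cnj (w k))"
        by (simp only: complex_add_cnj)
      then have "of_real (2 * Re (c * cnj (w k))) = c * cnj (w k) + cnj c * w k"
        by (simp only: complex_cnj_mult complex_cnj_cnj)
      then have "of_real (2 * Re (c * cnj (w k))) = c * w k ^ (K - 1) + cnj c * w k"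
        by (simp only: flip: cw)
      then show ?thesis unfolding p_def of_real_divide of_real_add by (simp only: add.assoc of_real_1 of_real_of_nat_eq)
    qed
    note roots = sum_roots_of_unity[OF K(1), folded w_def]
    have moment: "(\<Sum>k<K. of_real (p k) * w k ^ j) = (if j = 0 then 1 else if j = 1 then c else 0)"
      if "j \<le> N" for j
    proof -
      have "of_real (p k) * w k ^ j = (w k ^ j + c * w k ^ (j + (K - 1)) + cnj c * w k ^ (j + 1)) / of_nat K" for k
        by (simp add: pk power_add algebra_simps add_divide_distrib)
      then have "(\<Sum>k<K. of_real (p k) * w k ^ j) = ((\<Sum>k<K. w k ^ j) + c * (\<Sum>k<K. w k ^ (j + (K - 1))) +
          cnj c * (\<Sum>k<K. w k ^ (j + 1))) / of_nat K"
        by (simp add: sum_divide_distrib[symmetric] sum.distrib sum_distrib_left)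
      moreover have "K dvd j \<longleftrightarrow> j = 0" using that by (auto simp: K_def dest: dvd_imp_le)
      moreover have "\<not> K dvd j + 1" using that by (auto simp: K_def dest: dvd_imp_le)
      moreover have "K dvd j + (K - 1) \<longleftrightarrow> j = 1"
      proof
        assume d: "K dvd j + (K - 1)"
        show "j = 1"
        proof (cases j)
          case 0
          then show ?thesis using d K by (auto dest: dvd_imp_le)
        next
          case (Suc i)
          then have "K dvd i + K" using d K by simp
          then have "K dvd i" by simp
          then show ?thesis using Suc that by (auto simp: K_def dest: dvd_imp_le)
        qed
      qed (use K in simp)
      ultimately show ?thesis using K by (simp only: roots) auto
    qed
    define X where "X j = of_nat (N choose j) * \<nu> ^ j * \<mu> ^ (N - j)" for j
    have "(\<Sum>k<K. of_real (p k)) = (1 :: complex)" using moment[of 0] by simp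
    then have p1: "(\<Sum>k<K. p k) = 1" by (metis of_real_eq_1_iff of_real_sum)
    have t: "tgood n (N * a) (\<Sum>k<K. sc (of_real (p k)) * (\<mu> + sc (of_real r * w k) * \<nu>) ^ N)"
      using p0 p1 True
      by (intro tgood_combination tgood_power mdiscD[OF m]) (auto simp: norm_mult w_def)
    have "(\<mu> + sc (of_real r * w k) * \<nu>) ^ N = (\<Sum>j\<le>N. sc ((of_real r * w k) ^ j) * X j)" for k
      unfolding add.commute[of \<mu>] binomial_ring by (simp add: X_def power_mult_distrib mult_ac)
    then have "(\<Sum>k<K. sc (of_real (p k)) * (\<mu> + sc (of_real r * w k) * \<nu>) ^ N) =
        (\<Sum>k<K. \<Sum>j\<le>N. sc (of_real (p k) * (of_real r * w k) ^ j) * X j)"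
      by (simp add: sum_distrib_left mult.assoc[symmetric])
    also have "\<dots> = (\<Sum>j\<le>N. sc (\<Sum>k<K. of_real (p k) * (of_real r * w k) ^ j) * X j)"
      by (subst sum.swap) (simp add: sum_distrib_right sc_sum[symmetric])
    also have "\<dots> = (\<Sum>j\<le>N. sc (of_real r ^ j * (if j = 0 then 1 else if j = 1 then c else 0)) * X j)"
    proof (rule sum.cong[OF refl])
      fix j assume "j \<in> {..N}"
      then have "(\<Sum>k<K. of_real (p k) * (of_real r * w k) ^ j) =
          of_real r ^ j * (if j = 0 then 1 else if j = 1 then c else 0)"
        unfolding power_mult_distrib
        by (subst moment[symmetric]) (simp_all add: sum_distrib_left mult_ac)
      then show "sc (\<Sum>k<K. of_real (p k) * (of_real r * w k) ^ j) * X j =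
        sc (of_real r ^ j * (if j = 0 then 1 else if j = 1 then c else 0)) * X j" by simp
    qed
    also have "\<dots> = (\<Sum>j\<in>{0, 1}. sc (of_real r ^ j * (if j = 0 then 1 else if j = 1 then c else 0)) * X j)"
      using N by (intro sum.mono_neutral_right) auto
    also have "\<dots> = \<mu> ^ N + sc (of_real r * c) * (of_nat N * \<nu> * \<mu> ^ (N - 1))"
      by (simp add: X_def)
    also have "sc (of_real r * c) * (of_nat N * \<nu> * \<mu> ^ (N - 1)) = sc (of_real r * c * of_nat N) * (\<mu> ^ (N - 1) * \<nu>)"
      by (simp only: sc_mult_sc[symmetric] single_of_nat mult_ac)
    also have "of_real r * c * of_nat N = s" using True N by (simp add: c_def)
    finally show ?thesis using t by simp
  qed
qed

section \<open>Cauchy--Schwarz for one row\<close>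

text \<open>A column carries a label \<open>\<beta>\<close> which gives its entry in row \<open>Suc n\<close> under each option \<open>v\<close>.\<close>

lemma ugood_Suc_labelled:
  fixes \<mu> :: "((nat \<Rightarrow> bool) \<times> ('o \<Rightarrow> bool)) law"
  assumes prob: "prob_law X \<mu>" and hom: "homog a \<mu>" and V: "finite V"
    and pair: "tgood n a (\<Sum>v\<in>V. \<Sum>v'\<in>V. sc (\<omega> v * cnj (\<omega> v')) * push (\<lambda>(c, \<beta>). (c, (\<beta> v, \<beta> v'))) \<mu>)"
  shows "ugood (Suc n) a (\<Sum>v\<in>V. sc (\<omega> v) * push (\<lambda>(c, \<beta>). c(Suc n := \<beta> v)) \<mu>)"
  unfolding ugood_def
proof (intro conjI allI impI)
  show "homog a (\<Sum>v\<in>V. sc (\<omega> v) * push (\<lambda>(c, \<beta>). c(Suc n := \<beta> v)) \<mu>)"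
    by (intro homog_sum homog_scale homog_push hom)
  fix S :: "nat set" assume S: "finite S"
  obtain vs where vs: "set vs = V" "distinct vs" using finite_distinct_list[OF V] by blast
  define Z where "Z x v = {p \<in> S. snd (x p) v}" for x :: "nat \<Rightarrow> (nat \<Rightarrow> bool) \<times> ('o \<Rightarrow> bool)" and v
  define es where "es x = map (\<lambda>v. (\<omega> v, Z x v)) vs" for x
  define P where "P \<phi> = ext (\<lambda>M. arr S M (\<lambda>x. \<phi> (rows_of S x, es x))) \<mu>" for \<phi>
  note lin = lin_arr[OF S]
  have es: "fsum (es x) f = (\<Sum>v\<in>V. \<omega> v * f (Z x v))" for x f
    unfolding es_def fsum_def using vs by (simp add: sum_list_distinct_conv_sum_set comp_def)
  have es': "fsum (cnj_weights (es x)) f = (\<Sum>v\<in>V. cnj (\<omega> v) * f (Z x v))" for x f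
    by (simp add: fsum_cnj_weights es)
  have 1: "subprob UNIV P"
    unfolding P_def
  proof (rule subprob_bind[of X "\<lambda>\<phi>. ext \<phi> \<mu>"])
    show "subprob X (\<lambda>\<phi>. ext \<phi> \<mu>)" using prob by (simp add: prob_law_def)
    show "subprob UNIV (\<lambda>\<phi>. arr S M (\<lambda>x. \<phi> (rows_of S x, es x)))" for M
      by (rule subprob_map[OF subprob_arr[OF S]]) simp
  qed
  have row: "(\<lambda>r. {p \<in> S. restrict ((\<lambda>(c, \<beta>). c(Suc n := \<beta> v)) \<circ> x) S p r}) = (rows_of S x)(Suc n := Z x v)" for v x
    by (auto simp: fun_eq_iff rows_of_def Z_def case_prod_unfold)
  have 2: "(\<lambda>f. ext (\<lambda>M. arr S M (\<lambda>x. f (\<lambda>r. {p \<in> S. x p r})))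
      (\<Sum>v\<in>V. sc (\<omega> v) * push (\<lambda>(c, \<beta>). c(Suc n := \<beta> v)) \<mu>)) = present (Suc n) P"
  proof
    fix f
    have "present (Suc n) P f = (\<Sum>v\<in>V. \<omega> v * ext (\<lambda>M. arr S M (\<lambda>x. f ((rows_of S x)(Suc n := Z x v)))) \<mu>)"
      unfolding present_def P_def by (simp add: es lin_sum_scaled[OF lin] lin_sum_scaled[OF lin_ext])
    then show "ext (\<lambda>M. arr S M (\<lambda>x. f (\<lambda>r. {p \<in> S. x p r})))
      (\<Sum>v\<in>V. sc (\<omega> v) * push (\<lambda>(c, \<beta>). c(Suc n := \<beta> v)) \<mu>) = present (Suc n) P f"
      by (simp only: ext_sum ext_scale ext_push arr_image[OF S] row)
  qed
  define H where "H l = ({p \<in> S. fst (l p)}, {p \<in> S. snd (l p)})" for l :: "nat \<Rightarrow> bool \<times> bool"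
  have lab: "rows_of S (restrict ((\<lambda>(c, \<beta>). (c, (\<beta> v, \<beta> v'))) \<circ> x) S) = rows_of S x"
    "H (labels S (restrict ((\<lambda>(c, \<beta>). (c, (\<beta> v, \<beta> v'))) \<circ> x) S)) = (Z x v, Z x v')" for v v' x
    by (auto simp: fun_eq_iff rows_of_def H_def labels_def Z_def case_prod_unfold)
  have 3: "pair_law P = (\<lambda>g. arrangement S (\<Sum>v\<in>V. \<Sum>v'\<in>V. sc (\<omega> v * cnj (\<omega> v')) *
      push (\<lambda>(c, \<beta>). (c, (\<beta> v, \<beta> v'))) \<mu>) (\<lambda>(Y, l). g (\<lambda>r. Y r, H l)))"
  proof
    fix g
    have "pair_law P g = (\<Sum>v\<in>V. \<omega> v * (\<Sum>v'\<in>V. cnj (\<omega> v') *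
        ext (\<lambda>M. arr S M (\<lambda>x. g (rows_of S x, (Z x v, Z x v')))) \<mu>))"
      unfolding pair_law_def P_def
      by (simp add: es es' lin_sum_scaled[OF lin] lin_sum_scaled[OF lin_ext])
    then show "pair_law P g = arrangement S (\<Sum>v\<in>V. \<Sum>v'\<in>V. sc (\<omega> v * cnj (\<omega> v')) *
      push (\<lambda>(c, \<beta>). (c, (\<beta> v, \<beta> v'))) \<mu>) (\<lambda>(Y, l). g (\<lambda>r. Y r, H l))"
      by (simp add: arrangement_def ext_sum ext_push arr_image[OF S] lab sum_distrib_left mult.assoc)
  qed
  have "mix (good n) (pair_law P)"
    unfolding 3 by (rule mix_map) (use pair S in \<open>simp add: tgood_def\<close>)
  with 1 2 show "good (Suc n) (\<lambda>f. ext (\<lambda>M. arr S M (\<lambda>x. f (\<lambda>r. {p \<in> S. x p r})))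
      (\<Sum>v\<in>V. sc (\<omega> v) * push (\<lambda>(c, \<beta>). c(Suc n := \<beta> v)) \<mu>))"
    unfolding good.simps by blast
qed

section \<open>Column sets of prescribed parity\<close>

text \<open>\<open>raw j s\<close> consists of the columns in rows \<open>{..<j}\<close> whose number of zeros is even (for \<open>s\<close> true) or
  odd. Only \<open>raw j True\<close> contains the all-ones column.\<close>

primrec raw :: "nat \<Rightarrow> bool \<Rightarrow> (nat \<Rightarrow> bool) multiset" where
  "raw 0 s = (if s then {#\<lambda>_. False#} else {#})"
| "raw (Suc j) s = image_mset (\<lambda>c. c(j := True)) (raw j s) + image_mset (\<lambda>c. c(j := False)) (raw j (\<not> s))"

text \<open>In \<open>half + s dif\<close> the two parities are the points s = 1 and s = -1, and s =
  0 is the fair mixture used as a mask.\<close>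

definition half :: "nat \<Rightarrow> (nat \<Rightarrow> bool) law" where
  "half j = sc (1/2) * (mon (raw j True) + mon (raw j False))"

definition dif :: "nat \<Rightarrow> (nat \<Rightarrow> bool) law" where
  "dif j = sc (1/2) * (mon (raw j True) - mon (raw j False))"

abbreviation sg :: "bool \<Rightarrow> complex" where
  "sg s \<equiv> if s then 1 else - 1"

lemma size_raw: "size (raw (Suc j) s) = 2 ^ j"
  by (induction j arbitrary: s) (simp_all add: add.commute)

lemma homog_half: "homog (2 ^ j) (half (Suc j))"
  unfolding half_def by (intro homog_scale homog_add homog_single size_raw)

lemma mon_raw: "mon (raw j s) = half j + sc (sg s) * dif j"
proof -
  have *: "sc (1/2) * x + sc (1/2) * x = x" for x :: "(nat \<Rightarrow> bool) law"
  proof -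
    have "sc (1/2) * x + sc (1/2) * x = (sc (1/2) + sc (1/2)) * x" by (simp only: distrib_right)
    then show ?thesis by (simp flip: single_add)
  qed
  have "half j + dif j = mon (raw j True)" "half j - dif j = mon (raw j False)"
    using *[of "mon (raw j True)"] *[of "mon (raw j False)"] by (simp_all add: half_def dif_def algebra_simps)
  then show ?thesis by (auto simp: single_uminus)
qed

section \<open>Random complementation of rows and the XOR law\<close>

primrec parity :: "nat \<Rightarrow> (nat \<Rightarrow> bool) \<Rightarrow> bool" where
  "parity 0 b \<longleftrightarrow> True"
| "parity (Suc j) b \<longleftrightarrow> (parity j b \<longleftrightarrow> b j)"

definition flip :: "nat \<Rightarrow> (nat \<Rightarrow> bool) \<Rightarrow> (nat \<Rightarrow> bool) \<Rightarrow> nat \<Rightarrow> bool" where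
  "flip j b c = (\<lambda>r. if r < j then c r = b r else c r)"

lemma parity_upd: "j \<le> i \<Longrightarrow> parity j (b(i := v)) = parity j b"
  by (induction j) auto

text \<open>Complementing one row exchanges the two parities, and \<open>flip\<close> complements
  the rows where \<open>b\<close> is false.\<close>

lemma flip_raw: "image_mset (flip j b) (raw j s) = raw j (s = parity j b)"
proof (induction j arbitrary: s)
  case (Suc j)
  have *: "flip (Suc j) b (c(j := v)) = (flip j b c)(j := (v = b j))" for c v
    by (auto simp: flip_def fun_eq_iff less_Suc_eq)
  have "image_mset (flip (Suc j) b) (image_mset (\<lambda>c. c(j := v)) (raw j s)) =
      image_mset (\<lambda>c. c(j := (v = b j))) (raw j (s = parity j b))" for v s
    unfolding Suc[symmetric] by (simp add: image_mset.compositionality comp_def *)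
  then show ?case by (cases "b j"; cases s; cases "parity j b") (auto simp: add.commute)
qed (simp add: flip_def)

text \<open>The uniform distribution on the bits \<open>b\<^sub>0,\<dots>,b\<^sub>n\<close> of parity \<open>t\<close>.\<close>

primrec parity_bits :: "nat \<Rightarrow> bool \<Rightarrow> ((nat \<Rightarrow> bool) \<Rightarrow> complex) \<Rightarrow> complex" where
  "parity_bits 0 t f = f (\<lambda>_. t)"
| "parity_bits (Suc n) t f = (parity_bits n t (\<lambda>b. f (b(Suc n := True))) +
     parity_bits n (\<not> t) (\<lambda>b. f (b(Suc n := False)))) / 2"

text \<open>With bits read as signs, this is the law, complex for complex \<open>s\<close>, that is
  uniform on each parity and under which the product of all signs has mean \<open>s\<close>.\<close>

definition xor_law :: "nat \<Rightarrow> complex \<Rightarrow> ((nat \<Rightarrow> bool) \<Rightarrow> complex) \<Rightarrow> complex" where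
  "xor_law n s f = ((1 + s) * parity_bits n True f + (1 - s) * parity_bits n False f) / 2"

lemma subprob_half:
  assumes "subprob X P" "subprob X Q"
  shows "subprob X (\<lambda>f. (P f + Q f) / 2)"
proof -
  have "subprob X (if i then P else Q)" for i
    using assms by (cases i) auto
  then show ?thesis
    using subprob_convex[of "UNIV :: bool set" "\<lambda>_. 1/2" X "\<lambda>b. if b then P else Q"]
    by (auto simp: UNIV_bool add_divide_distrib add.commute)
qed

lemma subprob_parity_bits: "subprob UNIV (parity_bits n t)"
proof (induction n arbitrary: t)
  case 0
  have "parity_bits 0 t = (\<lambda>f. f (\<lambda>_. t))" by (simp add: fun_eq_iff)
  then show ?case by (simp add: subprob_point)
next
  case (Suc n)
  have "parity_bits (Suc n) t = (\<lambda>f. (parity_bits n t (\<lambda>b. f (b(Suc n := True))) +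
     parity_bits n (\<not> t) (\<lambda>b. f (b(Suc n := False)))) / 2)" by (simp add: fun_eq_iff)
  then show ?case
    by (simp only:) (intro subprob_half subprob_map[OF Suc] UNIV_I)
qed

lemmas lin_parity_bits = lin_subprob[OF subprob_parity_bits]

lemma parity_bits_const: "parity_bits n t (\<lambda>_. c) = c"
  by (induction n arbitrary: t) auto

lemma parity_bits_cong:
  "(\<And>b. parity (Suc n) b = t \<Longrightarrow> f b = g b) \<Longrightarrow> parity_bits n t f = parity_bits n t g"
proof (induction n arbitrary: t f g)
  case (Suc n)
  have "parity_bits n t' (\<lambda>b. f (b(Suc n := v))) = parity_bits n t' (\<lambda>b. g (b(Suc n := v)))"
    if "t = (t' = v)" for t' v
    using that parity_upd[of "Suc n" "Suc n"] by (intro Suc.IH Suc.prems) (auto simp del: fun_upd_apply simp: fun_upd_same)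
  from this[of t True] this[of "\<not> t" False] show ?case by simp
qed simp

text \<open>With \<open>e, e' = \<plusminus>1\<close> the two copies of the last bit, the pair law has weight
  \<open>(1 + e e' \<bar>s\<bar>\<^sup>2)/4\<close> on \<open>(e, e')\<close> and again an XOR law on the remaining bits.\<close>

lemma good_xor_law: "norm s \<le> 1 / (2 ^ Suc n - 1) \<Longrightarrow> good n (xor_law n s)"
proof (induction n arbitrary: s)
  case 0
  have "lin (xor_law 0 s)" by (auto simp: lin_def xor_law_def field_simps)
  moreover have "xor_law 0 s (\<lambda>_. 1) = 1" by (simp add: xor_law_def field_simps)
  ultimately show ?case by simp
next
  case (Suc n)
  define R :: real where "R = 2 ^ Suc n - 1"
  have R: "R \<ge> 1" using power_increasing[of 1 "Suc n" "2::real"] by (simp add: R_def)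
  have s: "norm s \<le> 1 / (2 * R + 1)" using Suc.prems by (simp add: R_def)
  have s1: "norm s * (2 * R + 1) \<le> 1" using s R by (simp add: pos_le_divide_eq)
  have s13: "norm s < 1"
    using s R by (smt (verit) divide_less_eq_1_pos)
  define \<kappa> where "\<kappa> e e' = 1 + Re (sg e * sg e') * (norm s)\<^sup>2" for e e'
  \<comment> \<open>The bias left on the other bits once (e, e') is fixed. Its modulus is at most
    2|s|/(1 - |s|^2), and the passage from R to 2R + 1 in the reciprocal radius pays for
    this.\<close>
  define \<sigma> where "\<sigma> e e' = (s * sg e + cnj s * sg e') / of_real (\<kappa> e e')" for e e'
  have sq: "(norm s)\<^sup>2 < 1" using s13 by (simp add: abs_square_less_1)
  have \<kappa>: "0 < \<kappa> e e'" "1 - (norm s)\<^sup>2 \<le> \<kappa> e e'" for e e'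
  proof -
    have "\<kappa> e e' = 1 + (norm s)\<^sup>2 \<or> \<kappa> e e' = 1 - (norm s)\<^sup>2" by (auto simp: \<kappa>_def)
    then show "0 < \<kappa> e e'" "1 - (norm s)\<^sup>2 \<le> \<kappa> e e'" using sq zero_le_power2[of "norm s"] by linarith+
  qed
  have \<sigma>: "norm (\<sigma> e e') \<le> 1 / R" for e e'
  proof -
    have "norm (s * sg e + cnj s * sg e') \<le> norm (s * sg e) + norm (cnj s * sg e')"
      by (rule norm_triangle_ineq)
    also have "\<dots> = 2 * norm s" by (simp add: norm_mult)
    finally have 1: "norm (s * sg e + cnj s * sg e') \<le> 2 * norm s" .
    have "R * (2 * norm s) \<le> 1 - (norm s)\<^sup>2"
    proof -
      have "norm s * norm s \<le> norm s * 1" using s13 by (intro mult_left_mono) auto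
      then show ?thesis using s1 by (simp add: power2_eq_square algebra_simps)
    qed
    then have "R * norm (s * sg e + cnj s * sg e') \<le> \<kappa> e e'"
      using \<kappa>(2)[of e e'] mult_left_mono[OF 1, of R] R by linarith
    moreover have "norm (\<sigma> e e') = norm (s * sg e + cnj s * sg e') / \<kappa> e e'"
      unfolding \<sigma>_def norm_divide norm_of_real using \<kappa>(1)[of e e'] by simp
    ultimately show ?thesis using \<kappa>(1)[of e e'] R
      by (simp add: pos_divide_le_eq pos_le_divide_eq mult.commute)
  qed
  define \<alpha> where "\<alpha> = (1 + s) / 2"
  define \<beta> where "\<beta> = (1 - s) / 2"
  define P where "P \<phi> = (parity_bits n True (\<lambda>b. \<phi> (b, [(\<alpha>, True), (\<beta>, False)])) +
     parity_bits n False (\<lambda>b. \<phi> (b, [(\<beta>, True), (\<alpha>, False)]))) / 2" for \<phi>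
  have 1: "subprob UNIV P"
    unfolding P_def by (intro subprob_half subprob_map[OF subprob_parity_bits] UNIV_I)
  note lin = linD[OF lin_parity_bits]
  have 2: "xor_law (Suc n) s = present (Suc n) P"
    unfolding present_def P_def xor_law_def by (intro ext) (simp add: lin, simp add: \<alpha>_def \<beta>_def field_simps)
  have 3: "pair_law P = (\<lambda>g. \<Sum>(e, e')\<in>UNIV. of_real (\<kappa> e e' / 4) * xor_law n (\<sigma> e e') (\<lambda>b. g (b, (e, e'))))"
  proof
    fix g
    have ns: "of_real ((norm s)\<^sup>2) = s * cnj s" by (rule complex_norm_square)
    have w: "1 + s * sg e = 2 * (if e then \<alpha> else \<beta>)" "1 - s * sg e = 2 * (if e then \<beta> else \<alpha>)"
      "1 + cnj s * sg e = 2 * cnj (if e then \<alpha> else \<beta>)" "1 - cnj s * sg e = 2 * cnj (if e then \<beta> else \<alpha>)" for e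
      by (auto simp: \<alpha>_def \<beta>_def)
    have quarter: "(2 * a * (2 * b) * y + 2 * c * (2 * d) * z) / 8 = (a * b * y + c * d * z) / 2"
      for a b c d y z :: complex
      by (simp add: field_simps)
    have x: "of_real (\<kappa> e e' / 4) * xor_law n (\<sigma> e e') f =
      ((if e then \<alpha> else \<beta>) * cnj (if e' then \<alpha> else \<beta>) * parity_bits n True f +
       (if e then \<beta> else \<alpha>) * cnj (if e' then \<beta> else \<alpha>) * parity_bits n False f) / 2" for e e' f
    proof -
      have \<kappa>e: "of_real (\<kappa> e e') = 1 + sg e * sg e' * (s * cnj s)"
        unfolding \<kappa>_def ns[symmetric] by auto
      have k0: "of_real (\<kappa> e e') \<noteq> (0 :: complex)" using \<kappa>(1)[of e e'] by simp
      have \<sigma>e: "of_real (\<kappa> e e') * \<sigma> e e' = s * sg e + cnj s * sg e'"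
        using k0 by (simp add: \<sigma>_def)
      have "of_real (\<kappa> e e' / 4) * xor_law n (\<sigma> e e') f =
        ((of_real (\<kappa> e e') + of_real (\<kappa> e e') * \<sigma> e e') * parity_bits n True f +
         (of_real (\<kappa> e e') - of_real (\<kappa> e e') * \<sigma> e e') * parity_bits n False f) / 8"
        by (simp add: xor_law_def algebra_simps add_divide_distrib diff_divide_distrib)
      also have "\<dots> = ((1 + s * sg e) * (1 + cnj s * sg e') * parity_bits n True f +
          (1 - s * sg e) * (1 - cnj s * sg e') * parity_bits n False f) / 8"
        unfolding \<sigma>e unfolding \<kappa>e by (auto simp: algebra_simps)
      finally show ?thesis unfolding w quarter .
    qed
    have U: "(UNIV :: (bool \<times> bool) set) = {(True, True), (True, False), (False, True), (False, False)}"
      by auto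
    have "(\<Sum>(e, e')\<in>UNIV. of_real (\<kappa> e e' / 4) * xor_law n (\<sigma> e e') (\<lambda>b. g (b, (e, e')))) =
      (\<Sum>(e, e')\<in>UNIV. ((if e then \<alpha> else \<beta>) * cnj (if e' then \<alpha> else \<beta>) * parity_bits n True (\<lambda>b. g (b, (e, e'))) +
       (if e then \<beta> else \<alpha>) * cnj (if e' then \<beta> else \<alpha>) * parity_bits n False (\<lambda>b. g (b, (e, e')))) / 2)"
      unfolding case_prod_unfold by (intro sum.cong refl x)
    then show "pair_law P g = (\<Sum>(e, e')\<in>UNIV. of_real (\<kappa> e e' / 4) * xor_law n (\<sigma> e e') (\<lambda>b. g (b, (e, e'))))"
      unfolding pair_law_def P_def U
      by (simp add: cnj_weights_def lin add_divide_distrib distrib_left mult.assoc)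
  qed
  have "mix (good n) (pair_law P)"
    unfolding 3 case_prod_unfold
  proof (rule mix_combination)
    have U: "(UNIV :: (bool \<times> bool) set) = {(True, True), (True, False), (False, True), (False, False)}"
      by auto
    have k: "norm (complex_of_real (\<kappa> e e' / 4)) = \<kappa> e e' / 4" for e e'
      using \<kappa>(1)[of e e'] unfolding norm_of_real by simp
    have "(\<Sum>i\<in>UNIV. norm (complex_of_real (\<kappa> (fst i) (snd i) / 4))) = (\<Sum>i\<in>UNIV. \<kappa> (fst i) (snd i) / 4)"
      by (intro sum.cong refl k)
    also have "\<dots> = 1" unfolding U by (simp add: \<kappa>_def add_divide_distrib diff_divide_distrib)
    finally show "(\<Sum>i\<in>UNIV. norm (complex_of_real (\<kappa> (fst i) (snd i) / 4))) \<le> 1" by simp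
    show "mix (good n) (\<lambda>g. xor_law n (\<sigma> (fst i) (snd i)) (\<lambda>b. g (b, (fst i, snd i))))" for i
      using \<sigma>[of "fst i" "snd i"] by (intro mix_const[of "good n"] Suc.IH) (simp add: R_def)
  qed simp
  with 1 2 show ?case unfolding good.simps by blast
qed

text \<open>A random arrangement of either parity is obtained from one fixed arrangement by a random
  permutation followed by random flips of the prescribed parity. For a fixed permutation, row r is a
  function of the bit b r alone, so the law is a rowwise image of \<open>xor_law\<close>.\<close>

lemma ugood_unit:
  assumes s: "norm s \<le> 1 / (2 ^ Suc n - 1)"
  shows "ugood n (2 ^ n) (half (Suc n) + sc s * dif (Suc n))"
  unfolding ugood_def
proof (intro conjI allI impI)
  show "homog (2 ^ n) (half (Suc n) + sc s * dif (Suc n))"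
  proof -
    have "dif (Suc n) = sc (1/2) * mon (raw (Suc n) True) + sc (-1/2) * mon (raw (Suc n) False)"
      by (simp add: dif_def algebra_simps single_uminus)
    then show ?thesis
      by (simp only:) (intro homog_add homog_half homog_scale homog_single size_raw)
  qed
  fix S :: "nat set" assume S: "finite S"
  define F where "F f x = f (\<lambda>r. {p \<in> S. x p r})" for f :: "(nat \<Rightarrow> nat set) \<Rightarrow> complex" and x :: "nat \<Rightarrow> nat \<Rightarrow> bool"
  define A where "A t f = arr S (raw (Suc n) t) (F f)" for t f
  have expand: "ext (\<lambda>M. arr S M (F f)) (half (Suc n) + sc s * dif (Suc n)) =
    ((1 + s) * A True f + (1 - s) * A False f) / 2" for f
  proof -
    have "dif (Suc n) = sc (1/2) * mon (raw (Suc n) True) + sc (-1/2) * mon (raw (Suc n) False)"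
      by (simp add: dif_def algebra_simps single_uminus)
    then show ?thesis unfolding half_def A_def by (simp only: ext_add ext_scale ext_single) (simp add: field_simps)
  qed
  have "good n (\<lambda>f. ((1 + s) * A True f + (1 - s) * A False f) / 2)"
  proof (cases "card S = 2 ^ n")
    case False
    then have "A t = (\<lambda>_. 0)" for t
      by (intro ext) (simp add: A_def arr_def size_raw del: raw.simps)
    then show ?thesis using good_combination[of "{} :: nat set" "\<lambda>_. 0" n] by simp
  next
    case True
    obtain x where x: "image_mset x (mset_set S) = raw (Suc n) True"
      using ex_arrangement[OF S, of "raw (Suc n) True"] True size_raw[of n True] by metis
    define h where "h \<pi> r v = {p \<in> S. if r < Suc n then x (\<pi> p) r = v else x (\<pi> p) r}" for \<pi> :: "nat \<Rightarrow> nat" and r v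
    have Ab: "A (parity (Suc n) b) f = (\<Sum>\<pi> | \<pi> permutes S. of_real (1 / fact (card S)) * f (\<lambda>r. h \<pi> r (b r)))" for b f
    proof -
      have fx: "image_mset (flip (Suc n) b \<circ> x) (mset_set S) = raw (Suc n) (parity (Suc n) b)"
        using flip_raw[of "Suc n" b True] x by (simp flip: image_mset.compositionality del: raw.simps parity.simps)
      show ?thesis
        unfolding A_def arr_eq[OF S fx] F_def h_def flip_def
        by (intro sum.cong refl arg_cong2[where f = "(*)"] arg_cong[where f = f]) (auto simp: fun_eq_iff)
    qed
    have Aq: "A t f = (\<Sum>\<pi> | \<pi> permutes S. of_real (1 / fact (card S)) * parity_bits n t (\<lambda>b. f (\<lambda>r. h \<pi> r (b r))))" for t f
    proof -
      have "A t f = parity_bits n t (\<lambda>b. A (parity (Suc n) b) f)"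
        using parity_bits_cong[of n t "\<lambda>b. A (parity (Suc n) b) f" "\<lambda>_. A t f"] by (simp add: parity_bits_const del: parity.simps)
      then show ?thesis unfolding Ab lin_sum_scaled[OF lin_parity_bits] .
    qed
    have "((1 + s) * A True f + (1 - s) * A False f) / 2 =
      (\<Sum>\<pi> | \<pi> permutes S. of_real (1 / fact (card S)) * xor_law n s (\<lambda>b. f (\<lambda>r. h \<pi> r (b r))))" for f
      unfolding Aq xor_law_def sum_distrib_left sum.distrib[symmetric] sum_divide_distrib
      by (intro sum.cong refl) (simp add: field_simps)
    moreover have "good n (\<lambda>f. \<Sum>\<pi> | \<pi> permutes S. of_real (1 / fact (card S)) * xor_law n s (\<lambda>b. f (\<lambda>r. h \<pi> r (b r))))"
    proof (rule good_combination)
      show "good n (\<lambda>f. xor_law n s (\<lambda>b. f (\<lambda>r. h \<pi> r (b r))))" for \<pi>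
        by (rule good_rowwise[OF good_xor_law[OF s], of "h \<pi>"])
    qed (use S in \<open>auto simp: finite_permutations card_permutations norm_divide\<close>)
    ultimately show ?thesis by simp
  qed
  then show "good n (\<lambda>f. ext (\<lambda>M. arr S M (\<lambda>x. f (\<lambda>r. {p \<in> S. x p r}))) (half (Suc n) + sc s * dif (Suc n)))"
    unfolding expand[unfolded F_def] .
qed

section \<open>Pairwise independent labels\<close>

text \<open>The inner product over the field with two elements. Distinct nonempty sets are linearly
  independent vectors there, so the labels that they give are pairwise independent.\<close>

definition ip :: "nat set \<Rightarrow> nat set \<Rightarrow> bool" where
  "ip v y \<longleftrightarrow> odd (card (v \<inter> y))"

definition toggle :: "nat \<Rightarrow> nat set \<Rightarrow> nat set" where
  "toggle i y = (if i \<in> y then y - {i} else insert i y)"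

lemma ip_toggle: "finite v \<Longrightarrow> ip v (toggle i y) = (ip v y = (i \<notin> v))"
proof (cases "i \<in> v")
  case True
  assume fin: "finite v"
  show ?thesis
  proof (cases "i \<in> y")
    case True
    have "v \<inter> y = insert i (v \<inter> (y - {i}))" using True \<open>i \<in> v\<close> by auto
    then have "card (v \<inter> y) = Suc (card (v \<inter> (y - {i})))"
      using fin by (metis Diff_iff Int_iff card_insert_disjoint finite_Int insertI1)
    then show ?thesis using True \<open>i \<in> v\<close> by (simp add: ip_def toggle_def)
  next
    case False
    have "v \<inter> insert i y = insert i (v \<inter> y)" using \<open>i \<in> v\<close> by auto
    then have "card (v \<inter> insert i y) = Suc (card (v \<inter> y))" using fin False by simp
    then show ?thesis using False \<open>i \<in> v\<close> by (simp add: ip_def toggle_def)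
  qed
next
  case False
  then have "v \<inter> toggle i y = v \<inter> y" by (auto simp: toggle_def)
  then show ?thesis using False by (simp add: ip_def)
qed

lemma toggle_Pow: "i \<in> U \<Longrightarrow> bij_betw (toggle i) (Pow U) (Pow U)"
  by (rule bij_betw_byWitness[where f' = "toggle i"]) (auto simp: toggle_def split: if_splits)

lemma card_toggle:
  assumes "i \<in> U" "\<And>y. R (toggle i y) = R' y"
  shows "card {y \<in> Pow U. R y} = card {y \<in> Pow U. R' y}"
proof -
  have "bij_betw (toggle i) {y \<in> Pow U. R' y} {y \<in> Pow U. R y}"
    using toggle_Pow[OF assms(1)] assms(2) unfolding bij_betw_def
    by (auto simp: inj_on_def image_iff) (metis PowD PowI image_iff)
  then show ?thesis by (simp add: bij_betw_same_card)
qed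

lemma card_ip:
  assumes U: "finite U" "card U = Suc u" and v: "v \<subseteq> U" "v \<noteq> {}"
  shows "card {y \<in> Pow U. ip v y = \<alpha>} = 2 ^ u"
proof -
  obtain i where i: "i \<in> v" "i \<in> U" using v by auto
  have fin: "finite v" using U v finite_subset by blast
  have eq: "card {y \<in> Pow U. ip v y = \<alpha>} = card {y \<in> Pow U. ip v y = (\<not> \<alpha>)}"
    by (rule card_toggle[OF i(2)]) (use i(1) fin in \<open>auto simp: ip_toggle\<close>)
  have "card (Pow U) = card {y \<in> Pow U. ip v y = \<alpha>} + card {y \<in> Pow U. ip v y = (\<not> \<alpha>)}"
    using U by (subst card_Un_disjoint[symmetric]) (auto intro!: arg_cong[where f = card])
  then show ?thesis using eq U by (simp add: card_Pow)
qed

text \<open>A coordinate in exactly one of \<open>v\<close> and \<open>w\<close> changes one inner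
  product alone. With a further coordinate of \<open>v\<close> or \<open>w\<close> the other one can
  be changed as well, so the four classes have equal size.\<close>

lemma card_ip_pair:
  assumes U: "finite U" "card U = Suc (Suc u)"
    and v: "v \<subseteq> U" "v \<noteq> {}" "w \<subseteq> U" "w \<noteq> {}" "v \<noteq> w"
  shows "card {y \<in> Pow U. ip v y = \<alpha> \<and> ip w y = \<beta>} = 2 ^ u"
proof -
  define N where "N \<alpha> \<beta> = card {y \<in> Pow U. ip v y = \<alpha> \<and> ip w y = \<beta>}" for \<alpha> \<beta>
  have fin: "finite v" "finite w" using U v finite_subset by blast+
  have tog: "N (\<alpha> = (i \<notin> v)) (\<beta> = (i \<notin> w)) = N \<alpha> \<beta>" if "i \<in> U" for \<alpha> \<beta> i
    unfolding N_def by (rule card_toggle[OF that]) (use fin in \<open>auto simp: ip_toggle\<close>)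
  obtain i j l where ij: "i \<in> v" "j \<in> w" "l \<in> v \<longleftrightarrow> l \<notin> w" "i \<in> U" "j \<in> U" "l \<in> U"
    using v by blast
  have AB: "(\<forall>\<alpha> \<beta>. N (\<not> \<alpha>) \<beta> = N \<alpha> \<beta>) \<and> (\<forall>\<alpha> \<beta>. N \<alpha> (\<not> \<beta>) = N \<alpha> \<beta>)"
  proof (cases "l \<in> v")
    case True
    have A: "N (\<not> \<alpha>) \<beta> = N \<alpha> \<beta>" for \<alpha> \<beta> using tog[OF ij(6), of \<alpha> \<beta>] True ij(3) by simp
    have "N \<alpha> (\<not> \<beta>) = N \<alpha> \<beta>" for \<alpha> \<beta>
      using tog[OF ij(5), of \<alpha> \<beta>] A[of \<alpha> "\<not> \<beta>"] ij(2) by (cases "j \<in> v") auto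
    with A show ?thesis by blast
  next
    case False
    have B: "N \<alpha> (\<not> \<beta>) = N \<alpha> \<beta>" for \<alpha> \<beta> using tog[OF ij(6), of \<alpha> \<beta>] False ij(3) by simp
    have "N (\<not> \<alpha>) \<beta> = N \<alpha> \<beta>" for \<alpha> \<beta>
      using tog[OF ij(4), of \<alpha> \<beta>] B[of "\<not> \<alpha>" \<beta>] ij(1) by (cases "i \<in> w") auto
    with B show ?thesis by blast
  qed
  have "N True True = N False True" "N True False = N False False" "N True False = N True True"
    using AB by (metis (full_types))+
  then have "N \<alpha> \<beta> = N \<alpha>' \<beta>'" for \<alpha> \<beta> \<alpha>' \<beta>'
    by (cases \<alpha>; cases \<beta>; cases \<alpha>'; cases \<beta>') simp_all
  moreover have "{y \<in> Pow U. ip v y = \<alpha>} = {y \<in> Pow U. ip v y = \<alpha> \<and> ip w y = True} \<union> {y \<in> Pow U. ip v y = \<alpha> \<and> ip w y = False}"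
    by auto
  then have "card {y \<in> Pow U. ip v y = \<alpha>} = N \<alpha> True + N \<alpha> False"
    unfolding N_def using U by (simp only:) (rule card_Un_disjoint; auto)
  then have "2 ^ Suc u = N \<alpha> True + N \<alpha> False" using card_ip[OF U v(1,2), of \<alpha>] by simp
  ultimately have "2 * N \<alpha> \<beta> = 2 ^ Suc u" by (metis mult_2)
  then show ?thesis unfolding N_def by simp
qed

lemma prod_by_class:
  fixes F :: "bool \<Rightarrow> 'a :: comm_monoid_mult"
  assumes "finite W"
  shows "(\<Prod>w\<in>W. F (R w)) = F True ^ card {w \<in> W. R w} * F False ^ card {w \<in> W. \<not> R w}"
proof -
  have "(\<Prod>w\<in>W. F (R w)) = (\<Prod>w\<in>{w \<in> W. R w}. F (R w)) * (\<Prod>w\<in>{w \<in> W. \<not> R w}. F (R w))"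
    using assms by (subst prod.union_disjoint[symmetric]) (auto intro!: prod.cong)
  then show ?thesis by simp
qed

lemma card_even: "card {w \<in> {..<2 * m}. even w} = m" "card {w \<in> {..<2 * m}. odd w} = m"
proof (induction m)
  case (Suc m)
  have "{w \<in> {..<2 * Suc m}. even w} = insert (2 * m) {w \<in> {..<2 * m}. even w}"
    "{w \<in> {..<2 * Suc m}. odd w} = insert (Suc (2 * m)) {w \<in> {..<2 * m}. odd w}"
    by (auto simp: less_Suc_eq)
  then show "card {w \<in> {..<2 * Suc m}. even w} = Suc m" "card {w \<in> {..<2 * Suc m}. odd w} = Suc m"
    using Suc by simp_all
qed simp_all

section \<open>Two units of balanced types\<close>

lemma law_expand:
  fixes C E C' E' :: "'c law"
  shows "(\<Sum>t\<in>UNIV. \<Sum>t'\<in>UNIV. sc (\<kappa> t t') * ((C + sc (sg t) * E) * (C' + sc (sg t') * E'))) =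
    sc (\<kappa> True True + \<kappa> True False + \<kappa> False True + \<kappa> False False) * (C * C') +
    sc (\<kappa> True True + \<kappa> True False - \<kappa> False True - \<kappa> False False) * (E * C') +
    sc (\<kappa> True True - \<kappa> True False + \<kappa> False True - \<kappa> False False) * (C * E') +
    sc (\<kappa> True True - \<kappa> True False - \<kappa> False True + \<kappa> False False) * (E * E')"
  by (simp add: UNIV_bool single_add single_diff single_uminus algebra_simps)

text \<open>The average of (C + t E)(C' + t' E') over correlated signs t, t' has the coefficients w,
  \<theta> - b cnj \<theta>, its conjugate, and |\<theta>|^2 - b at CC', EC', CE' and EE'. Divided
  by w, this is a product at the centres \<alpha> and cnj \<alpha> plus a multiple of E E', the
  shape that \<open>tgood_bilinear\<close> handles.\<close>

lemma tgood_balanced: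
  fixes \<theta> :: complex and b \<beta> :: real
  assumes m: "mdisc n a C E r" "mdisc n a' C' E' r"
    and b: "0 < b" "b \<le> \<beta>\<^sup>2" "0 < \<beta>"
    and w: "w = 1 - b * (norm \<theta>)\<^sup>2" "0 < w"
    and r: "(norm \<theta> * (1 + b) + \<beta> * (1 + (norm \<theta>)\<^sup>2)) / w \<le> r"
  obtains Y where "tgood n (a + a') Y"
    "(\<Sum>t\<in>UNIV. \<Sum>t'\<in>UNIV. sc ((1 - of_real b * sg t * sg t') / 4 * (1 + \<theta> * sg t) * (1 + cnj \<theta> * sg t')) *
        ((C + sc (sg t) * E) * (C' + sc (sg t') * E'))) = sc (of_real w) * Y"
proof -
  define \<alpha> where "\<alpha> = (\<theta> - of_real b * cnj \<theta>) / of_real w"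
  \<comment> \<open>The required product is x y = - b |1 - \<theta>^2|^2 / w^2. The parameter
    \<beta> distributes it: since b is at most \<beta>^2, both factors satisfy the same
    bound.\<close>
  define x where "x = of_real \<beta> * (1 - \<theta>\<^sup>2) / of_real w"
  define y where "y = - (of_real (b / \<beta>) * cnj (1 - \<theta>\<^sup>2) / of_real w)"
  define Y where "Y = (C + sc \<alpha> * E) * (C' + sc (cnj \<alpha>) * E') + sc (x * y) * (E * E')"
  have w0: "complex_of_real w \<noteq> 0" using w(2) unfolding of_real_eq_0_iff by linarith
  have n1: "norm \<alpha> \<le> norm \<theta> * (1 + b) / w"
  proof -
    have "norm (\<theta> - of_real b * cnj \<theta>) \<le> norm \<theta> + norm (of_real b * cnj \<theta>)" by (rule norm_triangle_ineq4)
    also have "\<dots> = norm \<theta> * (1 + b)" using b by (simp add: norm_mult algebra_simps)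
    finally show ?thesis unfolding \<alpha>_def norm_divide norm_of_real using w(2) by (simp add: divide_right_mono)
  qed
  have n2: "norm (1 - \<theta>\<^sup>2) \<le> 1 + (norm \<theta>)\<^sup>2" using norm_triangle_ineq4[of 1 "\<theta>\<^sup>2"] by (simp add: norm_power)
  have n3: "norm x \<le> \<beta> * (1 + (norm \<theta>)\<^sup>2) / w"
    unfolding x_def norm_divide norm_mult norm_of_real using w(2) b n2 by (simp add: divide_right_mono)
  have "b / \<beta> \<le> \<beta>" using b by (simp add: pos_divide_le_eq power2_eq_square)
  then have "norm (complex_of_real (b / \<beta>)) * norm (cnj (1 - \<theta>\<^sup>2)) \<le> \<beta> * (1 + (norm \<theta>)\<^sup>2)"
    using b n2 unfolding norm_of_real complex_mod_cnj by (intro mult_mono) auto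
  then have n4: "norm y \<le> \<beta> * (1 + (norm \<theta>)\<^sup>2) / w"
    unfolding y_def norm_minus_cancel norm_divide norm_mult norm_of_real[of w] using w(2)
    by (simp only: abs_of_pos) (rule divide_right_mono; simp)
  have "tgood n (a + a') Y"
    unfolding Y_def using n1 n3 n4 r by (intro tgood_bilinear[OF m]) (auto simp: add_divide_distrib)
  moreover have "(\<Sum>t\<in>UNIV. \<Sum>t'\<in>UNIV. sc ((1 - of_real b * sg t * sg t') / 4 * (1 + \<theta> * sg t) * (1 + cnj \<theta> * sg t')) *
        ((C + sc (sg t) * E) * (C' + sc (sg t') * E'))) = sc (of_real w) * Y"
  proof -
    have nt: "complex_of_real w = 1 - of_real b * (\<theta> * cnj \<theta>)"
      by (simp only: w(1) of_real_diff of_real_mult complex_norm_square of_real_1)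
    have wa: "of_real w * \<alpha> = \<theta> - of_real b * cnj \<theta>" "of_real w * cnj \<alpha> = cnj \<theta> - of_real b * \<theta>"
      using w0 by (simp_all add: \<alpha>_def)
    have "of_real w * (of_real w * (\<alpha> * cnj \<alpha> + x * y)) = (of_real w * \<alpha>) * (of_real w * cnj \<alpha>) + (of_real w * x) * (of_real w * y)"
      by (simp add: algebra_simps)
    also have "(of_real w * x) * (of_real w * y) = - (of_real b * (1 - \<theta>\<^sup>2) * cnj (1 - \<theta>\<^sup>2))"
      using w0 b(3) by (simp add: x_def y_def)
    also have "(of_real w * \<alpha>) * (of_real w * cnj \<alpha>) + - (of_real b * (1 - \<theta>\<^sup>2) * cnj (1 - \<theta>\<^sup>2)) =
      of_real w * (\<theta> * cnj \<theta> - of_real b)"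
      unfolding wa unfolding nt by (simp add: algebra_simps power2_eq_square)
    finally have wxy: "of_real w * (\<alpha> * cnj \<alpha> + x * y) = \<theta> * cnj \<theta> - of_real b"
      using w0 by (metis mult_left_cancel)
    have Y: "sc (of_real w) * Y = sc (of_real w) * (C * C') + sc (of_real w * \<alpha>) * (E * C') +
        sc (of_real w * cnj \<alpha>) * (C * E') + sc (of_real w * (\<alpha> * cnj \<alpha> + x * y)) * (E * E')"
      unfolding Y_def by (simp only: sc_mult_sc[symmetric] single_add) (simp add: algebra_simps del: sc_mult_sc)
    show ?thesis
      unfolding law_expand Y wa wxy
      by (intro arg_cong2[where f = "(+)"] arg_cong2[where f = "(*)"] arg_cong[where f = "sc"] refl)
        (simp_all add: nt field_simps)
  qed
  ultimately show ?thesis by (rule that)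
qed

lemma sum_by_class:
  fixes F :: "bool \<Rightarrow> 'a :: comm_semiring_1"
  assumes "finite W"
  shows "(\<Sum>w\<in>W. F (R w)) = of_nat (card {w \<in> W. R w}) * F True + of_nat (card {w \<in> W. \<not> R w}) * F False"
proof -
  have "(\<Sum>w\<in>W. F (R w)) = (\<Sum>w\<in>{w \<in> W. R w}. F (R w)) + (\<Sum>w\<in>{w \<in> W. \<not> R w}. F (R w))"
    using assms by (subst sum.union_disjoint[symmetric]) (auto intro!: sum.cong)
  then show ?thesis by simp
qed

lemma prod_by_two_classes:
  fixes F :: "bool \<Rightarrow> bool \<Rightarrow> 'a :: comm_monoid_mult"
  assumes W: "finite W" and c: "\<And>\<alpha> \<beta>. card {w \<in> W. R w = \<alpha> \<and> R' w = \<beta>} = m"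
  shows "(\<Prod>w\<in>W. F (R w) (R' w)) = F True True ^ m * F True False ^ m * F False True ^ m * F False False ^ m"
proof -
  have "(\<Prod>w\<in>W. F (R w) (R' w)) = (\<Prod>p\<in>UNIV. \<Prod>w\<in>{w \<in> W. (R w, R' w) = p}. F (R w) (R' w))"
    using W by (intro prod.group[symmetric]) auto
  also have "\<dots> = (\<Prod>p\<in>UNIV. F (fst p) (snd p) ^ m)"
    using c by (intro prod.cong refl) (auto simp: prod_eq_iff)
  also have "(UNIV :: (bool \<times> bool) set) = {(True, True), (True, False), (False, True), (False, False)}"
    by auto
  finally show ?thesis by (simp add: mult_ac)
qed

lemma card_class_remove:
  assumes "finite W" "v \<in> W"
  shows "card {w \<in> W - {v}. R w} = card {w \<in> W. R w} - (if R v then 1 else 0)"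
proof -
  have "{w \<in> W - {v}. R w} = {w \<in> W. R w} - {v}" by auto
  then show ?thesis using assms by (simp add: card_Diff_singleton_if)
qed

section \<open>The hard distributions\<close>

text \<open>The covering columns per unit of the parameter \<open>q\<close>, read off from
  \<open>labelled_option\<close>: in the new row the idle units, one of each type, and
  \<open>2 * d n\<close> halves get bit 0, while of four older parts two get bit 1 and two get bit
  0.\<close>

primrec part :: "(nat \<Rightarrow> nat) \<Rightarrow> nat \<Rightarrow> (nat \<Rightarrow> bool) law" where
  "part d 0 = 1"
| "part d (Suc n) =
     push (\<lambda>c. c(Suc n := False)) (mon (raw (Suc n) True) * mon (raw (Suc n) False) * half (Suc n) ^ (2 * d n)) *
     push (\<lambda>c. c(Suc n := True)) (part d n ^ 2) * push (\<lambda>c. c(Suc n := False)) (part d n ^ 2)"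

primrec part_size :: "(nat \<Rightarrow> nat) \<Rightarrow> nat \<Rightarrow> nat" where
  "part_size d 0 = 0"
| "part_size d (Suc n) = (2 ^ n + 2 ^ n + 2 * d n * 2 ^ n) + 2 * part_size d n + 2 * part_size d n"

definition mlaw :: "(nat \<Rightarrow> nat) \<Rightarrow> nat \<Rightarrow> nat \<Rightarrow> bool \<Rightarrow> (nat \<Rightarrow> bool) law" where
  "mlaw d q n t = mon (raw (Suc n) t) * part d n ^ q"

lemma homog_part: "homog (part_size d n) (part d n)"
proof (induction n)
  case (Suc n)
  then show ?case unfolding part.simps part_size.simps
    by (intro homog_mult homog_push homog_power homog_half homog_single size_raw)
qed (simp add: homog_one)

lemma prob_law_half: "raw j True \<in> X \<Longrightarrow> raw j False \<in> X \<Longrightarrow> prob_law X (half j)"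
  unfolding half_def by (intro prob_law_avg prob_law_mon)

lemma prob_law_part: "prob_law UNIV (part d n)"
proof (induction n)
  case (Suc n)
  then show ?case unfolding part.simps
    by (intro prob_law_mult[where X = UNIV and Y = UNIV] prob_law_push[where X = UNIV]
        prob_law_power[where X = UNIV] prob_law_mon prob_law_half) auto
qed (simp add: prob_law_one)

lemma mon_add: "mon (M + N) = mon M * mon N"
  by (simp add: mult_single)

lemma mon_raw_Suc: "mon (raw (Suc j) t) =
    push (\<lambda>c. c(j := True)) (mon (raw j t)) * push (\<lambda>c. c(j := False)) (mon (raw j (\<not> t)))"
  by (simp add: mon_add)

lemma mlaw_eq: "mlaw d q n t = half (Suc n) * part d n ^ q + sc (sg t) * (dif (Suc n) * part d n ^ q)"
  unfolding mlaw_def mon_raw by (simp add: algebra_simps)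

text \<open>The partner of type opposite to \<open>t\<close> among \<open>N\<close> halves is affine
  in the sign of \<open>t\<close>, the form in which \<open>mdisc_anti\<close> multiplies it with
  the live unit.\<close>

lemma half_mask: "mon (raw j (\<not> t)) * half j ^ N = half j ^ Suc N - sc (sg t) * (half j ^ N * dif j)"
  unfolding mon_raw by (auto simp: algebra_simps single_uminus)

text \<open>The invariant of the recursion over rows. The hidden multisets \<open>mlaw\<close> of
  the two types sit at \<theta> = 1 and \<theta> = -1.\<close>

definition level :: "(nat \<Rightarrow> nat) \<Rightarrow> nat \<Rightarrow> nat \<Rightarrow> real \<Rightarrow> bool" where
  "level d q n \<rho> \<longleftrightarrow> (\<forall>\<theta>. norm \<theta> \<le> \<rho> \<longrightarrow> ugood n (2 ^ n + q * part_size d n)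
     (half (Suc n) * part d n ^ q + sc \<theta> * (dif (Suc n) * part d n ^ q)))"

lemma mdisc_level:
  assumes "level d q n \<rho>"
  shows "mdisc n (2 ^ n + q * part_size d n) (push (\<lambda>c. (c, l)) (half (Suc n) * part d n ^ q))
    (push (\<lambda>c. (c, l)) (dif (Suc n) * part d n ^ q)) \<rho>"
  unfolding mdisc_def
proof (intro allI impI)
  fix s :: complex assume "norm s \<le> \<rho>"
  then have "tgood n (2 ^ n + q * part_size d n)
     (push (\<lambda>c. (c, l)) (half (Suc n) * part d n ^ q + sc s * (dif (Suc n) * part d n ^ q)))"
    using assms by (intro tgood_tag) (simp add: level_def)
  then show "tgood n (2 ^ n + q * part_size d n) (push (\<lambda>c. (c, l)) (half (Suc n) * part d n ^ q) +
    sc s * push (\<lambda>c. (c, l)) (dif (Suc n) * part d n ^ q))" by simp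
qed

lemma mdisc_mask:
  "mdisc n (Suc N * 2 ^ n) (push (\<lambda>c. (c, l)) (half (Suc n) ^ Suc N))
    (push (\<lambda>c. (c, l)) (half (Suc n) ^ N * dif (Suc n))) (real (Suc N) * (1 / (2 ^ Suc n - 1)) / 2)"
proof -
  have "mdisc n (2 ^ n) (push (\<lambda>c. (c, l)) (half (Suc n))) (push (\<lambda>c. (c, l)) (dif (Suc n))) (1 / (2 ^ Suc n - 1))"
    unfolding mdisc_def
  proof (intro allI impI)
    fix s :: complex assume "norm s \<le> 1 / (2 ^ Suc n - 1)"
    from tgood_tag[OF ugood_unit[OF this], of l]
    show "tgood n (2 ^ n) (push (\<lambda>c. (c, l)) (half (Suc n)) + sc s * push (\<lambda>c. (c, l)) (dif (Suc n)))" by simp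
  qed
  from mdisc_among[OF this, of "Suc N"] show ?thesis by simp
qed

text \<open>The random labelled columns: \<open>2q + 2\<close> units with types balanced, of which the unit \<open>v\<close> is live under
  option \<open>v\<close>; dead columns; and \<open>4q\<close> parts with pairwise independent labels.\<close>

definition labelled :: "(nat \<Rightarrow> nat) \<Rightarrow> nat \<Rightarrow> nat \<Rightarrow> (nat \<Rightarrow> nat set) \<Rightarrow> nat set \<Rightarrow> ((nat \<Rightarrow> bool) \<times> (nat \<Rightarrow> bool)) law" where
  "labelled d q n e U =
     (\<Prod>w<2 * (q + 1). push (\<lambda>c. (c, \<lambda>v. v = w)) (mon (raw (Suc n) (even w)))) *
     push (\<lambda>c. (c, \<lambda>_. False)) (half (Suc n) ^ (2 * (d n * q))) *
     (\<Prod>y\<in>Pow U. push (\<lambda>c. (c, \<lambda>v. ip (e v) y)) (part d n))"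

definition labelled_size :: "(nat \<Rightarrow> nat) \<Rightarrow> nat \<Rightarrow> nat \<Rightarrow> nat" where
  "labelled_size d q n = 2 * (q + 1) * 2 ^ n + 2 * (d n * q) * 2 ^ n + 4 * q * part_size d n"

lemma homog_labelled:
  assumes "finite U" "card (Pow U) = 4 * q"
  shows "homog (labelled_size d q n) (labelled d q n e U)"
proof -
  have "homog ((\<Sum>w<2 * (q + 1). 2 ^ n) + 2 * (d n * q) * 2 ^ n + (\<Sum>y\<in>Pow U. part_size d n)) (labelled d q n e U)"
    unfolding labelled_def
    by (intro homog_mult homog_prod homog_push homog_power homog_half homog_single size_raw homog_part)
  then show ?thesis using assms by (simp add: labelled_size_def)
qed

lemma prob_law_labelled: "prob_law UNIV (labelled d q n e U)"
  unfolding labelled_def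
  by (intro prob_law_mult[where X = UNIV and Y = UNIV] prob_law_push[where X = UNIV] prob_law_prod
      prob_law_power[where X = UNIV] prob_law_mon prob_law_half prob_law_part) auto

text \<open>Taking one unit out of the balanced 2q + 2 leaves q pairs of opposite units and one unit
  of the opposite type, the partner of the removed one.\<close>

lemma units_remaining:
  assumes "v < 2 * (q + 1)"
  shows "(\<Prod>w\<in>{..<2 * (q + 1)} - {v}. F (even w)) = F (\<not> even v) * (F True * F False :: 'a :: comm_monoid_mult) ^ q"
proof -
  have v: "v \<in> {..<2 * (q + 1)}" using assms by simp
  have "card {w \<in> {..<2 * (q + 1)} - {v}. even w} = (if even v then q else q + 1)"
    "card {w \<in> {..<2 * (q + 1)} - {v}. odd w} = (if even v then q + 1 else q)"
    unfolding card_class_remove[OF finite_lessThan v] card_even by auto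
  then show ?thesis by (subst prod_by_class) (auto simp: power_mult_distrib mult_ac)
qed

lemma units_remaining2:
  assumes "v < 2 * (q + 1)" "v' < 2 * (q + 1)" "v \<noteq> v'" "0 < q"
  shows "(\<Prod>w\<in>{..<2 * (q + 1)} - {v} - {v'}. F (even w)) =
    F (\<not> even v) * F (\<not> even v') * (F True * F False :: 'a :: comm_monoid_mult) ^ (q - 1)"
proof -
  have v: "v \<in> {..<2 * (q + 1)}" "v' \<in> {..<2 * (q + 1)} - {v}" using assms by auto
  obtain p where q: "q = Suc p" using assms(4) by (cases q) auto
  have "card {w \<in> {..<2 * (q + 1)} - {v} - {v'}. even w} = q + 1 - (if even v then 1 else 0) - (if even v' then 1 else 0)"
    "card {w \<in> {..<2 * (q + 1)} - {v} - {v'}. odd w} = q + 1 - (if odd v then 1 else 0) - (if odd v' then 1 else 0)"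
    unfolding card_class_remove[OF finite_Diff[OF finite_lessThan] v(2)] card_class_remove[OF finite_lessThan v(1)]
      card_even by auto
  then show ?thesis unfolding q by (subst prod_by_class) (auto simp: power_mult_distrib mult_ac)
qed

text \<open>The live unit with bit 1 and its partner of opposite type with bit 0 form a unit of the
  same type over one more row, by the recursion of \<open>raw\<close>. The remaining columns are
  exactly \<open>q\<close> parts of the next level.\<close>

lemma labelled_option:
  assumes U: "finite U" "card U = Suc (Suc u)" and q: "q = 2 ^ u"
    and v: "v < 2 * (q + 1)" "e v \<subseteq> U" "e v \<noteq> {}"
  shows "push (\<lambda>(c, \<beta>). c(Suc n := \<beta> v)) (labelled d q n e U) = mlaw d q (Suc n) (even v)"
proof -
  let ?u = "\<lambda>b. push (\<lambda>c. c(Suc n := b))"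
  have 1: "(\<Prod>w<2 * (q + 1). ?u (v = w) (mon (raw (Suc n) (even w)))) =
      ?u True (mon (raw (Suc n) (even v))) * (?u False (mon (raw (Suc n) (\<not> even v))) *
        (?u False (mon (raw (Suc n) True)) * ?u False (mon (raw (Suc n) False))) ^ q)"
  proof -
    have "(\<Prod>w<2 * (q + 1). ?u (v = w) (mon (raw (Suc n) (even w)))) =
      ?u True (mon (raw (Suc n) (even v))) * (\<Prod>w\<in>{..<2 * (q + 1)} - {v}. ?u (v = w) (mon (raw (Suc n) (even w))))"
      using v(1) by (subst prod.remove[of _ v]) auto
    also have "(\<Prod>w\<in>{..<2 * (q + 1)} - {v}. ?u (v = w) (mon (raw (Suc n) (even w)))) =
        (\<Prod>w\<in>{..<2 * (q + 1)} - {v}. ?u False (mon (raw (Suc n) (even w))))"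
      by (intro prod.cong) auto
    finally show ?thesis
      unfolding units_remaining[OF v(1), of "\<lambda>t. ?u False (mon (raw (Suc n) t))"] .
  qed
  have c: "card {y \<in> Pow U. ip (e v) y} = 2 * q" "card {y \<in> Pow U. \<not> ip (e v) y} = 2 * q"
    using card_ip[OF U v(2,3), of True] card_ip[OF U v(2,3), of False] q by auto
  have 2: "(\<Prod>y\<in>Pow U. ?u (ip (e v) y) (part d n)) = ?u True (part d n) ^ (2 * q) * ?u False (part d n) ^ (2 * q)"
    using U by (subst prod_by_class) (simp_all only: c finite_Pow_iff)
  have "push (\<lambda>(c, \<beta>). c(Suc n := \<beta> v)) (labelled d q n e U) =
      (\<Prod>w<2 * (q + 1). ?u (v = w) (mon (raw (Suc n) (even w)))) * ?u False (half (Suc n) ^ (2 * (d n * q))) *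
      (\<Prod>y\<in>Pow U. ?u (ip (e v) y) (part d n))"
    unfolding labelled_def push_mult push_prod push_push case_prod_conv ..
  also have "\<dots> = mlaw d q (Suc n) (even v)"
    unfolding 1 2 mlaw_def mon_raw_Suc[of "Suc n"] part.simps push_mult push_power power_mult_distrib
    by (simp only: power_mult[symmetric] mult_ac)
  finally show ?thesis .
qed

text \<open>The two copies of the new row sort the columns into four classes, each of which receives
  \<open>q\<close> parts. (True, False) holds a hidden unit of the type of \<open>v\<close>, (False,
  True) one of the type of \<open>v'\<close>. The columns with (False, False) contain a partner of
  opposite type for each of them, and the halves are shared equally between the two
  partners.\<close>

lemma labelled_pair:
  assumes U: "finite U" "card U = Suc (Suc u)" and q: "q = 2 ^ u"
    and v: "v < 2 * (q + 1)" "e v \<subseteq> U" "e v \<noteq> {}" and v': "v' < 2 * (q + 1)" "e v' \<subseteq> U" "e v' \<noteq> {}"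
    and ne: "v \<noteq> v'" "e v \<noteq> e v'"
  shows "push (\<lambda>(c, \<beta>). (c, (\<beta> v, \<beta> v'))) (labelled d q n e U) =
    push (\<lambda>c. (c, (True, False))) (mlaw d q n (even v)) *
    push (\<lambda>c. (c, (False, False))) (mon (raw (Suc n) (\<not> even v)) * half (Suc n) ^ (d n * q)) *
    (push (\<lambda>c. (c, (False, True))) (mlaw d q n (even v')) *
     push (\<lambda>c. (c, (False, False))) (mon (raw (Suc n) (\<not> even v')) * half (Suc n) ^ (d n * q))) *
    (push (\<lambda>c. (c, (False, False))) ((mon (raw (Suc n) True) * mon (raw (Suc n) False)) ^ (q - 1) * part d n ^ q) *
     push (\<lambda>c. (c, (True, True))) (part d n ^ q))"
proof -
  let ?g = "\<lambda>a b. push (\<lambda>c. (c, (a, b)))"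
  have 1: "(\<Prod>w<2 * (q + 1). ?g (v = w) (v' = w) (mon (raw (Suc n) (even w)))) =
      ?g True False (mon (raw (Suc n) (even v))) * (?g False True (mon (raw (Suc n) (even v'))) *
      (?g False False (mon (raw (Suc n) (\<not> even v))) * ?g False False (mon (raw (Suc n) (\<not> even v'))) *
        (?g False False (mon (raw (Suc n) True)) * ?g False False (mon (raw (Suc n) False))) ^ (q - 1)))"
  proof -
    have "(\<Prod>w<2 * (q + 1). ?g (v = w) (v' = w) (mon (raw (Suc n) (even w)))) =
      ?g True False (mon (raw (Suc n) (even v))) *
      (\<Prod>w\<in>{..<2 * (q + 1)} - {v}. ?g (v = w) (v' = w) (mon (raw (Suc n) (even w))))"
      using v(1) ne by (subst prod.remove[of _ v]) auto
    also have "(\<Prod>w\<in>{..<2 * (q + 1)} - {v}. ?g (v = w) (v' = w) (mon (raw (Suc n) (even w)))) =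
      ?g False True (mon (raw (Suc n) (even v'))) *
      (\<Prod>w\<in>{..<2 * (q + 1)} - {v} - {v'}. ?g (v = w) (v' = w) (mon (raw (Suc n) (even w))))"
      using v'(1) ne by (subst prod.remove[of _ v']) auto
    also have "(\<Prod>w\<in>{..<2 * (q + 1)} - {v} - {v'}. ?g (v = w) (v' = w) (mon (raw (Suc n) (even w)))) =
        (\<Prod>w\<in>{..<2 * (q + 1)} - {v} - {v'}. ?g False False (mon (raw (Suc n) (even w))))"
      by (intro prod.cong) auto
    finally show ?thesis
      using units_remaining2[OF v(1) v'(1) ne(1), of "\<lambda>t. ?g False False (mon (raw (Suc n) t))"] q by simp
  qed
  have 2: "(\<Prod>y\<in>Pow U. ?g (ip (e v) y) (ip (e v') y) (part d n)) =
      ?g True True (part d n) ^ q * ?g True False (part d n) ^ q * ?g False True (part d n) ^ q * ?g False False (part d n) ^ q"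
    using U card_ip_pair[OF U v(2,3) v'(2,3) ne(2)] unfolding q
    by (intro prod_by_two_classes[where F = "\<lambda>a b. ?g a b (part d n)"]) simp_all
  have "push (\<lambda>(c, \<beta>). (c, (\<beta> v, \<beta> v'))) (labelled d q n e U) =
      (\<Prod>w<2 * (q + 1). ?g (v = w) (v' = w) (mon (raw (Suc n) (even w)))) *
      ?g False False (half (Suc n) ^ (2 * (d n * q))) *
      (\<Prod>y\<in>Pow U. ?g (ip (e v) y) (ip (e v') y) (part d n))"
    unfolding labelled_def push_mult push_prod push_push case_prod_conv ..
  then show ?thesis
    unfolding 1 2 mlaw_def push_mult push_power mult_2[of "d n * q"] power_add
    by (simp only: mult_ac)
qed

text \<open>With a single row only the total mass matters. On sets of the right size it is (1 +
  \<theta>)/2 + (1 - \<theta>)/2 = 1.\<close>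

lemma level_zero: "level d q 0 \<rho>"
  unfolding level_def ugood_def
proof (intro allI impI conjI)
  fix \<theta> :: complex
  have eq: "half (Suc 0) * part d 0 ^ q + sc \<theta> * (dif (Suc 0) * part d 0 ^ q) =
      sc ((1 + \<theta>) / 2) * mon (raw (Suc 0) True) + sc ((1 - \<theta>) / 2) * mon (raw (Suc 0) False)"
  proof -
    have s: "sc ((1 + \<theta>) / 2) = sc (1/2) + sc \<theta> * sc (1/2)" "sc ((1 - \<theta>) / 2) = sc (1/2) - sc \<theta> * sc (1/2)"
      unfolding sc_mult_sc single_add[symmetric] single_diff[symmetric] by (simp_all add: add_divide_distrib diff_divide_distrib)
    show ?thesis unfolding s half_def dif_def part.simps power_one mult_1_right by (simp only: algebra_simps)
  qed
  show "homog (2 ^ 0 + q * part_size d 0) (half (Suc 0) * part d 0 ^ q + sc \<theta> * (dif (Suc 0) * part d 0 ^ q))"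
    unfolding eq by (intro homog_add homog_scale homog_single) (simp_all add: size_raw del: raw.simps)
  fix S :: "nat set" assume S: "finite S"
  let ?L = "\<lambda>f. ext (\<lambda>M. arr S M (\<lambda>x. f (\<lambda>r. {p \<in> S. x p r})))
     (half (Suc 0) * part d 0 ^ q + sc \<theta> * (dif (Suc 0) * part d 0 ^ q))"
  have "lin ?L"
    unfolding lin_def linD(1)[OF lin_arr[OF S]] linD(2)[OF lin_arr[OF S]] linD(1)[OF lin_ext] linD(2)[OF lin_ext]
    by simp
  moreover have "norm (?L (\<lambda>_. 1)) \<le> 1"
  proof (cases "card S = 1")
    case True
    then show ?thesis unfolding eq ext_add ext_scale ext_single
      using S by (simp add: arr_const size_raw add_divide_distrib diff_divide_distrib del: raw.simps)
  next
    case False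
    then show ?thesis unfolding eq ext_add ext_scale ext_single
      by (simp add: arr_size size_raw del: raw.simps)
  qed
  ultimately show "good 0 ?L" by simp
qed

text \<open>Each unit can be combined with \<open>q\<close> other units of its own type and with
  \<open>q + 1\<close> of the opposite type; this is the negative correlation b = 1/(2q +
  1).\<close>

lemma sum_off_diagonal:
  fixes K :: "bool \<Rightarrow> bool \<Rightarrow> 'c law"
  shows "(\<Sum>v<2 * (q + 1). \<Sum>v'\<in>{..<2 * (q + 1)} - {v}. K (even v) (even v')) =
    (\<Sum>t\<in>UNIV. \<Sum>t'\<in>UNIV. sc (of_nat ((q + 1) * (if t = t' then q else q + 1))) * K t t')"
proof -
  define H where "H t = of_nat (q + 1) * K t True + of_nat (q + 1) * K t False - K t t" for t
  have "(\<Sum>v'\<in>{..<2 * (q + 1)} - {v}. K (even v) (even v')) = H (even v)" if "v < 2 * (q + 1)" for v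
  proof -
    have "(\<Sum>v'\<in>{..<2 * (q + 1)} - {v}. K (even v) (even v')) =
      (\<Sum>v'<2 * (q + 1). K (even v) (even v')) - K (even v) (even v)"
      using that by (simp only: sum_diff1 finite_lessThan lessThan_iff if_True)
    then show ?thesis unfolding H_def using sum_by_class[of "{..<2 * (q + 1)}" "K (even v)" even]
      by (simp only: card_even finite_lessThan simp_thms)
  qed
  then have "(\<Sum>v<2 * (q + 1). \<Sum>v'\<in>{..<2 * (q + 1)} - {v}. K (even v) (even v')) = (\<Sum>v<2 * (q + 1). H (even v))"
    by (intro sum.cong) auto
  also have "\<dots> = of_nat (q + 1) * H True + of_nat (q + 1) * H False"
    using sum_by_class[of "{..<2 * (q + 1)}" H even] by (simp only: card_even finite_lessThan simp_thms)
  finally show ?thesis unfolding H_def single_of_nat by (simp add: UNIV_bool algebra_simps)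
qed

text \<open>The options for the new row are the units. The diagonal of the pair law consists of
  nonnegative laws, which are good by \<open>tgood_prob\<close>. Off the diagonal,
  \<open>mdisc_anti\<close> treats a live unit together with its partner as C + t E, and
  \<open>tgood_balanced\<close> sums over the types of the two live units.\<close>

lemma level_Suc:
  fixes b \<beta> \<rho> \<rho>' r :: real
  assumes lev: "level d q n \<rho>" and q: "q = 2 ^ u" "0 < u"
    and r: "r < \<rho>" "r \<le> \<pi>" "1 + r\<^sup>2 \<le> (\<rho> - r) * (\<pi> - r)"
    and \<pi>: "\<pi> = real (Suc (d n * q)) * (1 / (2 ^ Suc n - 1)) / 2"
    and b: "b = 1 / (2 * real q + 1)" "b \<le> \<beta>\<^sup>2" "0 < \<beta>"
    and \<rho>': "0 < 1 - b * \<rho>'\<^sup>2" "(\<rho>' * (1 + b) + \<beta> * (1 + \<rho>'\<^sup>2)) / (1 - b * \<rho>'\<^sup>2) \<le> r"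
  shows "level d q (Suc n) \<rho>'"
  unfolding level_def
proof (intro allI impI)
  fix \<theta> :: complex assume \<theta>: "norm \<theta> \<le> \<rho>'"
  define U where "U = {..<Suc (Suc u)}"
  have U: "finite U" "card U = Suc (Suc u)" by (simp_all add: U_def)
  \<comment> \<open>For q = 1 the 4q - 1 nonempty label sets would be too few for 2q + 2
    units.\<close>
  have q2: "2 \<le> q" using q by (metis One_nat_def Suc_leI power_increasing power_one_right one_le_numeral)
  have "2 * (q + 1) \<le> card (Pow U - {{}})"
    using q q2 U by (simp add: card_Pow card_Diff_singleton_if)
  then obtain e where e: "e ` {..<2 * (q + 1)} \<subseteq> Pow U - {{}}" "inj_on e {..<2 * (q + 1)}"
    using card_le_inj[of "{..<2 * (q + 1)}" "Pow U - {{}}"] U by auto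
  have ev: "e v \<subseteq> U" "e v \<noteq> {}" if "v < 2 * (q + 1)" for v using e(1) that by auto
  have ene: "e v \<noteq> e v'" if "v < 2 * (q + 1)" "v' < 2 * (q + 1)" "v \<noteq> v'" for v v'
    using e(2) that by (auto simp: inj_on_def)
  define mu where "mu = labelled d q n e U"
  define N where "N = d n * q"
  define nn where "nn = 2 * (q + 1)"
  define a where "a = labelled_size d q n"
  have hom: "homog a mu" unfolding a_def mu_def using U q by (intro homog_labelled) (auto simp: card_Pow)
  have prob: "prob_law UNIV mu" unfolding mu_def by (rule prob_law_labelled)
  \<comment> \<open>The types being balanced, these weights add up to 1 for every \<theta>.\<close>
  define \<omega> where "\<omega> v = (1 + \<theta> * sg (even v)) / of_nat nn" for v :: nat

  define A where "A = half (Suc n) * part d n ^ q"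
  define B where "B = dif (Suc n) * part d n ^ q"
  define P0 where "P0 = half (Suc n) ^ Suc N"
  define P1 where "P1 = half (Suc n) ^ N * dif (Suc n)"
  let ?g = "\<lambda>a b :: bool. push (\<lambda>c :: nat \<Rightarrow> bool. (c, (a, b)))"
  \<comment> \<open>The unit of type t times its partner is (A + t B)(P0 - t P1). As t^2 = 1, the
    quadratic term joins C and the product is C + t E.\<close>
  define C where "C s s' = ?g s s' A * ?g False False P0 - ?g s s' B * ?g False False P1" for s s'
  define E where "E s s' = ?g s s' B * ?g False False P0 - ?g s s' A * ?g False False P1" for s s'
  define ax where "ax = (2 ^ n + q * part_size d n) + Suc N * 2 ^ n"
  define Rest where "Rest = ?g False False ((mon (raw (Suc n) True) * mon (raw (Suc n) False)) ^ (q - 1) * part d n ^ q) *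
     ?g True True (part d n ^ q)"
  have mX: "mdisc n ax (C s s') (E s s') r" for s s'
    unfolding ax_def C_def E_def A_def B_def P0_def P1_def
    by (rule mdisc_anti[OF mdisc_level[OF lev] mdisc_mask]) (use r \<pi> in \<open>simp_all add: N_def\<close>)
  have X: "?g s s' (mlaw d q n t) * ?g False False (mon (raw (Suc n) (\<not> t)) * half (Suc n) ^ (d n * q)) =
      C s s' + sc (sg t) * E s s'" for s s' t
  proof -
    have "mlaw d q n t = A + sc (sg t) * B" unfolding mlaw_eq A_def B_def ..
    moreover have "mon (raw (Suc n) (\<not> t)) * half (Suc n) ^ (d n * q) = P0 - sc (sg t) * P1"
      unfolding half_mask P0_def P1_def N_def ..
    moreover have "(x + sc (sg t) * y) * (x' - sc (sg t) * y') = (x * x' - y * y') + sc (sg t) * (y * x' - x * y')"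
      for x y x' y' :: "((nat \<Rightarrow> bool) \<times> bool \<times> bool) law"
      by (cases t) (simp_all add: algebra_simps single_uminus)
    ultimately show ?thesis unfolding C_def E_def by (simp only: push_add push_diff push_mult push_single image_mset_empty)
  qed
  have w: "0 < 1 - b * (norm \<theta>)\<^sup>2"
    "(norm \<theta> * (1 + b) + \<beta> * (1 + (norm \<theta>)\<^sup>2)) / (1 - b * (norm \<theta>)\<^sup>2) \<le> r"
  proof -
    have b0: "0 < b" by (simp add: b(1) add_pos_pos add_nonneg_pos)
    have sq: "(norm \<theta>)\<^sup>2 \<le> \<rho>'\<^sup>2" using \<theta> by (intro power_mono) auto
    then have bs: "b * (norm \<theta>)\<^sup>2 \<le> b * \<rho>'\<^sup>2" using b0 by simp
    then show "0 < 1 - b * (norm \<theta>)\<^sup>2" using \<rho>'(1) by linarith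
    have "(norm \<theta> * (1 + b) + \<beta> * (1 + (norm \<theta>)\<^sup>2)) / (1 - b * (norm \<theta>)\<^sup>2) \<le>
      (\<rho>' * (1 + b) + \<beta> * (1 + \<rho>'\<^sup>2)) / (1 - b * \<rho>'\<^sup>2)"
    proof (rule frac_le)
      show "norm \<theta> * (1 + b) + \<beta> * (1 + (norm \<theta>)\<^sup>2) \<le> \<rho>' * (1 + b) + \<beta> * (1 + \<rho>'\<^sup>2)"
        using \<theta> sq b0 b(3) by (intro add_mono mult_right_mono mult_left_mono) auto
      have "0 \<le> \<rho>'" using \<theta> norm_ge_zero[of \<theta>] by linarith
      then show "0 \<le> \<rho>' * (1 + b) + \<beta> * (1 + \<rho>'\<^sup>2)" using b0 b(3) by simp
    qed (use bs \<rho>'(1) in auto)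
    then show "(norm \<theta> * (1 + b) + \<beta> * (1 + (norm \<theta>)\<^sup>2)) / (1 - b * (norm \<theta>)\<^sup>2) \<le> r" using \<rho>'(2) by linarith
  qed
  have b0: "0 < b" by (simp add: b(1) add_pos_pos add_nonneg_pos)
  obtain Y where Y: "tgood n (ax + ax) Y"
    "(\<Sum>t\<in>UNIV. \<Sum>t'\<in>UNIV. sc ((1 - of_real b * sg t * sg t') / 4 * (1 + \<theta> * sg t) * (1 + cnj \<theta> * sg t')) *
        ((C True False + sc (sg t) * E True False) * (C False True + sc (sg t') * E False True))) =
      sc (of_real (1 - b * (norm \<theta>)\<^sup>2)) * Y"
    using tgood_balanced[OF mX[of True False] mX[of False True] b0 b(2,3) refl w] by blast
  \<comment> \<open>The share of pairs of distinct units among all ordered pairs.\<close>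
  define c0 where "c0 = (2 * real q + 1) / real nn"
  define wt where "wt = c0 * (1 - b * (norm \<theta>)\<^sup>2)"
  have restT: "tgood n ((q - 1) * (2 ^ n + 2 ^ n) + q * part_size d n + q * part_size d n) Rest"
  proof (rule tgood_prob)
    show "prob_law UNIV Rest"
      unfolding Rest_def
      by (intro prob_law_mult[where X = UNIV and Y = UNIV] prob_law_push[where X = UNIV]
        prob_law_power[where X = UNIV] prob_law_mon prob_law_part) auto
    show "homog ((q - 1) * (2 ^ n + 2 ^ n) + q * part_size d n + q * part_size d n) Rest"
      unfolding Rest_def by (intro homog_mult homog_push homog_power homog_single size_raw homog_part)
  qed
  have a: "a = (ax + ax) + ((q - 1) * (2 ^ n + 2 ^ n) + q * part_size d n + q * part_size d n)"
  proof -
    obtain p where "q = Suc p" using q2 by (cases q) auto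
    then show ?thesis unfolding a_def ax_def labelled_size_def N_def by (simp add: algebra_simps)
  qed
  have YR: "tgood n a (Y * Rest)" unfolding a by (rule tgood_mult[OF Y(1) restT])
  have diagT: "tgood n a (push (\<lambda>(c, \<beta>). (c, (\<beta> v, \<beta> v))) mu)" for v
    by (rule tgood_prob[of UNIV]) (auto intro: prob_law_push[OF prob] homog_push hom)
  define K where "K t t' = sc ((1 + \<theta> * sg t) * (1 + cnj \<theta> * sg t') / of_nat (nn * nn)) *
      ((C True False + sc (sg t) * E True False) * (C False True + sc (sg t') * E False True))" for t t'
  have nn0: "nn \<noteq> 0" by (simp add: nn_def)
  have off: "(\<Sum>v<nn. \<Sum>v'\<in>{..<nn} - {v}. sc (\<omega> v * cnj (\<omega> v')) * push (\<lambda>(c, \<beta>). (c, (\<beta> v, \<beta> v'))) mu) =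
      sc (of_real wt) * (Y * Rest)"
  proof -
    have "sc (\<omega> v * cnj (\<omega> v')) * push (\<lambda>(c, \<beta>). (c, (\<beta> v, \<beta> v'))) mu = K (even v) (even v') * Rest"
      if "v < nn" "v' \<in> {..<nn} - {v}" for v v'
    proof -
      have v: "v < 2 * (q + 1)" "v' < 2 * (q + 1)" "v \<noteq> v'" using that by (auto simp: nn_def)
      have "\<omega> v * cnj (\<omega> v') = (1 + \<theta> * sg (even v)) * (1 + cnj \<theta> * sg (even v')) / of_nat (nn * nn)"
        by (auto simp: \<omega>_def)
      then show ?thesis
        unfolding mu_def labelled_pair[OF U q(1) v(1) ev[OF v(1)] v(2) ev[OF v(2)] v(3) ene[OF v]] X K_def Rest_def
        by (simp only: mult.assoc)
    qed
    then have "(\<Sum>v<nn. \<Sum>v'\<in>{..<nn} - {v}. sc (\<omega> v * cnj (\<omega> v')) * push (\<lambda>(c, \<beta>). (c, (\<beta> v, \<beta> v'))) mu) =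
        (\<Sum>v<nn. \<Sum>v'\<in>{..<nn} - {v}. K (even v) (even v')) * Rest"
      unfolding sum_distrib_right by (intro sum.cong refl) simp
    also have "(\<Sum>v<nn. \<Sum>v'\<in>{..<nn} - {v}. K (even v) (even v')) =
      (\<Sum>t\<in>UNIV. \<Sum>t'\<in>UNIV. sc (of_nat ((q + 1) * (if t = t' then q else q + 1))) * K t t')"
      unfolding nn_def by (rule sum_off_diagonal)
    also have "\<dots> = sc (of_real c0) * (\<Sum>t\<in>UNIV. \<Sum>t'\<in>UNIV.
        sc ((1 - of_real b * sg t * sg t') / 4 * (1 + \<theta> * sg t) * (1 + cnj \<theta> * sg t')) *
        ((C True False + sc (sg t) * E True False) * (C False True + sc (sg t') * E False True)))"
    proof -
      have coef: "of_nat ((q + 1) * (if t = t' then q else q + 1)) / of_nat (nn * nn) =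
          complex_of_real c0 * ((1 - of_real b * sg t * sg t') / 4)" for t t'
      proof -
        have "real ((q + 1) * (if t = t' then q else q + 1)) / real (nn * nn) =
          c0 * ((1 - b * (if t = t' then 1 else -1)) / 4)"
        proof -
          have "4 + (real q * 8 + real q * (real q * 4)) \<noteq> 0" by (smt (verit) of_nat_0_le_iff mult_nonneg_nonneg)
          then show ?thesis
            unfolding c0_def b(1) nn_def by (auto simp: divide_simps) (simp_all add: algebra_simps)
        qed
        from arg_cong[where f = complex_of_real, OF this] show ?thesis
          by (cases t; cases t') simp_all
      qed
      have scz: "sc x * (sc y * Z) = sc x' * (sc y' * Z)" if "x * y = x' * y'"
        for x y x' y' and Z :: "((nat \<Rightarrow> bool) \<times> bool \<times> bool) law"
        unfolding mult.assoc[symmetric] sc_mult_sc that ..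
      have gen: "m * (x * y / z) = c * (\<kappa> * x * y)" if "m / z = c * \<kappa>" for m x y z c \<kappa> :: complex
      proof -
        have "m * (x * y / z) = m / z * (x * y)" by simp
        then show ?thesis unfolding that by simp
      qed
      show ?thesis
        unfolding sum_distrib_left K_def by (intro sum.cong refl scz gen coef)
    qed
    finally show ?thesis unfolding Y(2) wt_def by (simp add: mult.assoc[symmetric])
  qed
  have pair: "tgood n a (\<Sum>v<nn. \<Sum>v'<nn. sc (\<omega> v * cnj (\<omega> v')) * push (\<lambda>(c, \<beta>). (c, (\<beta> v, \<beta> v'))) mu)"
  proof -
    \<comment> \<open>One index for the whole off-diagonal part and one for each diagonal
      term.\<close>
    define I where "I = insert None (Some ` {..<nn})"
    define c where "c i = (case i of None \<Rightarrow> of_real wt | Some v \<Rightarrow> \<omega> v * cnj (\<omega> v))" for i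
    define T where "T i = (case i of None \<Rightarrow> Y * Rest | Some v \<Rightarrow> push (\<lambda>(c, \<beta>). (c, (\<beta> v, \<beta> v))) mu)" for i
    have "(\<Sum>v<nn. \<Sum>v'<nn. sc (\<omega> v * cnj (\<omega> v')) * push (\<lambda>(c, \<beta>). (c, (\<beta> v, \<beta> v'))) mu) =
      (\<Sum>v<nn. sc (\<omega> v * cnj (\<omega> v)) * push (\<lambda>(c, \<beta>). (c, (\<beta> v, \<beta> v))) mu) +
      (\<Sum>v<nn. \<Sum>v'\<in>{..<nn} - {v}. sc (\<omega> v * cnj (\<omega> v')) * push (\<lambda>(c, \<beta>). (c, (\<beta> v, \<beta> v'))) mu)"
      unfolding sum.distrib[symmetric] by (intro sum.cong refl) (simp add: sum.remove)
    also have "\<dots> = (\<Sum>i\<in>I. sc (c i) * T i)"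
      unfolding off I_def by (simp add: c_def T_def sum.reindex)
    finally have eq: "(\<Sum>v<nn. \<Sum>v'<nn. sc (\<omega> v * cnj (\<omega> v')) * push (\<lambda>(c, \<beta>). (c, (\<beta> v, \<beta> v'))) mu) =
      (\<Sum>i\<in>I. sc (c i) * T i)" .
    have "(\<Sum>v<nn. (norm (\<omega> v))\<^sup>2) = (1 + (norm \<theta>)\<^sup>2) / real nn"
    proof -
      have "(norm (\<omega> v))\<^sup>2 = (norm (1 + \<theta> * sg (even v)))\<^sup>2 / (real nn * real nn)" for v
        by (simp add: \<omega>_def norm_divide power_divide power2_eq_square)
      then have "(\<Sum>v<nn. (norm (\<omega> v))\<^sup>2) = (\<Sum>v<nn. (norm (1 + \<theta> * sg (even v)))\<^sup>2) / (real nn * real nn)"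
        by (simp add: sum_divide_distrib)
      also have "(\<Sum>v<nn. (norm (1 + \<theta> * sg (even v)))\<^sup>2) = real (q + 1) * (norm (1 + \<theta>))\<^sup>2 + real (q + 1) * (norm (1 - \<theta>))\<^sup>2"
        unfolding nn_def using sum_by_class[of "{..<2 * (q + 1)}" "\<lambda>t. (norm (1 + \<theta> * sg t))\<^sup>2" even]
        by (simp only: card_even finite_lessThan simp_thms) simp
      also have "\<dots> = real nn * (1 + (norm \<theta>)\<^sup>2)"
        unfolding nn_def cmod_power2 by (simp add: power2_eq_square algebra_simps)
      finally show ?thesis using nn0 by simp
    qed
    moreover have "norm (complex_of_real wt) = wt"
      unfolding norm_of_real wt_def c0_def using w(1) by (simp add: abs_mult)
    ultimately have "(\<Sum>i\<in>I. norm (c i)) = wt + (1 + (norm \<theta>)\<^sup>2) / real nn"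
      unfolding I_def by (simp add: c_def sum.reindex norm_mult power2_eq_square del: norm_of_real)
    \<comment> \<open>The correlation takes |\<theta>|^2/nn away from the off-diagonal weight, and
      the diagonal weights gain precisely this amount.\<close>
    also have "\<dots> = 1"
    proof -
      have "wt = c0 - c0 * b * (norm \<theta>)\<^sup>2" by (simp add: wt_def algebra_simps)
      moreover have "c0 * b = 1 / real nn" unfolding c0_def b(1) by (simp add: add_pos_pos add_nonneg_pos field_simps)
      moreover have "c0 + 1 / real nn = 1" unfolding c0_def nn_def by (simp add: field_simps)
      ultimately show ?thesis by (simp add: add_divide_distrib)
    qed
    finally show ?thesis unfolding eq
      by (intro tgood_combination) (auto simp: I_def T_def YR diagT)
  qed
  from ugood_Suc_labelled[OF prob hom _ this]
  have "ugood (Suc n) a (\<Sum>v<nn. sc (\<omega> v) * push (\<lambda>(c, \<beta>). c(Suc n := \<beta> v)) mu)" by simp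
  moreover have "(\<Sum>v<nn. sc (\<omega> v) * push (\<lambda>(c, \<beta>). c(Suc n := \<beta> v)) mu) =
      half (Suc (Suc n)) * part d (Suc n) ^ q + sc \<theta> * (dif (Suc (Suc n)) * part d (Suc n) ^ q)"
  proof -
    define G where "G t = sc ((1 + \<theta> * sg t) / of_nat nn) * mlaw d q (Suc n) t" for t
    have Gs: "of_nat (q + 1) * G t = sc ((1 + \<theta> * sg t) / 2) * mlaw d q (Suc n) t" for t
    proof -
      have "of_nat (q + 1) * ((1 + \<theta> * sg t) / of_nat nn) = (1 + \<theta> * sg t) / 2"
      proof -
        have "m * (x / (2 * m)) = x / 2" if "m \<noteq> 0" for m x :: complex using that by simp
        moreover have "complex_of_nat (q + 1) \<noteq> 0" by (simp only: of_nat_eq_0_iff)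
        moreover have "complex_of_nat nn = 2 * of_nat (q + 1)" by (simp only: nn_def of_nat_mult of_nat_numeral)
        ultimately show ?thesis by (simp only:)
      qed
      then have "sc (of_nat (q + 1)) * sc ((1 + \<theta> * sg t) / of_nat nn) = (sc ((1 + \<theta> * sg t) / 2) :: (nat \<Rightarrow> bool) law)"
        by (simp only: sc_mult_sc)
      then show ?thesis unfolding G_def by (simp only: single_of_nat mult.assoc[symmetric])
    qed
    have "(\<Sum>v<nn. sc (\<omega> v) * push (\<lambda>(c, \<beta>). c(Suc n := \<beta> v)) mu) = (\<Sum>v<nn. G (even v))"
      unfolding mu_def nn_def
      by (intro sum.cong refl, subst labelled_option[OF U q(1)]) (auto simp: ev G_def \<omega>_def nn_def)
    also have "\<dots> = of_nat (q + 1) * G True + of_nat (q + 1) * G False"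
      unfolding nn_def using sum_by_class[of "{..<2 * (q + 1)}" G even]
      by (simp only: card_even finite_lessThan simp_thms)
    also have "\<dots> = sc ((1 + \<theta> * sg True) / 2) * mlaw d q (Suc n) True + sc ((1 + \<theta> * sg False) / 2) * mlaw d q (Suc n) False"
      unfolding Gs ..
    also have "\<dots> =
      half (Suc (Suc n)) * part d (Suc n) ^ q + sc \<theta> * (dif (Suc (Suc n)) * part d (Suc n) ^ q)"
    proof -
      have s: "sc ((1 + \<theta> * sg True) / 2) + sc ((1 + \<theta> * sg False) / 2) = (1 :: (nat \<Rightarrow> bool) law)"
        "sc ((1 + \<theta> * sg True) / 2) - sc ((1 + \<theta> * sg False) / 2) = (sc \<theta> :: (nat \<Rightarrow> bool) law)"
        by (simp_all add: single_add[symmetric] single_diff[symmetric] add_divide_distrib[symmetric] diff_divide_distrib[symmetric])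
      have "x * (a + b) + y * (a - b) = (x + y) * a + (x - y) * b" for x y a b :: "(nat \<Rightarrow> bool) law"
        by (simp add: algebra_simps)
      moreover have "x + sc (sg True) * y = x + y" "x + sc (sg False) * y = x - y" for x y :: "(nat \<Rightarrow> bool) law"
        by (simp_all add: single_uminus)
      ultimately show ?thesis unfolding mlaw_eq by (simp only: s mult_1_left)
    qed
    finally show ?thesis .
  qed
  moreover have "a = 2 ^ Suc n + q * part_size d (Suc n)"
    unfolding a_def labelled_size_def part_size.simps by (simp add: algebra_simps)
  ultimately show "ugood (Suc n) (2 ^ Suc n + q * part_size d (Suc n))
     (half (Suc (Suc n)) * part d (Suc n) ^ q + sc \<theta> * (dif (Suc (Suc n)) * part d (Suc n) ^ q))" by simp
qed

section \<open>Choice of the parameters and count of the columns\<close>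

definition masks :: "nat \<Rightarrow> nat \<Rightarrow> nat \<Rightarrow> nat" where
  "masks k q n = 92 * k * 2 ^ n div q + 1"

text \<open>A row may cost 1/k of the radius, in two halves h = 1/(2k). The first pays for
  \<open>mdisc_anti\<close>: \<open>masks\<close> gives the mask a radius of at least 23 k, so that
  h times 20 k covers 1 + r^2, which is at most 10. The second pays for
  \<open>tgood_balanced\<close>: as q is at least 450 k^2, one may take \<beta> = 1/(30 k), and the
  loss 30 b + 10 \<beta> is at most 11/(30 k). The radius starts at 3 and stays at least 2.\<close>

lemma level_masks:
  assumes k: "0 < k" and q: "q = 2 ^ u" "450 * k\<^sup>2 \<le> q"
  shows "n < k \<Longrightarrow> level (masks k q) q n (3 - real n / real k)"
proof (induction n)
  case 0
  show ?case by (rule level_zero)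
next
  case (Suc n)
  define K where "K = real k"
  define \<rho>' where "\<rho>' = 3 - real (Suc n) / K"
  define b where "b = 1 / (2 * real q + 1)"
  have K: "1 \<le> K" using k by (simp add: K_def)
  have \<rho>': "2 \<le> \<rho>'" "\<rho>' \<le> 3" using Suc.prems K unfolding \<rho>'_def K_def by (auto simp: field_simps)
  have q450: "450 * K\<^sup>2 \<le> real q"
    using q(2) unfolding K_def by (metis of_nat_le_iff of_nat_mult of_nat_numeral of_nat_power)
  have b: "0 < b" "b \<le> (1 / (30 * K))\<^sup>2" "b * K \<le> 1 / 900"
  proof -
    show "0 < b" by (simp add: b_def add_nonneg_pos)
    have "b \<le> 1 / (900 * K\<^sup>2)" unfolding b_def using q450 K by (intro divide_left_mono) (auto intro!: mult_pos_pos)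
    then show "b \<le> (1 / (30 * K))\<^sup>2" by (simp add: power_divide power_mult_distrib)
    have "b * K \<le> 1 / (900 * K\<^sup>2) * K" using \<open>b \<le> 1 / (900 * K\<^sup>2)\<close> K by (intro mult_right_mono) auto
    also have "\<dots> = 1 / (900 * K)" using K by (simp add: power2_eq_square)
    also have "\<dots> \<le> 1 / 900" using K by (intro divide_left_mono) auto
    finally show "b * K \<le> 1 / 900" .
  qed
  have "b \<le> b * K" using b K by simp
  with b(3) have b900: "b \<le> 1 / 900" by linarith
  define h where "h = 1 / (2 * K)"
  have h: "0 < h" "h \<le> 1/2" "K * h = 1/2" using K by (auto simp: h_def field_simps)
  define \<pi> where "\<pi> = real (Suc (masks k q n * q)) * (1 / (2 ^ Suc n - 1)) / 2"
  have \<pi>: "23 * K \<le> \<pi>"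
  proof -
    have q0: "0 < q" using q by simp
    have "92 * k * 2 ^ n \<le> masks k q n * q"
      unfolding masks_def add_mult_distrib
      using div_mult_mod_eq[of "92 * k * 2 ^ n" q] mod_less_divisor[OF q0, of "92 * k * 2 ^ n"] by linarith
    then have "real (92 * k * 2 ^ n) \<le> real (masks k q n * q)" by (simp only: of_nat_le_iff)
    then have 1: "92 * K * 2 ^ n \<le> real (Suc (masks k q n * q))" by (simp add: K_def)
    have "23 * K * (2 * (2 ^ Suc n - 1)) \<le> 92 * K * 2 ^ n" using K by (simp add: algebra_simps)
    also have "\<dots> \<le> real (Suc (masks k q n * q))" by (rule 1)
    finally have *: "23 * K * (2 * (2 ^ Suc n - 1)) \<le> real (Suc (masks k q n * q))" .
    have "0 < 2 * (2 ^ Suc n - (1 :: real))" using one_less_power[of "2::real" "Suc n"] by (simp del: power_Suc)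
    from iffD2[OF pos_le_divide_eq[OF this] *]
    have "23 * K \<le> real (Suc (masks k q n * q)) / (2 * (2 ^ Suc n - 1))" .
    also have "\<dots> = \<pi>" by (simp only: \<pi>_def) simp
    finally show ?thesis .
  qed
  have \<rho>: "3 - real n / real k = \<rho>' + 2 * h" unfolding \<rho>'_def h_def K_def by (simp add: add_divide_distrib)
  have sq: "\<rho>'\<^sup>2 \<le> 9" using \<rho>' power_mono[of \<rho>' 3 2] by simp
  have "level (masks k q) q (Suc n) \<rho>'"
  proof (rule level_Suc[where r = "\<rho>' + h" and \<beta> = "1 / (30 * K)", OF Suc.IH q(1) _ _ _ _ \<pi>_def b_def b(2)])
    show "n < k" using Suc.prems by simp
    show "0 < u"
    proof (rule ccontr)
      assume "\<not> 0 < u"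
      then have "real q = 1" using q by simp
      moreover have "1 \<le> K\<^sup>2" using K by (simp add: one_le_power)
      ultimately show False using q450 by linarith
    qed
    show "\<rho>' + h < 3 - real n / real k" using \<rho> h by simp
    show "\<rho>' + h \<le> \<pi>" using \<pi> \<rho>' h K by linarith
    have r: "\<rho>' + h \<le> 3" using \<rho> h by (smt (verit) divide_nonneg_nonneg of_nat_0_le_iff)
    then have "(\<rho>' + h)\<^sup>2 \<le> 9" using power_mono[of "\<rho>' + h" 3 2] \<rho>' h by simp
    moreover have "10 \<le> h * (\<pi> - (\<rho>' + h))"
    proof -
      have "h * (20 * K) \<le> h * (\<pi> - (\<rho>' + h))" using \<pi> r K h by (intro mult_left_mono) linarith+
      moreover have "h * (20 * K) = 20 * (K * h)" by simp
      ultimately show ?thesis unfolding h(3) by linarith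
    qed
    ultimately show "1 + (\<rho>' + h)\<^sup>2 \<le> (3 - real n / real k - (\<rho>' + h)) * (\<pi> - (\<rho>' + h))"
      unfolding \<rho> by simp
    show "0 < 1 / (30 * K)" using K by simp
    have w: "b * \<rho>'\<^sup>2 \<le> b * 9" using sq b by simp
    then show w0: "0 < 1 - b * \<rho>'\<^sup>2" using b900 by linarith
    have "\<rho>' * (1 + b) + 1 / (30 * K) * (1 + \<rho>'\<^sup>2) \<le> (\<rho>' + h) * (1 - b * \<rho>'\<^sup>2)"
    proof -
      have e1: "\<rho>' * b \<le> 3 * b" using \<rho>' b by simp
      have e2: "1 / (30 * K) * (1 + \<rho>'\<^sup>2) \<le> 1 / (30 * K) * 10" using sq K by (intro mult_left_mono) auto
      have e3: "(\<rho>' + h) * (b * \<rho>'\<^sup>2) \<le> 3 * (b * 9)" using r w \<rho>' h b by (intro mult_mono) auto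
      have "30 * b * K \<le> 30 / 900" using b(3) by simp
      then have "30 * b \<le> 30 / 900 / K" using K by (simp add: pos_le_divide_eq)
      then have e4: "30 * b + 1 / (30 * K) * 10 \<le> (30 / 900 + 1 / 3) / K" by (simp add: add_divide_distrib)
      have "(30 / 900 + 1 / 3) / K \<le> h" unfolding h_def using K by (simp add: field_simps)
      with e1 e2 e3 e4 show ?thesis by (simp add: algebra_simps)
    qed
    then show "(\<rho>' * (1 + b) + 1 / (30 * K) * (1 + \<rho>'\<^sup>2)) / (1 - b * \<rho>'\<^sup>2) \<le> \<rho>' + h"
      using w0 by (simp add: pos_divide_le_eq)
  qed
  then show ?case by (simp only: \<rho>'_def K_def)
qed

text \<open>The recursion multiplies by 4. The term n/(8k) collects the masks, which add 4^n/(2k)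
  per row up to terms of order 2^n; those are absorbed by the subtracted 2 * 2^n.\<close>

lemma part_size_masks:
  assumes k: "0 < k" and q: "450 * k\<^sup>2 \<le> q"
  shows "real (part_size (masks k q) n) \<le> 4 ^ n * (2 + real n / real k / 8) - 2 * 2 ^ n"
proof (induction n)
  case (Suc n)
  have k1: "1 \<le> real k" using k by simp
  have q0: "0 < real q" using k q by (metis of_nat_0_less_iff gr0I le_zero_eq mult_eq_0_iff power_eq_0_iff zero_neq_numeral less_irrefl)
  have q450: "450 * (real k)\<^sup>2 \<le> real q"
    using q by (metis of_nat_le_iff of_nat_mult of_nat_numeral of_nat_power)
  have "real (92 * k * 2 ^ n div q * q) \<le> real (92 * k * 2 ^ n)"
    by (simp only: of_nat_le_iff div_times_less_eq_dividend)
  then have "real (92 * k * 2 ^ n div q) \<le> real (92 * k * 2 ^ n) / real q"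
    using q0 by (simp only: pos_le_divide_eq of_nat_mult)
  also have "\<dots> \<le> real (92 * k * 2 ^ n) / (450 * (real k)\<^sup>2)"
    using q450 k1 q0 by (intro divide_left_mono) auto
  also have "\<dots> = 92 / 450 * (2 ^ n / real k)" using k1 by (simp add: power2_eq_square)
  also have "\<dots> \<le> 1 / 4 * (2 ^ n / real k)" using k1 by (intro mult_right_mono) auto
  finally have "real (masks k q n) \<le> 1 / 4 * (2 ^ n / real k) + 1" by (simp add: masks_def)
  then have "real (masks k q n) * 2 ^ n \<le> (1 / 4 * (2 ^ n / real k) + 1) * 2 ^ n" by (intro mult_right_mono) auto
  also have "\<dots> = 1 / 4 * (4 ^ n / real k) + 2 ^ n"
    by (simp add: algebra_simps power_mult_distrib[symmetric])
  finally have m: "real (masks k q n) * 2 ^ n \<le> 1 / 4 * (4 ^ n / real k) + 2 ^ n" .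
  have "real (part_size (masks k q) (Suc n)) = 2 * 2 ^ n + 2 * (real (masks k q n) * 2 ^ n) + 4 * real (part_size (masks k q) n)"
    by simp
  also have "\<dots> \<le> 2 * 2 ^ n + 2 * (1 / 4 * (4 ^ n / real k) + 2 ^ n) + 4 * (4 ^ n * (2 + real n / real k / 8) - 2 * 2 ^ n)"
    by (intro add_mono order_refl mult_left_mono m Suc.IH) simp_all
  also have "\<dots> = 4 ^ Suc n * (2 + real (Suc n) / real k / 8) - 2 * 2 ^ Suc n"
    by (simp add: algebra_simps add_divide_distrib)
  finally show ?case .
qed simp

section \<open>Two distributions on disjointness inputs\<close>

definition disjoint_cols :: "nat \<Rightarrow> (nat \<Rightarrow> bool) multiset set" where
  "disjoint_cols k = {M. \<forall>c\<in>#M. \<exists>i<k. \<not> c i}"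

definition meeting_cols :: "nat \<Rightarrow> (nat \<Rightarrow> bool) multiset set" where
  "meeting_cols k = {M. \<exists>c\<in>#M. \<forall>i<k. c i}"

lemma raw_all_ones: "c \<in># raw j s \<Longrightarrow> \<forall>i<j. c i \<Longrightarrow> s"
proof (induction j arbitrary: s c)
  case (Suc j)
  then consider c' where "c' \<in># raw j s" "c = c'(j := True)" | c' where "c = c'(j := False)" by auto
  then show ?case
  proof cases
    case 1
    then have "\<forall>i<j. c' i" using Suc.prems(2) by auto
    then show ?thesis using Suc.IH 1 by blast
  qed (use Suc.prems(2) in auto)
qed (simp split: if_splits)

lemma raw_True_meeting: "raw j True \<in> meeting_cols j"
proof (induction j)
  case (Suc j)
  then obtain c where c: "c \<in># raw j True" "\<forall>i<j. c i" by (auto simp: meeting_cols_def)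
  then have "c(j := True) \<in># raw (Suc j) True" "\<forall>i<Suc j. (c(j := True)) i" by (auto simp: less_Suc_eq)
  then show ?case unfolding meeting_cols_def by blast
qed (simp add: meeting_cols_def)

lemma raw_False_disjoint: "raw j False \<in> disjoint_cols j"
  using raw_all_ones[of _ j False] by (auto simp: disjoint_cols_def)

lemma disjoint_cols_add: "M \<in> disjoint_cols k \<Longrightarrow> N \<in> disjoint_cols k \<Longrightarrow> M + N \<in> disjoint_cols k"
  by (auto simp: disjoint_cols_def)

lemma disjoint_cols_zero: "0 \<in> disjoint_cols k"
  by (simp add: disjoint_cols_def)

text \<open>A column of a part gets bit 0 in the new row or extends a column of an older part, so an
  all-ones column never arises.\<close>

lemma prob_law_part_disjoint: "prob_law (disjoint_cols (Suc n)) (part d n)"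
proof (induction n)
  case (Suc n)
  have 1: "prob_law (disjoint_cols (Suc (Suc n))) (push (\<lambda>c. c(Suc n := False)) \<mu>)" if "prob_law UNIV \<mu>" for \<mu>
    by (rule prob_law_push[OF that]) (auto simp: disjoint_cols_def)
  have 2: "prob_law (disjoint_cols (Suc (Suc n))) (push (\<lambda>c. c(Suc n := True)) (part d n ^ 2))"
  proof (rule prob_law_push)
    show "prob_law (disjoint_cols (Suc n)) (part d n ^ 2)"
      by (rule prob_law_power[OF Suc disjoint_cols_zero disjoint_cols_add])
    fix M assume "M \<in> disjoint_cols (Suc n)"
    then have M: "\<forall>c\<in>#M. \<exists>i<Suc n. \<not> c i" unfolding disjoint_cols_def mem_Collect_eq .
    have "\<forall>c\<in>#image_mset (\<lambda>c. c(Suc n := True)) M. \<exists>i<Suc (Suc n). \<not> c i"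
    proof
      fix c' assume "c' \<in># image_mset (\<lambda>c. c(Suc n := True)) M"
      then obtain c where c: "c \<in># M" "c' = c(Suc n := True)" unfolding set_image_mset by (rule imageE)
      obtain i where i: "i < Suc n" "\<not> c i" using bspec[OF M c(1)] by (elim exE conjE)
      show "\<exists>i<Suc (Suc n). \<not> c' i" unfolding c(2) by (rule exI[of _ i]) (use i in simp)
    qed
    then show "image_mset (\<lambda>c. c(Suc n := True)) M \<in> disjoint_cols (Suc (Suc n))"
      unfolding disjoint_cols_def mem_Collect_eq .
  qed
  have U: "prob_law UNIV (mon (raw (Suc n) True) * mon (raw (Suc n) False) * half (Suc n) ^ (2 * d n))"
    by (intro prob_law_mult[where X = UNIV and Y = UNIV] prob_law_power[where X = UNIV] prob_law_mon prob_law_half) auto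
  have V: "prob_law UNIV (part d n ^ 2)"
    by (intro prob_law_power[where X = UNIV] prob_law_part) auto
  show ?case unfolding part.simps
    by (rule prob_law_mult[OF prob_law_mult[OF 1[OF U] 2 disjoint_cols_add] 1[OF V] disjoint_cols_add])
qed (simp add: prob_law_one disjoint_cols_zero)

lemma prob_law_mlaw_False: "prob_law (disjoint_cols (Suc n)) (mlaw d q n False)"
  unfolding mlaw_def
  by (rule prob_law_mult[OF prob_law_mon[OF raw_False_disjoint]
        prob_law_power[OF prob_law_part_disjoint disjoint_cols_zero disjoint_cols_add] disjoint_cols_add])

lemma prob_law_mlaw_True: "prob_law (meeting_cols (Suc n)) (mlaw d q n True)"
  unfolding mlaw_def
  by (rule prob_law_mult[OF prob_law_mon[OF raw_True_meeting] prob_law_power[OF prob_law_part]])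
    (auto simp: meeting_cols_def)

definition mass :: "'c law \<Rightarrow> complex" where
  "mass \<mu> = ext (\<lambda>_. 1) \<mu>"

lemma mass_mult: "mass (\<mu> * \<nu>) = mass \<mu> * mass \<nu>"
  unfolding mass_def ext_mult using lin_multr[OF lin_ext, of "\<lambda>_. 1" "ext (\<lambda>_. 1) \<nu>" \<mu>] by simp

lemma mass_one: "mass 1 = 1"
  using ext_single[of "\<lambda>_. 1" 0 1] by (simp add: mass_def del: ext_single)

lemma mass_power: "mass (\<mu> ^ m) = mass \<mu> ^ m"
  by (induction m) (simp_all add: mass_mult mass_one)

lemma mass_push: "mass (push h \<mu>) = mass \<mu>"
  by (simp add: mass_def ext_push)

lemma mass_mon: "mass (mon M) = 1"
  by (simp add: mass_def)

lemma mass_half: "mass (half j) = 1"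
  by (simp add: mass_def half_def)

lemma mass_part: "mass (part d n) = 1"
  by (induction n) (simp_all only: part.simps mass_one mass_mult mass_push mass_power mass_mon mass_half power_one mult_1_left)

lemma mass_mlaw: "mass (mlaw d q n t) = 1"
  by (simp add: mlaw_def mass_mult mass_mon mass_power mass_part)

text \<open>\<open>L0\<close> arranges N hidden blocks of type False, so DISJ is 1 on its support;
  for \<open>L1\<close> one of the blocks has type True and supplies an all-ones column.\<close>

lemma ex_block_laws:
  assumes k: "0 < k" and N: "0 < N"
  obtains a :: nat and L0 L1 :: "((nat \<Rightarrow> nat set) \<Rightarrow> complex) \<Rightarrow> complex" where
    "real a \<le> 500 * (real k)\<^sup>2 * 4 ^ k"
    "subprob {X. \<forall>p. \<exists>i<k. p \<notin> X i} L0" "subprob {X. \<exists>p<N * a. \<forall>i<k. p \<in> X i} L1"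
    "L0 (\<lambda>_. 1) = 1" "L1 (\<lambda>_. 1) = 1"
    "\<And>s. norm s \<le> real N / 4 \<Longrightarrow> good (k - 1) (\<lambda>f. (1 - s) * L0 f + s * L1 f)"
proof -
  obtain n where n: "k = Suc n" using k by (cases k) auto
  \<comment> \<open>The label sets force \<open>q\<close> to be a power of two; one lies between 450
    k^2 and 900 k^2.\<close>
  obtain u where u: "2 ^ u \<le> 900 * k\<^sup>2" "900 * k\<^sup>2 < 2 ^ (u + 1)"
    using ex_power_ivl1[of 2 "900 * k\<^sup>2"] k by auto
  define q :: nat where "q = 2 ^ u"
  have q: "450 * k\<^sup>2 \<le> q" "q \<le> 900 * k\<^sup>2" using u by (auto simp: q_def)
  define d where "d = masks k q"
  define a where "a = 2 ^ n + q * part_size d n"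
  define S where "S = {..<N * a}"
  define RT where "RT = mlaw d q n True"
  define RF where "RF = mlaw d q n False"
  define L where "L \<mu> f = ext (\<lambda>M. arr S M (\<lambda>x. f (\<lambda>r. {p \<in> S. x p r}))) \<mu>" for \<mu> and f :: "(nat \<Rightarrow> nat set) \<Rightarrow> complex"
  define T where "T = RF ^ N"
  define H where "H = RF ^ (N - 1) * RT"
  have S: "finite S" "card S = N * a" by (simp_all add: S_def)
  have lev: "level d q n 2"
  proof -
    have "level d q n (3 - real n / real k)" unfolding d_def by (rule level_masks[OF k q_def q(1)]) (simp add: n)
    moreover have "2 \<le> 3 - real n / real k" using n by (simp add: field_simps)
    ultimately show ?thesis unfolding level_def by auto
  qed
  have size: "real a \<le> 500 * (real k)\<^sup>2 * 4 ^ k"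
  proof -
    have "real (part_size d n) \<le> 4 ^ n * (2 + real n / real k / 8) - 2 * 2 ^ n"
      unfolding d_def by (rule part_size_masks[OF k q(1)])
    also have "\<dots> \<le> 4 ^ n * (17/8)"
    proof -
      have "real n / real k \<le> 1" using n by simp
      then have "4 ^ n * (2 + real n / real k / 8) \<le> 4 ^ n * (17/8)" by (intro mult_left_mono) auto
      then show ?thesis using zero_le_power[of "2::real" n] by linarith
    qed
    finally have ps: "real (part_size d n) \<le> 4 ^ n * (17/8)" .
    have "real q \<le> 900 * (real k)\<^sup>2" using q(2) by (metis of_nat_le_iff of_nat_mult of_nat_numeral of_nat_power)
    then have "real q * real (part_size d n) \<le> 900 * (real k)\<^sup>2 * (4 ^ n * (17/8))"
      using ps by (intro mult_mono) auto
    moreover have "(2::real) ^ n \<le> 4 ^ n * (real k)\<^sup>2"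
    proof -
      have "(2::real) ^ n * 1 \<le> 4 ^ n * (real k)\<^sup>2" using k by (intro mult_mono power_mono) (auto simp: one_le_power)
      then show ?thesis by simp
    qed
    moreover have "real a = 2 ^ n + real q * real (part_size d n)" by (simp add: a_def)
    moreover have "4 ^ n * (real k)\<^sup>2 + 900 * (real k)\<^sup>2 * (4 ^ n * (17/8)) = 3827 / 2 * (4 ^ n * (real k)\<^sup>2)"
      by simp
    moreover have "500 * (real k)\<^sup>2 * 4 ^ k = 2000 * (4 ^ n * (real k)\<^sup>2)" unfolding power_Suc n by simp
    moreover have "0 \<le> 4 ^ n * (real k)\<^sup>2" by simp
    ultimately show ?thesis by linarith
  qed
  \<comment> \<open>Type False is \<theta> = -1, and s corresponds to \<theta> = 2 s - 1. Radius 2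
    for \<theta> therefore leaves 1/2 for s, and hiding among N blocks turns this into N/4.\<close>
  have m1: "mdisc n a (push (\<lambda>c. (c, ())) RF) (push (\<lambda>c. (c, ())) (RT - RF)) (1/2)"
    unfolding mdisc_def
  proof (intro allI impI)
    fix s :: complex assume s: "norm s \<le> 1/2"
    have "norm (2 * s - 1) \<le> 2" using norm_triangle_ineq4[of "2 * s" 1] s by (simp add: norm_mult)
    then have "ugood n a (half (Suc n) * part d n ^ q + sc (2 * s - 1) * (dif (Suc n) * part d n ^ q))"
      using lev by (simp add: level_def a_def)
    moreover have "half (Suc n) * part d n ^ q + sc (2 * s - 1) * (dif (Suc n) * part d n ^ q) = RF + sc s * (RT - RF)"
    proof -
      have "sc (2 * s - 1) = sc s + sc s - (1 :: (nat \<Rightarrow> bool) law)"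
        by (simp add: single_add[symmetric] single_diff[symmetric] flip: single_one)
      moreover have "x + (sc s + sc s - 1) * y = (x - y) + sc s * ((x + y) - (x - y))" for x y :: "(nat \<Rightarrow> bool) law"
        by (simp add: algebra_simps)
      moreover have "x + sc (sg True) * y = x + y" "x + sc (sg False) * y = x - y" for x y :: "(nat \<Rightarrow> bool) law"
        by (simp_all add: single_uminus)
      ultimately show ?thesis unfolding RF_def RT_def mlaw_eq by (simp only:)
    qed
    ultimately have "ugood n a (RF + sc s * (RT - RF))" by simp
    from tgood_tag[OF this, of "()"]
    show "tgood n a (push (\<lambda>c. (c, ())) RF + sc s * push (\<lambda>c. (c, ())) (RT - RF))" by simp
  qed
  have good: "good n (\<lambda>f. (1 - s) * L T f + s * L H f)" if s: "norm s \<le> real N / 4" for s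
  proof -
    have "tgood n (N * a) (push (\<lambda>c. (c, ())) (T + sc s * (H - T)))"
    proof -
      have "H - T = RF ^ (N - 1) * (RT - RF)"
        using N by (cases N) (simp_all add: H_def T_def algebra_simps)
      then show ?thesis using mdiscD[OF mdisc_among[OF m1 N], of s] s by (simp add: T_def)
    qed
    from ugood_of_tgood[OF this] have "good n (L (T + sc s * (H - T)))"
      using S(1) unfolding ugood_def L_def[abs_def] by blast
    moreover have "L (T + sc s * (H - T)) f = (1 - s) * L T f + s * L H f" for f
    proof -
      have "T + sc s * (H - T) = sc (1 - s) * T + sc s * H" by (simp add: single_diff algebra_simps)
      then show ?thesis unfolding L_def by (simp only: ext_add ext_scale)
    qed
    then have "L (T + sc s * (H - T)) = (\<lambda>f. (1 - s) * L T f + s * L H f)" by (rule ext)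
    ultimately show ?thesis by (simp only:)
  qed
  have hom: "homog (N * a) T" "homog (N * a) H"
  proof -
    have h: "homog a RF" "homog a RT"
      unfolding RF_def RT_def mlaw_def a_def by (intro homog_mult homog_power homog_part homog_single size_raw)+
    show "homog (N * a) T" unfolding T_def by (rule homog_power[OF h(1)])
    have "homog ((N - 1) * a + a) H" unfolding H_def by (intro homog_mult homog_power h)
    then show "homog (N * a) H" using N by (cases N) (simp_all add: add.commute)
  qed
  have L1: "L \<mu> (\<lambda>_. 1) = mass \<mu>" if "homog (N * a) \<mu>" for \<mu>
    unfolding L_def mass_def by (rule ext_cong_homog[OF that]) (simp add: arr_const S)
  have sub: "subprob Y (L \<mu>)" if p: "prob_law Z \<mu>"
    and z: "\<And>M x. M \<in> Z \<Longrightarrow> image_mset x (mset_set S) = M \<Longrightarrow> (\<lambda>r. {p \<in> S. x p r}) \<in> Y" for Y Z \<mu>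
    unfolding L_def
  proof (rule subprob_bind[of Z "\<lambda>\<phi>. ext \<phi> \<mu>"])
    show "subprob Z (\<lambda>\<phi>. ext \<phi> \<mu>)" using p by (simp add: prob_law_def)
    show "subprob Y (\<lambda>f. arr S M (\<lambda>x. f (\<lambda>r. {p \<in> S. x p r})))" if "M \<in> Z" for M
      by (rule subprob_map[OF subprob_arr[OF S(1)]]) (use z that in auto)
  qed
  have pT: "prob_law (disjoint_cols k) T"
    unfolding T_def RF_def n by (rule prob_law_power[OF prob_law_mlaw_False disjoint_cols_zero disjoint_cols_add])
  have pH: "prob_law (meeting_cols k) H"
    unfolding H_def RF_def RT_def n
    by (rule prob_law_mult[OF prob_law_power[OF prob_law_mono[OF prob_law_mlaw_False subset_UNIV]] prob_law_mlaw_True])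
      (auto simp: meeting_cols_def)
  show thesis
  proof (rule that[OF size, of "L T" "L H"])
    show "subprob {X. \<forall>p. \<exists>i<k. p \<notin> X i} (L T)"
    proof (rule sub[OF pT], clarify)
      fix x p
      assume x: "image_mset x (mset_set S) \<in> disjoint_cols k"
      show "\<exists>i<k. p \<notin> {p \<in> S. x p i}"
      proof (cases "p \<in> S")
        case True
        then show ?thesis using x S(1) by (auto simp: disjoint_cols_def)
      qed (use k in auto)
    qed
    show "subprob {X. \<exists>p<N * a. \<forall>i<k. p \<in> X i} (L H)"
      by (rule sub[OF pH], auto simp: meeting_cols_def S_def, blast)
    show "L T (\<lambda>_. 1) = 1" "L H (\<lambda>_. 1) = 1"
      using L1[OF hom(1)] L1[OF hom(2)] by (simp_all add: T_def H_def RF_def RT_def mass_mult mass_power mass_mlaw)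
  qed (use good n in simp)
qed

section \<open>Products over blocks\<close>

primrec blocks :: "(nat \<Rightarrow> ((nat \<Rightarrow> 'r) \<Rightarrow> complex) \<Rightarrow> complex) \<Rightarrow> nat \<Rightarrow> ((nat \<Rightarrow> nat \<Rightarrow> 'r) \<Rightarrow> complex) \<Rightarrow> complex" where
  "blocks L 0 f = f (\<lambda>r t. undefined)"
| "blocks L (Suc n) f = blocks L n (\<lambda>X. L n (\<lambda>Y. f (\<lambda>r. (X r)(n := Y r))))"

lemma good_blocks: "(\<And>t. t < n \<Longrightarrow> good m (L t)) \<Longrightarrow> good m (blocks L n)"
proof (induction n)
  case 0
  have "blocks L 0 = (\<lambda>f. f (\<lambda>r t. undefined))" by (simp add: fun_eq_iff)
  then show ?case using good_point[of m "\<lambda>r t. undefined"] by simp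
next
  case (Suc n)
  have "good m (\<lambda>f. blocks L n (\<lambda>X. L n (\<lambda>Y. f (glue (\<lambda>r x y. x(n := y)) X Y))))"
    using Suc by (intro good_glue) auto
  then show ?case by (simp add: glue_def)
qed

lemma lin_blocks: "(\<And>t. t < n \<Longrightarrow> lin (L t)) \<Longrightarrow> lin (blocks L n)"
proof (induction n)
  case (Suc n)
  then have "lin (L n)" "lin (blocks L n)" by auto
  then show ?case by (simp add: lin_def)
qed (simp add: lin_def)

lemma blocks_cong: "(\<And>t. t < n \<Longrightarrow> L t = L' t) \<Longrightarrow> blocks L n = blocks L' n"
proof (induction n)
  case (Suc n)
  then have "blocks L n = blocks L' n" "L n = L' n" by auto
  then show ?case by (simp add: fun_eq_iff)
qed (simp add: fun_eq_iff)

lemma subprob_blocks: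
  assumes "\<And>t. t < n \<Longrightarrow> subprob (Z t) (L t)"
  shows "subprob {X. \<forall>t<n. (\<lambda>r. X r t) \<in> Z t} (blocks L n)"
  using assms
proof (induction n)
  case 0
  have "blocks L 0 = (\<lambda>f. f (\<lambda>r t. undefined))" by (simp add: fun_eq_iff)
  then show ?case by (simp add: subprob_point)
next
  case (Suc n)
  have "subprob {X. \<forall>t<Suc n. (\<lambda>r. X r t) \<in> Z t} (\<lambda>f. blocks L n (\<lambda>X. L n (\<lambda>Y. f (\<lambda>r. (X r)(n := Y r)))))"
  proof (rule subprob_bind[where K = "\<lambda>X f. L n (\<lambda>Y. f (\<lambda>r. (X r)(n := Y r)))"])
    show "subprob {X. \<forall>t<n. (\<lambda>r. X r t) \<in> Z t} (blocks L n)" using Suc by simp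
    fix X assume X: "X \<in> {X. \<forall>t<n. (\<lambda>r. X r t) \<in> Z t}"
    show "subprob {X. \<forall>t<Suc n. (\<lambda>r. X r t) \<in> Z t} (\<lambda>f. L n (\<lambda>Y. f (\<lambda>r. (X r)(n := Y r))))"
    proof (rule subprob_map[OF Suc.prems[of n], where h = "\<lambda>Y r. (X r)(n := Y r)"])
      fix Y assume "Y \<in> Z n"
      then show "(\<lambda>r. (X r)(n := Y r)) \<in> {X. \<forall>t<Suc n. (\<lambda>r. X r t) \<in> Z t}"
        using X by (auto simp: less_Suc_eq)
    qed simp
  qed
  then show ?case by simp
qed

lemma blocks_mass: "(\<And>t. t < n \<Longrightarrow> L t (\<lambda>_. 1) = 1) \<Longrightarrow> blocks L n (\<lambda>_. 1) = 1"
  by (induction n) auto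

lemma blocks_expand:
  assumes "\<And>t. t < n \<Longrightarrow> lin (P t)" "\<And>t. t < n \<Longrightarrow> lin (D t)"
  shows "blocks (\<lambda>t g. P t g + w t * D t g) n f =
    (\<Sum>S\<in>Pow {..<n}. (\<Prod>t\<in>S. w t) * blocks (\<lambda>t. if t \<in> S then D t else P t) n f)"
  using assms
proof (induction n arbitrary: f)
  case (Suc n)
  let ?B = "\<lambda>S. blocks (\<lambda>t. if t \<in> S then D t else P t)"
  let ?P = "\<lambda>X. P n (\<lambda>Y. f (\<lambda>r. (X r)(n := Y r)))"
  let ?D = "\<lambda>X. D n (\<lambda>Y. f (\<lambda>r. (X r)(n := Y r)))"
  have lin: "lin (?B S n)" for S using Suc.prems by (intro lin_blocks) auto
  have eq: "?B (insert n S) n = ?B S n" for S by (rule blocks_cong) auto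
  have "blocks (\<lambda>t g. P t g + w t * D t g) (Suc n) f =
      (\<Sum>S\<in>Pow {..<n}. (\<Prod>t\<in>S. w t) * ?B S n (\<lambda>X. ?P X + w n * ?D X))"
    using Suc by simp
  also have "\<dots> = (\<Sum>S\<in>Pow {..<n}. (\<Prod>t\<in>S. w t) * ?B S n ?P) +
      (\<Sum>S\<in>Pow {..<n}. w n * (\<Prod>t\<in>S. w t) * ?B S n ?D)"
    unfolding linD(1)[OF lin] linD(2)[OF lin] sum.distrib[symmetric]
    by (intro sum.cong refl) (simp add: algebra_simps)
  also have "(\<Sum>S\<in>Pow {..<n}. (\<Prod>t\<in>S. w t) * ?B S n ?P) = (\<Sum>S\<in>Pow {..<n}. (\<Prod>t\<in>S. w t) * ?B S (Suc n) f)"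
    by (intro sum.cong refl) (auto simp: subset_iff)
  also have "(\<Sum>S\<in>Pow {..<n}. w n * (\<Prod>t\<in>S. w t) * ?B S n ?D) =
      (\<Sum>S\<in>insert n ` Pow {..<n}. (\<Prod>t\<in>S. w t) * ?B S (Suc n) f)"
  proof (subst sum.reindex)
    show "inj_on (insert n) (Pow {..<n})"
      by (rule inj_onI) (metis PowD insert_ident lessThan_iff less_irrefl subsetD)
    show "(\<Sum>S\<in>Pow {..<n}. w n * (\<Prod>t\<in>S. w t) * ?B S n ?D) =
      sum ((\<lambda>S. (\<Prod>t\<in>S. w t) * ?B S (Suc n) f) \<circ> insert n) (Pow {..<n})"
    proof (rule sum.cong[OF refl])
      fix S assume S: "S \<in> Pow {..<n}"
      then have "n \<notin> S" "finite S" by (auto intro: finite_subset)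
      then show "w n * (\<Prod>t\<in>S. w t) * ?B S n ?D = ((\<lambda>S. (\<Prod>t\<in>S. w t) * ?B S (Suc n) f) \<circ> insert n) S"
        using eq[of S] by simp
    qed
  qed
  also have "(\<Sum>S\<in>Pow {..<n}. (\<Prod>t\<in>S. w t) * ?B S (Suc n) f) +
      (\<Sum>S\<in>insert n ` Pow {..<n}. (\<Prod>t\<in>S. w t) * ?B S (Suc n) f) =
      (\<Sum>S\<in>Pow {..<n} \<union> insert n ` Pow {..<n}. (\<Prod>t\<in>S. w t) * ?B S (Suc n) f)"
    by (intro sum.union_disjoint[symmetric]) auto
  also have "Pow {..<n} \<union> insert n ` Pow {..<n} = Pow {..<Suc n}"
    by (simp add: lessThan_Suc Pow_insert)
  finally show ?case .
qed simp

section \<open>Low-degree approximation\<close>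

text \<open>Cauchy's estimate for polynomials, with the integral over the circle replaced by an
  average over n + 1 equally spaced points.\<close>

lemma coefficient_bound:
  fixes q :: "nat \<Rightarrow> complex"
  assumes R: "0 < R" and b: "\<And>u. norm u = R \<Longrightarrow> norm (\<Sum>i\<le>n. q i * u ^ i) \<le> B" and j: "j \<le> n"
  shows "norm (q j) * R ^ j \<le> B"
proof -
  define K where "K = Suc n"
  define w where "w k = cis (2 * pi * real k / real K)" for k
  have K: "0 < K" by (simp add: K_def)
  note roots = sum_roots_of_unity[OF K, folded w_def]
  have "(\<Sum>k<K. (\<Sum>i\<le>n. q i * (of_real R * w k) ^ i) * w k ^ (K - j)) =
      (\<Sum>i\<le>n. q i * of_real R ^ i * (\<Sum>k<K. w k ^ (i + (K - j))))"
    unfolding sum_distrib_left sum_distrib_right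
    by (subst sum.swap) (intro sum.cong refl, simp add: power_mult_distrib power_add mult_ac)
  also have "\<dots> = (\<Sum>i\<le>n. if i = j then q j * of_real R ^ j * of_nat K else 0)"
  proof (intro sum.cong refl)
    fix i assume i: "i \<in> {..n}"
    have "K dvd i + (K - j) \<longleftrightarrow> i = j"
    proof
      assume d: "K dvd i + (K - j)"
      then obtain c where c: "i + (K - j) = K * c" by (elim dvdE)
      have "K * c < K * 2" "0 < K * c" unfolding c[symmetric] using i j by (auto simp: K_def)
      then have "c < 2" "0 < c" using K by (simp_all only: mult_less_cancel1 nat_0_less_mult_iff)
      then have "c = 1" by simp
      then show "i = j" using c j by (simp add: K_def)
    qed (use j in \<open>simp add: K_def\<close>)
    then show "q i * of_real R ^ i * (\<Sum>k<K. w k ^ (i + (K - j))) = (if i = j then q j * of_real R ^ j * of_nat K else 0)"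
      unfolding roots by simp
  qed
  also have "\<dots> = q j * of_real R ^ j * of_nat K" using j by simp
  finally have eq: "q j * of_real R ^ j * of_nat K =
    (\<Sum>k<K. (\<Sum>i\<le>n. q i * (of_real R * w k) ^ i) * w k ^ (K - j))" by simp
  have "norm (q j * of_real R ^ j * of_nat K) \<le> (\<Sum>k<K. B)"
    unfolding eq
  proof (rule sum_norm_le)
    fix k
    have "norm (\<Sum>i\<le>n. q i * (of_real R * w k) ^ i) \<le> B" using R by (intro b) (simp add: norm_mult w_def)
    then show "norm ((\<Sum>i\<le>n. q i * (of_real R * w k) ^ i) * w k ^ (K - j)) \<le> B"
      by (simp add: norm_mult norm_power w_def)
  qed
  then have "norm (q j) * R ^ j * real K \<le> real K * B" using R by (simp add: norm_mult norm_power)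
  then show ?thesis using K by simp
qed

text \<open>The Cauchy estimates form a geometric series of ratio 1/R; since R is at least 2, its
  sum is at most twice the first term.\<close>

lemma tail_bound:
  fixes q :: "nat \<Rightarrow> complex"
  assumes R: "2 \<le> R" and b: "\<And>u. norm u = R \<Longrightarrow> norm (\<Sum>i\<le>n. q i * u ^ i) \<le> B"
  shows "norm ((\<Sum>i\<le>n. q i) - (\<Sum>i\<in>{..n} \<inter> {..<d}. q i)) \<le> 2 * B / R ^ d"
proof -
  have B: "0 \<le> B" using b[of "of_real R"] R norm_ge_zero order_trans by (metis abs_of_nonneg norm_of_real zero_le_numeral)
  have "(\<Sum>i\<le>n. q i) - (\<Sum>i\<in>{..n} \<inter> {..<d}. q i) = (\<Sum>i\<in>{..n} - {..n} \<inter> {..<d}. q i)"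
    by (subst sum_diff) auto
  also have "norm \<dots> \<le> (\<Sum>i\<in>{..n} - {..n} \<inter> {..<d}. B / R ^ i)"
  proof (rule sum_norm_le)
    fix i assume i: "i \<in> {..n} - {..n} \<inter> {..<d}"
    have "norm (q i) * R ^ i \<le> B"
    proof (rule coefficient_bound[where R = R and q = q and n = n])
      show "norm (\<Sum>i\<le>n. q i * u ^ i) \<le> B" if "norm u = R" for u by (rule b[OF that])
    qed (use R i in auto)
    then show "norm (q i) \<le> B / R ^ i"
      using R by (simp add: pos_le_divide_eq)
  qed
  also have "\<dots> \<le> (\<Sum>i\<in>{d..<d + Suc n}. B / R ^ i)"
    using B R by (intro sum_mono2) auto
  also have "\<dots> \<le> 2 * B / R ^ d"
  proof -
    have "(\<Sum>i\<in>{d..<d + l}. B / R ^ i) \<le> 2 * B / R ^ d - 2 * (B / R ^ (d + l))" for l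
    proof (induction l)
      case 0
      show ?case using B R by simp
    next
      case (Suc l)
      have "2 * (B / R ^ (d + Suc l)) \<le> R * (B / R ^ (d + Suc l))" using B R by (intro mult_right_mono) auto
      also have "\<dots> = B / R ^ (d + l)" using R by simp
      finally have "2 * (B / R ^ (d + Suc l)) \<le> B / R ^ (d + l)" .
      moreover have "(\<Sum>i\<in>{d..<d + Suc l}. B / R ^ i) = (\<Sum>i\<in>{d..<d + l}. B / R ^ i) + B / R ^ (d + l)" by simp
      ultimately show ?case using Suc.IH by linarith
    qed
    from this[of "Suc n"] show ?thesis using B R by (smt (verit) divide_nonneg_nonneg zero_le_power)
  qed
  finally show ?thesis .
qed

section \<open>Multilinear polynomials and the one-sided degree\<close>

definition mono_exp :: "nat set \<Rightarrow> (nat \<Rightarrow>\<^sub>0 nat)" where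
  "mono_exp S = (\<Sum>t\<in>S. Poly_Mapping.single t 1)"

definition multilinear :: "nat set set \<Rightarrow> (nat set \<Rightarrow> real) \<Rightarrow> real_mpoly" where
  "multilinear \<S> c = (\<Sum>S\<in>\<S>. Poly_Mapping.single (mono_exp S) (c S))"

lemma lookup_mono_exp: "finite S \<Longrightarrow> Poly_Mapping.lookup (mono_exp S) t = (if t \<in> S then 1 else 0)"
  by (simp add: mono_exp_def lookup_sum lookup_single when_def)

lemma keys_mono_exp: "finite S \<Longrightarrow> Poly_Mapping.keys (mono_exp S) = S"
  by (auto simp: in_keys_iff lookup_mono_exp split: if_splits)

lemma keys_multilinear: "finite \<S> \<Longrightarrow> Poly_Mapping.keys (multilinear \<S> c) \<subseteq> mono_exp ` \<S>"
  unfolding multilinear_def by (rule order_trans[OF keys_sum]) auto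

lemma mpoly_eval_add: "mpoly_eval (p + q) x = mpoly_eval p x + mpoly_eval q x"
  unfolding mpoly_eval_def by (rule setsum_keys_plus_distrib) (simp_all add: algebra_simps)

lemma mpoly_eval_single: "mpoly_eval (Poly_Mapping.single a c) x =
    c * (\<Prod>i\<in>Poly_Mapping.keys a. x i ^ Poly_Mapping.lookup a i)"
  by (cases "c = 0") (simp_all add: mpoly_eval_def)

lemma mpoly_eval_multilinear:
  assumes "finite \<S>" "\<And>S. S \<in> \<S> \<Longrightarrow> finite S"
  shows "mpoly_eval (multilinear \<S> c) x = (\<Sum>S\<in>\<S>. c S * (\<Prod>t\<in>S. x t))"
proof -
  have single: "mpoly_eval (Poly_Mapping.single (mono_exp S) (c S)) x = c S * (\<Prod>t\<in>S. x t)" if "finite S" for S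
    using that by (simp add: mpoly_eval_single keys_mono_exp lookup_mono_exp cong: prod.cong)
  show ?thesis using assms unfolding multilinear_def
  proof (induction \<S> rule: finite_induct)
    case (insert S \<S>)
    then show ?case by (simp add: mpoly_eval_add single)
  qed (simp add: mpoly_eval_def)
qed

lemma deg_plus_less:
  assumes \<S>: "\<And>S. S \<in> \<S> \<Longrightarrow> S \<subseteq> {..<n} \<and> card S < d" and d: "0 < d"
    and approx: "onesided_approx n f \<epsilon> (multilinear \<S> c)"
  shows "deg_plus n f \<epsilon> < d"
proof -
  let ?p = "multilinear \<S> c"
  have fin: "finite \<S>" using \<S> by (intro finite_subset[of \<S> "Pow {..<n}"]) auto
  have S: "finite S" if "S \<in> \<S>" for S using \<S>[OF that] finite_subset by blast
  have keys: "\<exists>S\<in>\<S>. a = mono_exp S" if "a \<in> Poly_Mapping.keys ?p" for a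
    using keys_multilinear[OF fin, of c] that by auto
  have "mpoly_vars ?p \<subseteq> {..<n}"
    unfolding mpoly_vars_def using keys \<S> S by (force simp: keys_mono_exp)
  then have "deg_plus n f \<epsilon> \<le> mpoly_degree ?p"
    unfolding deg_plus_def using approx by (intro Least_le) blast
  also have "mpoly_degree ?p < d"
  proof -
    have "(\<Sum>i\<in>Poly_Mapping.keys a. Poly_Mapping.lookup a i) < d" if a: "a \<in> Poly_Mapping.keys ?p" for a
    proof -
      obtain s where s: "s \<in> \<S>" "a = mono_exp s" using keys[OF a] by blast
      then show ?thesis using \<S>[OF s(1)] S[OF s(1)] by (simp add: keys_mono_exp lookup_mono_exp cong: sum.cong)
    qed
    then show ?thesis unfolding mpoly_degree_def using d by (subst Max_less_iff) auto
  qed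
  finally show ?thesis .
qed

lemma subprob_Re_nonneg:
  assumes P: "subprob X P" and f: "\<And>x. x \<in> X \<Longrightarrow> 0 \<le> Re (f x)"
  shows "0 \<le> Re (P f)"
proof -
  obtain A :: "(real \<times> _) list" where A: "\<forall>(c, x)\<in>set A. 0 \<le> c \<and> x \<in> X"
    "P = (\<lambda>f. \<Sum>(c, x)\<leftarrow>A. of_real c * f x)" using P by (auto simp: subprob_def)
  have "0 \<le> Re (\<Sum>(c, x)\<leftarrow>B. of_real c * f x)" if "\<forall>(c, x)\<in>set B. 0 \<le> c \<and> x \<in> X" for B
    using that by (induction B) (auto intro!: add_nonneg_nonneg mult_nonneg_nonneg f)
  then show ?thesis using A by simp
qed

definition disj_values :: "nat \<Rightarrow> nat \<Rightarrow> nat \<Rightarrow> (nat \<Rightarrow> nat \<Rightarrow> nat set) \<Rightarrow> nat \<Rightarrow> bool" where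
  "disj_values n m k X = (\<lambda>t\<in>{..<n}. DISJ m k (\<lambda>i p. p \<in> X i t))"

text \<open>Let block t have the law L1 + z_t u (L0 - L1). The expectation of F is then a polynomial
  in u whose coefficient at u^i is homogeneous of degree i in z. Goodness bounds it by B for |u| =
  R, and u = 1 gives inputs with DISJ values z. Cutting off at degree
  \<open>deg_plus n f \<epsilon>\<close> changes the value at 1 by at most 2 B / R^deg; were the
  claim false, a polynomial of smaller degree would approximate f.\<close>

lemma deg_plus_bound:
  fixes F :: "(nat \<Rightarrow> nat \<Rightarrow> nat set) \<Rightarrow> real"
  assumes L: "subprob {X. \<forall>p. \<exists>i<k. p \<notin> X i} L0" "subprob {X. \<exists>p<b. \<forall>i<k. p \<in> X i} L1"
      "L0 (\<lambda>_. 1) = 1" "L1 (\<lambda>_. 1) = 1"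
    and good: "\<And>s. norm s \<le> R + 1 \<Longrightarrow> good (k - 1) (\<lambda>f. (1 - s) * L0 f + s * L1 f)"
    and R: "2 \<le> R" and b: "b \<le> m"
    and F: "\<And>L. good (k - 1) L \<Longrightarrow> norm (L (\<lambda>X. of_real (F X))) \<le> B"
      "\<And>X. \<not> f (disj_values n m k X) \<Longrightarrow> \<bar>F X\<bar> \<le> \<delta>"
      "\<And>X. f (disj_values n m k X) \<Longrightarrow> 1 \<le> F X"
    and \<delta>: "0 \<le> \<delta>" and D: "0 < deg_plus n f \<epsilon>"
  shows "\<epsilon> < \<delta> + 2 * B / R ^ deg_plus n f \<epsilon>"
proof (rule ccontr)
  assume "\<not> ?thesis"
  then have \<epsilon>: "\<delta> + 2 * B / R ^ deg_plus n f \<epsilon> \<le> \<epsilon>" by simp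
  define d where "d = deg_plus n f \<epsilon>"
  define F' where "F' X = complex_of_real (F X)" for X
  define Dif where "Dif g = L0 g - L1 g" for g
  define c where "c S = blocks (\<lambda>t. if t \<in> S then Dif else L1) n F'" for S
  define \<S> where "\<S> = {S \<in> Pow {..<n}. card S < d}"
  have lin: "lin L0" "lin L1" "lin Dif"
    using lin_subprob[OF L(1)] lin_subprob[OF L(2)] by (simp_all add: lin_def Dif_def algebra_simps)
  have fin: "finite \<S>" by (simp add: \<S>_def)
  \<comment> \<open>The polynomial has to be real: as z has entries 0 and 1, taking real parts of
    the coefficients takes the real part of the value and does not increase the error.\<close>
  have approx: "\<bar>mpoly_eval (multilinear \<S> (\<lambda>S. Re (c S))) (\<lambda>i. of_bool (z i)) -
      Re (blocks (\<lambda>t. if z t then L0 else L1) n F')\<bar> \<le> 2 * B / R ^ d" for z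
  proof -
    define \<zeta> where "\<zeta> S = (\<Prod>t\<in>S. of_bool (z t) :: complex)" for S
    define q where "q i = (\<Sum>S\<in>{S \<in> Pow {..<n}. card S = i}. \<zeta> S * c S)" for i
    have \<Phi>: "blocks (\<lambda>t g. L1 g + (of_bool (z t) * u) * Dif g) n F' = (\<Sum>i\<le>n. q i * u ^ i)" for u
    proof -
      have "blocks (\<lambda>t g. L1 g + (of_bool (z t) * u) * Dif g) n F' =
          (\<Sum>S\<in>Pow {..<n}. (\<Prod>t\<in>S. of_bool (z t) * u) * c S)"
        unfolding c_def by (rule blocks_expand) (auto intro: lin)
      also have "\<dots> = (\<Sum>S\<in>Pow {..<n}. \<zeta> S * c S * u ^ card S)"
        by (simp add: \<zeta>_def prod.distrib mult_ac)
      also have "\<dots> = (\<Sum>i\<le>n. \<Sum>S\<in>{S \<in> Pow {..<n}. card S = i}. \<zeta> S * c S * u ^ card S)"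
        by (rule sum.group[symmetric]) (auto intro: card_mono[of "{..<n}", simplified])
      also have "\<dots> = (\<Sum>i\<le>n. q i * u ^ i)"
        unfolding q_def sum_distrib_right by (intro sum.cong refl) auto
      finally show ?thesis .
    qed
    have "norm (\<Sum>i\<le>n. q i * u ^ i) \<le> B" if u: "norm u = R" for u
    proof -
      have "good (k - 1) (blocks (\<lambda>t g. L1 g + (of_bool (z t) * u) * Dif g) n)"
      proof (rule good_blocks)
        fix t
        \<comment> \<open>In the form required by \<open>good\<close> the parameter is s = 1 - z_t
          u, so R is one less than the radius of the disc.\<close>
        have "norm (1 - of_bool (z t) * u) \<le> R + 1"
          using norm_triangle_ineq4[of 1 "of_bool (z t) * u"] u R by (cases "z t") auto
        from good[OF this] show "good (k - 1) (\<lambda>g. L1 g + (of_bool (z t) * u) * Dif g)"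
          by (simp add: Dif_def algebra_simps)
      qed
      from F(1)[OF this] show ?thesis unfolding \<Phi>[symmetric] F'_def .
    qed
    from tail_bound[OF R this, of d]
    have t: "norm ((\<Sum>i\<le>n. q i) - (\<Sum>i\<in>{..n} \<inter> {..<d}. q i)) \<le> 2 * B / R ^ d" by simp
    have 1: "(\<Sum>i\<le>n. q i) = blocks (\<lambda>t. if z t then L0 else L1) n F'"
    proof -
      have "(\<Sum>i\<le>n. q i) = blocks (\<lambda>t g. L1 g + (of_bool (z t) * 1) * Dif g) n F'" unfolding \<Phi> by simp
      also have "(\<lambda>t g. L1 g + (of_bool (z t) * 1) * Dif g) = (\<lambda>t. if z t then L0 else L1)"
        by (auto simp: fun_eq_iff Dif_def)
      finally show ?thesis .
    qed
    have 2: "(\<Sum>i\<in>{..n} \<inter> {..<d}. q i) = (\<Sum>S\<in>\<S>. \<zeta> S * c S)"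
    proof -
      have "(\<Sum>i\<in>{..n} \<inter> {..<d}. q i) = (\<Sum>i\<in>{..n} \<inter> {..<d}. \<Sum>S\<in>{S \<in> \<S>. card S = i}. \<zeta> S * c S)"
        unfolding q_def by (intro sum.cong refl arg_cong2[where f = sum]) (auto simp: \<S>_def)
      also have "\<dots> = (\<Sum>S\<in>\<S>. \<zeta> S * c S)"
        using fin by (intro sum.group) (auto simp: \<S>_def intro: card_mono[of "{..<n}", simplified])
      finally show ?thesis .
    qed
    have "mpoly_eval (multilinear \<S> (\<lambda>S. Re (c S))) (\<lambda>i. of_bool (z i)) = (\<Sum>S\<in>\<S>. Re (c S) * (\<Prod>t\<in>S. of_bool (z t)))"
      using fin by (intro mpoly_eval_multilinear) (auto simp: \<S>_def intro: finite_subset)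
    also have "\<dots> = Re (\<Sum>S\<in>\<S>. \<zeta> S * c S)"
    proof -
      have "\<zeta> S = of_real (\<Prod>t\<in>S. of_bool (z t))" for S
        unfolding \<zeta>_def of_real_prod by (rule prod.cong) (auto simp: of_bool_def)
      then show ?thesis by (simp add: mult.commute del: of_real_prod)
    qed
    finally have "mpoly_eval (multilinear \<S> (\<lambda>S. Re (c S))) (\<lambda>i. of_bool (z i)) -
      Re (blocks (\<lambda>t. if z t then L0 else L1) n F') = Re ((\<Sum>i\<in>{..n} \<inter> {..<d}. q i) - (\<Sum>i\<le>n. q i))"
      unfolding 1 2 by simp
    also have "\<bar>\<dots>\<bar> \<le> norm ((\<Sum>i\<in>{..n} \<inter> {..<d}. q i) - (\<Sum>i\<le>n. q i))" by (rule abs_Re_le_cmod)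
    finally show ?thesis using t by (simp add: norm_minus_commute)
  qed
  have "onesided_approx n f \<epsilon> (multilinear \<S> (\<lambda>S. Re (c S)))"
    unfolding onesided_approx_def
  proof (intro ballI conjI impI)
    fix z assume z: "z \<in> cube n"
    define \<Lambda> where "\<Lambda> = blocks (\<lambda>t. if z t then L0 else L1) n"
    define Z where "Z t = (if z t then {X. \<forall>p. \<exists>i<k. p \<notin> X i} else {X. \<exists>p<b. \<forall>i<k. (p::nat) \<in> X i})" for t
    have sub: "subprob {X. \<forall>t<n. (\<lambda>r. X r t) \<in> Z t} \<Lambda>"
      unfolding \<Lambda>_def Z_def by (rule subprob_blocks) (use L in auto)
    have val: "disj_values n m k X = z" if "\<forall>t<n. (\<lambda>r. X r t) \<in> Z t" for X
    proof
      fix t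
      show "disj_values n m k X t = z t"
      proof (cases "t < n")
        case True
        then have "(\<lambda>r. X r t) \<in> Z t" using that by simp
        then show ?thesis using True b
          by (auto simp: disj_values_def DISJ_def Z_def split: if_splits) (meson less_le_trans)
      next
        case False
        then show ?thesis using z by (auto simp: disj_values_def cube_def PiE_def extensional_def)
      qed
    qed
    have mass: "\<Lambda> (\<lambda>_. of_real r) = of_real r" for r
    proof -
      have "\<Lambda> (\<lambda>_. 1) = 1" unfolding \<Lambda>_def by (rule blocks_mass) (use L in auto)
      then show ?thesis using linD(2)[OF lin_subprob[OF sub], of "of_real r" "\<lambda>_. 1"] by simp
    qed
    have Re_le: "Re (\<Lambda> g) \<le> Re (\<Lambda> h)" if "\<And>X. \<forall>t<n. (\<lambda>r. X r t) \<in> Z t \<Longrightarrow> Re (g X) \<le> Re (h X)" for g h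
    proof -
      have "0 \<le> Re (\<Lambda> (\<lambda>X. h X + (-1) * g X))" by (rule subprob_Re_nonneg[OF sub]) (use that in auto)
      also have "\<Lambda> (\<lambda>X. h X + (-1) * g X) = \<Lambda> h + (-1) * \<Lambda> g"
        unfolding linD(1)[OF lin_subprob[OF sub]] linD(2)[OF lin_subprob[OF sub]] ..
      finally show ?thesis by simp
    qed
    note ap = approx[of z, folded \<Lambda>_def]
    show "\<bar>mpoly_eval (multilinear \<S> (\<lambda>S. Re (c S))) (\<lambda>i. of_bool (z i)) - of_bool (f z)\<bar> \<le> \<epsilon>" if nf: "\<not> f z"
    proof -
      have "Re (\<Lambda> F') \<le> Re (\<Lambda> (\<lambda>_. of_real \<delta>))" "Re (\<Lambda> (\<lambda>_. of_real (- \<delta>))) \<le> Re (\<Lambda> F')"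
      proof -
        have "\<bar>F X\<bar> \<le> \<delta>" if "\<forall>t<n. (\<lambda>r. X r t) \<in> Z t" for X
          using F(2)[of X] nf val[OF that] by simp
        then show "Re (\<Lambda> F') \<le> Re (\<Lambda> (\<lambda>_. of_real \<delta>))" "Re (\<Lambda> (\<lambda>_. of_real (- \<delta>))) \<le> Re (\<Lambda> F')"
          by (intro Re_le; force simp: F'_def abs_le_iff)+
      qed
      then have "\<bar>Re (\<Lambda> F')\<bar> \<le> \<delta>" unfolding mass by (simp add: abs_le_iff)
      then show ?thesis using ap \<epsilon> nf unfolding d_def by (simp add: abs_le_iff)
    qed
    show "1 - \<epsilon> \<le> mpoly_eval (multilinear \<S> (\<lambda>S. Re (c S))) (\<lambda>i. of_bool (z i))" if fz: "f z"
    proof -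
      have "Re (\<Lambda> (\<lambda>_. of_real 1)) \<le> Re (\<Lambda> F')"
        by (rule Re_le) (use F(3) fz val in \<open>simp add: F'_def\<close>)
      then have "1 \<le> Re (\<Lambda> F')" unfolding mass by simp
      then show ?thesis using ap \<epsilon> \<delta> unfolding d_def abs_le_iff by linarith
    qed
  qed
  then have "deg_plus n f \<epsilon> < d"
    by (intro deg_plus_less[of \<S>]) (use D in \<open>auto simp: \<S>_def d_def\<close>)
  then show False by (simp add: d_def)
qed

section \<open>Protocols as combinations of cylinder functions\<close>

definition nof_cylinder :: "nat \<Rightarrow> (nat \<Rightarrow> 'a set) \<Rightarrow> ((nat \<Rightarrow> 'a) \<Rightarrow> complex) \<Rightarrow> bool" where
  "nof_cylinder k X G \<longleftrightarrow> (\<exists>\<phi>. (\<forall>i<k. \<forall>x. norm (\<phi> i x) \<le> 1) \<and>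
     (\<forall>i<k. \<forall>x\<in>PiE {..<k} X. \<forall>y\<in>PiE {..<k} X. (\<forall>j\<in>{..<k} - {i}. x j = y j) \<longrightarrow> \<phi> i x = \<phi> i y) \<and>
     G = (\<lambda>x. \<Prod>i<k. \<phi> i x))"

definition tester :: "nat \<Rightarrow> (nat \<Rightarrow> 'a set) \<Rightarrow> ((nat \<Rightarrow> 'a) \<Rightarrow> complex) \<Rightarrow> bool" where
  "tester k X \<omega> \<longleftrightarrow> (\<forall>G. nof_cylinder k X G \<longrightarrow> norm (\<Sum>x\<in>PiE {..<k} X. \<omega> x * G x) \<le> 1)"

text \<open>For finitely many inputs this is the norm whose unit ball is the closed absolutely
  convex hull of the cylinder functions, described through its dual. In this form expectations over
  infinitely many protocols are no harder than finite sums.\<close>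

definition cyl_bound :: "nat \<Rightarrow> (nat \<Rightarrow> 'a set) \<Rightarrow> real \<Rightarrow> ((nat \<Rightarrow> 'a) \<Rightarrow> complex) \<Rightarrow> bool" where
  "cyl_bound k X K F \<longleftrightarrow> (\<forall>\<omega>. tester k X \<omega> \<longrightarrow> norm (\<Sum>x\<in>PiE {..<k} X. \<omega> x * F x) \<le> K)"

lemma nof_cylinder_mult:
  assumes "nof_cylinder k X G" "nof_cylinder k X H"
  shows "nof_cylinder k X (\<lambda>x. G x * H x)"
proof -
  obtain \<phi> where p: "\<forall>i<k. \<forall>x. norm (\<phi> i x) \<le> 1"
     "\<forall>i<k. \<forall>x\<in>PiE {..<k} X. \<forall>y\<in>PiE {..<k} X. (\<forall>j\<in>{..<k} - {i}. x j = y j) \<longrightarrow> \<phi> i x = \<phi> i y"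
     "G = (\<lambda>x. \<Prod>i<k. \<phi> i x)" using assms(1) unfolding nof_cylinder_def by (elim exE conjE)
  obtain \<psi> where s: "\<forall>i<k. \<forall>x. norm (\<psi> i x) \<le> 1"
     "\<forall>i<k. \<forall>x\<in>PiE {..<k} X. \<forall>y\<in>PiE {..<k} X. (\<forall>j\<in>{..<k} - {i}. x j = y j) \<longrightarrow> \<psi> i x = \<psi> i y"
     "H = (\<lambda>x. \<Prod>i<k. \<psi> i x)" using assms(2) unfolding nof_cylinder_def by (elim exE conjE)
  show ?thesis unfolding nof_cylinder_def
  proof (intro exI[of _ "\<lambda>i x. \<phi> i x * \<psi> i x"] conjI allI impI ballI)
    fix i x assume "i < k"
    then show "norm (\<phi> i x * \<psi> i x) \<le> 1" using p(1) s(1) by (simp add: norm_mult mult_le_one)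
  next
    fix i x y assume *: "i < k" "x \<in> PiE {..<k} X" "y \<in> PiE {..<k} X" "\<forall>j\<in>{..<k} - {i}. x j = y j"
    have "\<phi> i x = \<phi> i y" "\<psi> i x = \<psi> i y"
      by (use p(2) * in blast, use s(2) * in blast)
    then show "\<phi> i x * \<psi> i x = \<phi> i y * \<psi> i y" by simp
  qed (simp add: p(3) s(3) prod.distrib)
qed

lemma nof_cylinder_one: "nof_cylinder k X (\<lambda>_. 1)"
  unfolding nof_cylinder_def by (intro exI[of _ "\<lambda>_ _. 1"]) simp

lemma nof_cylinder_single:
  assumes i: "i < k" and h: "\<And>x. norm (h x) \<le> 1"
    and dep: "\<forall>x\<in>PiE {..<k} X. \<forall>y\<in>PiE {..<k} X. (\<forall>j\<in>{..<k} - {i}. x j = y j) \<longrightarrow> h x = h y"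
  shows "nof_cylinder k X h"
  unfolding nof_cylinder_def
proof (intro exI[of _ "\<lambda>j x. if j = i then h x else 1"] conjI allI impI ballI)
  show "h = (\<lambda>x. \<Prod>j<k. if j = i then h x else 1)" using i by simp
  show "norm (if j = i then h x else 1) \<le> 1" for j x using h by simp
  show "(if j = i then h x else 1) = (if j = i then h y else 1)"
    if "x \<in> PiE {..<k} X" "y \<in> PiE {..<k} X" "\<forall>l\<in>{..<k} - {j}. x l = y l" for j x y
  proof (cases "j = i")
    case True
    have "h x = h y" using bspec[OF bspec[OF dep that(1)] that(2)] that(3) True by (simp only: simp_thms)
    then show ?thesis by (rule if_cong[OF refl _ refl])
  qed simp
qed

lemma tester_mult:
  assumes "tester k X \<omega>" "nof_cylinder k X G"
  shows "tester k X (\<lambda>x. \<omega> x * G x)"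
  using assms(1) nof_cylinder_mult[OF assms(2)] unfolding tester_def by (simp add: mult.assoc)

lemma cyl_bound_cylinder: "nof_cylinder k X G \<Longrightarrow> cyl_bound k X 1 G"
  by (simp add: cyl_bound_def tester_def)

lemma cyl_bound_mono: "cyl_bound k X K F \<Longrightarrow> K \<le> K' \<Longrightarrow> cyl_bound k X K' F"
  unfolding cyl_bound_def by (meson order_trans)

text \<open>Products of cylinder functions are cylinder functions, so the norm is submultiplicative:
  by the bound for \<open>F'\<close>, the function \<omega> F' / K' is again a tester, and the bound
  for \<open>F\<close> applies to it.\<close>

lemma cyl_bound_mult:
  assumes F: "cyl_bound k X K F" and F': "cyl_bound k X K' F'" and K': "0 < K'"
  shows "cyl_bound k X (K * K') (\<lambda>x. F x * F' x)"
  unfolding cyl_bound_def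
proof (intro allI impI)
  fix \<omega> assume \<omega>: "tester k X \<omega>"
  have "tester k X (\<lambda>x. \<omega> x * F' x / of_real K')"
    unfolding tester_def
  proof (intro allI impI)
    fix G assume G: "nof_cylinder k X G"
    have "norm (\<Sum>x\<in>PiE {..<k} X. (\<omega> x * G x) * F' x) \<le> K'"
      using F' tester_mult[OF \<omega> G] by (simp add: cyl_bound_def)
    moreover have "(\<Sum>x\<in>PiE {..<k} X. \<omega> x * F' x / of_real K' * G x) =
        (\<Sum>x\<in>PiE {..<k} X. (\<omega> x * G x) * F' x) / of_real K'"
      unfolding sum_divide_distrib by (intro sum.cong refl) simp
    ultimately show "norm (\<Sum>x\<in>PiE {..<k} X. \<omega> x * F' x / of_real K' * G x) \<le> 1"
      using K' by (simp add: norm_divide)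
  qed
  then have "norm (\<Sum>x\<in>PiE {..<k} X. \<omega> x * F' x / of_real K' * F x) \<le> K"
    by (rule F[unfolded cyl_bound_def, rule_format])
  moreover have "(\<Sum>x\<in>PiE {..<k} X. \<omega> x * F' x / of_real K' * F x) =
      (\<Sum>x\<in>PiE {..<k} X. \<omega> x * (F x * F' x)) / of_real K'"
    unfolding sum_divide_distrib by (intro sum.cong refl) simp
  ultimately show "norm (\<Sum>x\<in>PiE {..<k} X. \<omega> x * (F x * F' x)) \<le> K * K'"
    using K' by (simp add: norm_divide pos_divide_le_eq)
qed

lemma cyl_bound_sum:
  assumes "\<And>i. i \<in> I \<Longrightarrow> cyl_bound k X K (F i)"
  shows "cyl_bound k X (real (card I) * K) (\<lambda>x. \<Sum>i\<in>I. F i x)"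
  unfolding cyl_bound_def
proof (intro allI impI)
  fix \<omega> assume \<omega>: "tester k X \<omega>"
  have "norm (\<Sum>x\<in>PiE {..<k} X. \<omega> x * (\<Sum>i\<in>I. F i x)) = norm (\<Sum>i\<in>I. \<Sum>x\<in>PiE {..<k} X. \<omega> x * F i x)"
    unfolding sum_distrib_left by (subst sum.swap) simp
  also have "\<dots> \<le> (\<Sum>i\<in>I. K)"
    by (rule sum_norm_le) (use assms \<omega> in \<open>auto simp: cyl_bound_def\<close>)
  finally show "norm (\<Sum>x\<in>PiE {..<k} X. \<omega> x * (\<Sum>i\<in>I. F i x)) \<le> real (card I) * K" by simp
qed

lemma cyl_bound_scale:
  assumes "cyl_bound k X K F" "0 \<le> c"
  shows "cyl_bound k X (c * K) (\<lambda>x. of_real c * F x)"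
  unfolding cyl_bound_def
proof (intro allI impI)
  fix \<omega> assume \<omega>: "tester k X \<omega>"
  have "(\<Sum>x\<in>PiE {..<k} X. \<omega> x * (of_real c * F x)) = of_real c * (\<Sum>x\<in>PiE {..<k} X. \<omega> x * F x)"
    unfolding sum_distrib_left by (intro sum.cong refl) simp
  then show "norm (\<Sum>x\<in>PiE {..<k} X. \<omega> x * (of_real c * F x)) \<le> c * K"
    using assms \<omega> by (simp add: norm_mult cyl_bound_def mult_left_mono)
qed

lemma cyl_bound_power:
  assumes "cyl_bound k X K F" "0 < K"
  shows "cyl_bound k X (K ^ T) (\<lambda>x. F x ^ T)"
proof (induction T)
  case 0
  show ?case using cyl_bound_cylinder[OF nof_cylinder_one] by simp
next
  case (Suc T)
  then show ?case using cyl_bound_mult[OF assms(1) Suc] assms(2) by simp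
qed

text \<open>The induction has to remember the path: \<open>G\<close> is the product of the tests
  passed so far, and \<open>c\<close> bounds the bits still to be sent on inputs where
  \<open>G\<close> does not vanish. A node splits \<open>G\<close> into two cylinder functions, so
  every bit doubles the bound.\<close>

lemma cyl_bound_run_times:
  assumes "nof_protocol k X P" "nof_cylinder k X G"
    and "\<And>x. x \<in> PiE {..<k} X \<Longrightarrow> G x \<noteq> 0 \<Longrightarrow> bits_sent P x \<le> c"
  shows "cyl_bound k X (2 ^ c) (\<lambda>x. G x * of_bool (run P x))"
  using assms
proof (induction P arbitrary: G c)
  case (Output r)
  show ?case
  proof (cases r)
    case True
    have "cyl_bound k X (2 ^ c) G"
      by (rule cyl_bound_mono[OF cyl_bound_cylinder[OF Output(2)]]) simp
    then show ?thesis using True by simp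
  next
    case False
    then show ?thesis by (simp add: cyl_bound_def)
  qed
next
  case (Speak i b P0 P1)
  note speak = Speak.prems(1)[unfolded nof_protocol.simps]
  note i = conjunct1[OF speak] and dep = conjunct1[OF conjunct2[OF speak]]
    and P = conjunct1[OF conjunct2[OF conjunct2[OF speak]]] conjunct2[OF conjunct2[OF conjunct2[OF speak]]]
  have cyl: "nof_cylinder k X (\<lambda>x. of_bool (g (b x)))" for g :: "bool \<Rightarrow> bool"
  proof (rule nof_cylinder_single[OF i], simp, intro ballI impI)
    fix x y assume x: "x \<in> PiE {..<k} X" and y: "y \<in> PiE {..<k} X" and xy: "\<forall>j\<in>{..<k} - {i}. x j = y j"
    have "b x = b y" by (rule mp[OF bspec[OF bspec[OF dep x] y] xy])
    then show "(of_bool (g (b x)) :: complex) = of_bool (g (b y))" by simp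
  qed
  note c1 = cyl[of "\<lambda>e. e"] and c0 = cyl[of "\<lambda>e. \<not> e"]
  show ?case
  proof (cases c)
    case 0
    \<comment> \<open>A speaking node costs a bit; with none left, no input reaches it.\<close>
    have "G x = 0" if "x \<in> PiE {..<k} X" for x
    proof (rule ccontr)
      assume "G x \<noteq> 0"
      from Speak.prems(3)[OF that this] 0 show False by simp
    qed
    then have "(\<Sum>x\<in>PiE {..<k} X. \<omega> x * (G x * of_bool (run (Speak i b P0 P1) x))) = 0" for \<omega>
      by (intro sum.neutral ballI) (simp only: mult_zero_left mult_zero_right)
    then show ?thesis by (simp add: cyl_bound_def del: run.simps)
  next
    case (Suc c')
    have 1: "cyl_bound k X (2 ^ c') (\<lambda>x. G x * of_bool (b x) * of_bool (run P1 x))"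
    proof (rule Speak.IH(2)[OF P(2) nof_cylinder_mult[OF Speak.prems(2) c1]])
      fix x assume "x \<in> PiE {..<k} X" "G x * of_bool (b x) \<noteq> 0"
      then show "bits_sent P1 x \<le> c'" using Speak.prems(3)[of x] Suc by (auto split: if_splits)
    qed
    have 0: "cyl_bound k X (2 ^ c') (\<lambda>x. G x * of_bool (\<not> b x) * of_bool (run P0 x))"
    proof (rule Speak.IH(1)[OF P(1) nof_cylinder_mult[OF Speak.prems(2) c0]])
      fix x assume "x \<in> PiE {..<k} X" "G x * of_bool (\<not> b x) \<noteq> 0"
      then show "bits_sent P0 x \<le> c'" using Speak.prems(3)[of x] Suc by (auto split: if_splits)
    qed
    have "cyl_bound k X (real (card (UNIV :: bool set)) * 2 ^ c') (\<lambda>x. \<Sum>e\<in>UNIV.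
        if e then G x * of_bool (b x) * of_bool (run P1 x) else G x * of_bool (\<not> b x) * of_bool (run P0 x))"
    proof (rule cyl_bound_sum)
      fix e :: bool
      show "cyl_bound k X (2 ^ c') (\<lambda>x. if e then G x * of_bool (b x) * of_bool (run P1 x)
          else G x * of_bool (\<not> b x) * of_bool (run P0 x))"
        using 0 1 by (cases e) simp_all
    qed
    moreover have "(\<lambda>x. \<Sum>e\<in>UNIV. if e then G x * of_bool (b x) * of_bool (run P1 x) else G x * of_bool (\<not> b x) * of_bool (run P0 x)) =
        (\<lambda>x. G x * of_bool (run (Speak i b P0 P1) x))"
      by (auto simp: fun_eq_iff UNIV_bool)
    ultimately show ?thesis using Suc by simp
  qed
qed

lemma cyl_bound_run:
  assumes "nof_protocol k X P" "\<And>x. x \<in> PiE {..<k} X \<Longrightarrow> bits_sent P x \<le> c"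
  shows "cyl_bound k X (2 ^ c) (\<lambda>x. of_bool (run P x))"
  using cyl_bound_run_times[OF assms(1) nof_cylinder_one] assms(2) by simp

lemma cyl_bound_expectation:
  assumes P: "\<And>P. P \<in> set_pmf D \<Longrightarrow> cyl_bound k X K (\<lambda>x. of_bool (run P x))"
  shows "cyl_bound k X K (\<lambda>x. of_real (measure_pmf.prob D {P. run P x}))"
  unfolding cyl_bound_def
proof (intro allI impI)
  fix \<omega> assume \<omega>: "tester k X \<omega>"
  define h where "h P = (\<Sum>x\<in>PiE {..<k} X. \<omega> x * of_bool (run P x))" for P
  have prob: "of_real (measure_pmf.prob D {P. run P x}) = (LINT P|measure_pmf D. of_bool (run P x) :: complex)" for x
  proof -
    have "(LINT P|measure_pmf D. of_bool (run P x) :: complex) = (LINT P|measure_pmf D. of_real (indicator {P. run P x} P))"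
      by (intro Bochner_Integration.integral_cong) (auto simp: indicator_def)
    also have "\<dots> = of_real (LINT P|measure_pmf D. indicator {P. run P x} P)" by (rule integral_complex_of_real)
    finally show ?thesis by simp
  qed
  have iw: "integrable (measure_pmf D) (\<lambda>P. \<omega> x * of_bool (run P x))" for x
    by (rule measure_pmf.integrable_const_bound[where B = "norm (\<omega> x)"]) (auto simp: norm_mult)
  have hK: "norm (h P) \<le> K" if "P \<in> set_pmf D" for P
    unfolding h_def by (rule P[OF that, unfolded cyl_bound_def, rule_format, OF \<omega>])
  have ih: "integrable (measure_pmf D) h"
    by (rule measure_pmf.integrable_const_bound[where B = K]) (simp_all add: AE_measure_pmf_iff hK)
  have "(\<Sum>x\<in>PiE {..<k} X. \<omega> x * of_real (measure_pmf.prob D {P. run P x})) =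
      (\<Sum>x\<in>PiE {..<k} X. LINT P|measure_pmf D. \<omega> x * of_bool (run P x))"
    unfolding prob integral_mult_right_zero ..
  also have "\<dots> = (LINT P|measure_pmf D. h P)"
    unfolding h_def by (rule Bochner_Integration.integral_sum[symmetric]) (rule iw)
  also have "norm \<dots> \<le> (LINT P|measure_pmf D. norm (h P))" by (rule integral_norm_bound)
  also have "\<dots> \<le> K"
  proof (rule measure_pmf.integral_le_const)
    show "AE P in measure_pmf D. norm (h P) \<le> K" by (simp add: AE_measure_pmf_iff hK)
    show "integrable (measure_pmf D) (\<lambda>P. norm (h P))" by (rule integrable_norm[OF ih])
  qed
  finally show "norm (\<Sum>x\<in>PiE {..<k} X. \<omega> x * of_real (measure_pmf.prob D {P. run P x})) \<le> K" .
qed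

section \<open>From good functionals to inputs of the communication problem\<close>

definition nof_input :: "nat \<Rightarrow> nat \<Rightarrow> nat \<Rightarrow> (nat \<Rightarrow> nat \<Rightarrow> nat set) \<Rightarrow> nat \<Rightarrow> nat \<Rightarrow> nat \<Rightarrow> bool" where
  "nof_input n m k X = (\<lambda>i\<in>{..<k}. \<lambda>t\<in>{..<n}. \<lambda>p\<in>{..<m}. p \<in> X i t)"

lemma nof_input_mem: "nof_input n m k X \<in> PiE {..<k} (disj_args n m)"
  by (auto simp: nof_input_def disj_args_def cube_def)

lemma finite_inputs: "finite (PiE {..<k} (disj_args n m))"
  by (intro finite_PiE) (auto simp: disj_args_def cube_def intro!: finite_PiE)

lemma comp_DISJ_nof_input: "comp_DISJ n f m k (nof_input n m k X) = f (disj_values n m k X)"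
proof -
  have "DISJ m k (\<lambda>i. nof_input n m k X i t) = DISJ m k (\<lambda>i p. p \<in> X i t)" if "t < n" for t
    using that by (auto simp: DISJ_def nof_input_def)
  then have "(\<lambda>t\<in>{..<n}. DISJ m k (\<lambda>i. nof_input n m k X i t)) = disj_values n m k X"
    unfolding disj_values_def by (intro restrict_ext) simp
  then show ?thesis by (simp add: comp_DISJ_def)
qed

text \<open>The image \<omega> of \<open>L\<close> on inputs is a tester by
  \<open>good_cylinder\<close>. The k players are the rows 0..k - 1, whence goodness at k -
  1.\<close>

lemma good_cyl_bound:
  assumes L: "good (k - 1) L" and k: "0 < k" and F: "cyl_bound k (disj_args n m) K F"
  shows "norm (L (\<lambda>X. F (nof_input n m k X))) \<le> K"
proof -
  let ?\<Omega> = "PiE {..<k} (disj_args n m)"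
  define \<omega> where "\<omega> x = L (\<lambda>X. of_bool (nof_input n m k X = x))" for x
  note lin = lin_good[OF L]
  have sum: "(\<Sum>x\<in>?\<Omega>. \<omega> x * g x) = L (\<lambda>X. g (nof_input n m k X))" for g
  proof -
    have "(\<Sum>x\<in>?\<Omega>. \<omega> x * g x) = L (\<lambda>X. \<Sum>x\<in>?\<Omega>. of_bool (nof_input n m k X = x) * g x)"
      unfolding \<omega>_def lin_multr[OF lin, symmetric] by (rule lin_sum[OF lin, symmetric])
    also have "(\<lambda>X. \<Sum>x\<in>?\<Omega>. of_bool (nof_input n m k X = x) * g x) = (\<lambda>X. g (nof_input n m k X))"
    proof
      fix X
      have "(\<Sum>x\<in>?\<Omega>. of_bool (nof_input n m k X = x) * g x) =
          (\<Sum>x\<in>?\<Omega>. if nof_input n m k X = x then g x else 0)"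
        by (intro sum.cong refl) simp
      then show "(\<Sum>x\<in>?\<Omega>. of_bool (nof_input n m k X = x) * g x) = g (nof_input n m k X)"
        using nof_input_mem finite_inputs by (simp add: sum.delta)
    qed
    finally show ?thesis .
  qed
  have "tester k (disj_args n m) \<omega>"
    unfolding tester_def
  proof (intro allI impI)
    fix G assume "nof_cylinder k (disj_args n m) G"
    then obtain \<phi> where p: "\<forall>i<k. \<forall>x. norm (\<phi> i x) \<le> 1"
     "\<forall>i<k. \<forall>x\<in>?\<Omega>. \<forall>y\<in>?\<Omega>. (\<forall>j\<in>{..<k} - {i}. x j = y j) \<longrightarrow> \<phi> i x = \<phi> i y"
     "G = (\<lambda>x. \<Prod>i<k. \<phi> i x)" unfolding nof_cylinder_def by (elim exE conjE)
    have "cylinder (k - 1) (\<lambda>X. G (nof_input n m k X))"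
      unfolding cylinder_def
    proof (intro exI[of _ "\<lambda>i X. \<phi> i (nof_input n m k X)"] conjI allI impI)
      fix i and X :: "nat \<Rightarrow> nat \<Rightarrow> nat set" assume "i \<le> k - 1"
      then show "norm (\<phi> i (nof_input n m k X)) \<le> 1" using p(1) k by auto
    next
      fix i and X Y :: "nat \<Rightarrow> nat \<Rightarrow> nat set" assume i: "i \<le> k - 1" and XY: "\<forall>j\<le>k - 1. j \<noteq> i \<longrightarrow> X j = Y j"
      have ik: "i < k" using i k by simp
      have agree: "\<forall>j\<in>{..<k} - {i}. nof_input n m k X j = nof_input n m k Y j"
      proof
        fix j assume "j \<in> {..<k} - {i}"
        then have "X j = Y j" using XY by auto
        then show "nof_input n m k X j = nof_input n m k Y j" by (simp add: nof_input_def)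
      qed
      show "\<phi> i (nof_input n m k X) = \<phi> i (nof_input n m k Y)"
        by (rule p(2)[rule_format, OF ik nof_input_mem nof_input_mem]) (use agree in blast)
    next
      have "{..<k} = {..k - 1}" using k by auto
      then show "(\<lambda>X. G (nof_input n m k X)) = (\<lambda>X. \<Prod>i\<le>k - 1. \<phi> i (nof_input n m k X))"
        unfolding p(3) by simp
    qed
    from good_cylinder[OF L this] show "norm (\<Sum>x\<in>?\<Omega>. \<omega> x * G x) \<le> 1" unfolding sum .
  qed
  then have "norm (\<Sum>x\<in>?\<Omega>. \<omega> x * F x) \<le> K" by (rule F[unfolded cyl_bound_def, rule_format])
  then show ?thesis unfolding sum .
qed

lemma cyl_bound_nonneg: "cyl_bound k X K F \<Longrightarrow> 0 \<le> K"
proof -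
  assume F: "cyl_bound k X K F"
  have "tester k X (\<lambda>_. 0)" by (simp add: tester_def)
  from F[unfolded cyl_bound_def, rule_format, OF this] show "0 \<le> K" by simp
qed

text \<open>Each copy of disjointness holds N blocks with N about 80 x^2. They fit into m columns
  because 200^2 = 80 * 500, and R = N/4 - 1 is still at least 4 x.\<close>

lemma nof_degree_bound:
  fixes F :: "(nat \<Rightarrow> nat \<Rightarrow> nat \<Rightarrow> bool) \<Rightarrow> real"
  assumes k: "0 < k" and x: "x = sqrt (real m) / (200 * real k * 2 ^ k)" "1 < x"
    and F: "cyl_bound k (disj_args n m) B (\<lambda>y. of_real (F y))"
      "\<And>y. y \<in> PiE {..<k} (disj_args n m) \<Longrightarrow> \<not> comp_DISJ n f m k y \<Longrightarrow> \<bar>F y\<bar> \<le> \<delta>"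
      "\<And>y. y \<in> PiE {..<k} (disj_args n m) \<Longrightarrow> comp_DISJ n f m k y \<Longrightarrow> 1 \<le> F y"
    and \<delta>: "0 \<le> \<delta>" and D: "0 < deg_plus n f \<epsilon>"
  shows "\<epsilon> < \<delta> + 2 * B / (4 * x) ^ deg_plus n f \<epsilon>"
proof -
  define s where "s = 500 * (real k)\<^sup>2 * 4 ^ k"
  define N where "N = nat \<lfloor>80 * x\<^sup>2\<rfloor>"
  define R where "R = real N / 4 - 1"
  have s: "0 < s" using k by (simp add: s_def)
  have m: "real m = 80 * x\<^sup>2 * s"
  proof -
    have "x * (200 * real k * 2 ^ k) = sqrt (real m)" using x(1) k by simp
    then have "(x * (200 * real k * 2 ^ k))\<^sup>2 = real m" by simp
    moreover have "((2::real) ^ k)\<^sup>2 = 4 ^ k" by (simp add: power2_eq_square flip: power_mult_distrib)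
    ultimately show ?thesis by (simp add: s_def power_mult_distrib)
  qed
  have x2: "x \<le> x\<^sup>2" "1 \<le> x\<^sup>2" using x(2) self_le_power[of x 2] one_le_power[of x 2] by simp_all
  have N: "80 * x\<^sup>2 - 1 \<le> real N" "real N \<le> 80 * x\<^sup>2" unfolding N_def using x2 by linarith+
  have N0: "0 < N" using N(1) x2 by (intro gr0I) auto
  have R: "4 * x \<le> R" "2 \<le> R" unfolding R_def using N(1) x2 x(2) by linarith+
  obtain a :: nat and L0 L1 :: "((nat \<Rightarrow> nat set) \<Rightarrow> complex) \<Rightarrow> complex" where
    a: "real a \<le> 500 * (real k)\<^sup>2 * 4 ^ k" and
    L: "subprob {X. \<forall>p. \<exists>i<k. p \<notin> X i} L0" "subprob {X. \<exists>p<N * a. \<forall>i<k. p \<in> X i} L1"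
    "L0 (\<lambda>_. 1) = 1" "L1 (\<lambda>_. 1) = 1"
    "\<And>s. norm s \<le> real N / 4 \<Longrightarrow> good (k - 1) (\<lambda>f. (1 - s) * L0 f + s * L1 f)"
    using ex_block_laws[OF k N0] by blast
  have "real (N * a) \<le> real m"
    unfolding m of_nat_mult using N(2) a s by (intro mult_mono) (auto simp: s_def)
  then have Na: "N * a \<le> m" by (simp only: of_nat_le_iff)
  have "\<epsilon> < \<delta> + 2 * B / R ^ deg_plus n f \<epsilon>"
  proof (rule deg_plus_bound[where F = "\<lambda>X. F (nof_input n m k X)", OF L(1-4) _ R(2) Na _ _ _ \<delta> D])
    show "good (k - 1) (\<lambda>f. (1 - s) * L0 f + s * L1 f)" if "norm s \<le> R + 1" for s
      using that by (intro L(5)) (simp add: R_def)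
    show "norm (L (\<lambda>X. of_real (F (nof_input n m k X)))) \<le> B" if "good (k - 1) L" for L
      by (rule good_cyl_bound[OF that k F(1)])
    show "\<bar>F (nof_input n m k X)\<bar> \<le> \<delta>" if "\<not> f (disj_values n m k X)" for X
      by (rule F(2)[OF nof_input_mem]) (use that in \<open>simp add: comp_DISJ_nof_input\<close>)
    show "1 \<le> F (nof_input n m k X)" if "f (disj_values n m k X)" for X
      by (rule F(3)[OF nof_input_mem]) (use that in \<open>simp add: comp_DISJ_nof_input\<close>)
  qed
  moreover have "2 * B / R ^ deg_plus n f \<epsilon> \<le> 2 * B / (4 * x) ^ deg_plus n f \<epsilon>"
    using cyl_bound_nonneg[OF F(1)] R(1) x(2) by (intro divide_left_mono power_mono mult_pos_pos) auto
  ultimately show ?thesis by linarith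
qed

section \<open>The nondeterministic and Merlin--Arthur bounds\<close>

lemma guesses: "finite (guesses l)" "card (guesses l) = 2 ^ l"
  using card_lists_length_eq[of "UNIV :: bool set" l] finite_lists_length_eq[of "UNIV :: bool set" l]
  by (simp_all add: guesses_def)

lemma log_degree_bound:
  assumes "1 < x" "0 < r" "(4 * x) ^ D < r * 2 ^ e"
  shows "real D * (2 + log 2 x) < log 2 r + real e"
proof -
  have "log 2 ((4 * x) ^ D) < log 2 (r * 2 ^ e)"
    using assms by (subst log_less_cancel_iff) auto
  moreover have "log 2 (4 * x) = 2 + log 2 x"
  proof -
    have "log 2 (4 * x) = log 2 4 + log 2 x" using assms by (simp add: log_mult)
    moreover have "log 2 (2 powr 2) = (2 :: real)" by (rule log_powr_cancel) auto
    ultimately show ?thesis by simp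
  qed
  moreover have "log 2 ((4 * x) ^ D) = real D * log 2 (4 * x)" by (rule log_nat_power) (use assms in auto)
  moreover have "log 2 (r * 2 ^ e) = log 2 r + real e" using assms by (simp add: log_mult log_nat_power)
  ultimately show ?thesis by (simp only:)
qed

text \<open>The number of accepting guesses is 0 on the zeros of the problem and at least 1 on its
  ones, which suits the one-sided degree. As a sum of 2^l protocols it has norm at most 2^(l +
  c).\<close>

lemma nondet_lower_bound:
  assumes m: "0 < m" and k: "0 < k" and \<epsilon>: "0 < \<epsilon>" "\<epsilon> \<le> 1/2"
    and P: "nondet_computes k (disj_args n m) (comp_DISJ n f m k) l P"
    and c: "\<And>g x. g \<in> guesses l \<Longrightarrow> x \<in> PiE {..<k} (disj_args n m) \<Longrightarrow> bits_sent (P g) x \<le> c"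
  shows "real (deg_plus n f \<epsilon>) / 2 * log 2 (sqrt (real m) / (200 * real k * 2 ^ k)) - log 2 (1 / \<epsilon>) \<le> real (l + c)"
proof -
  define x where "x = sqrt (real m) / (200 * real k * 2 ^ k)"
  define D where "D = deg_plus n f \<epsilon>"
  have le: "0 \<le> log 2 (1 / \<epsilon>)" using \<epsilon> by simp
  show ?thesis
  \<comment> \<open>Outside this case the lower bound is not positive.\<close>
  proof (cases "1 < x \<and> 0 < D")
    case False
    have "real D * log 2 x \<le> 0"
    proof (cases "D = 0")
      case False
      then have "x \<le> 1" using \<open>\<not> (1 < x \<and> 0 < D)\<close> by simp
      moreover have "0 < x" using m k by (simp add: x_def)
      ultimately have "log 2 x \<le> 0" by (subst log_le_zero_cancel_iff) auto
      then show ?thesis by (simp add: mult_nonneg_nonpos)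
    qed simp
    then have "real D / 2 * log 2 x \<le> 0" by simp
    moreover have "0 \<le> real (l + c)" by simp
    ultimately show ?thesis using le unfolding x_def[symmetric] D_def[symmetric] by linarith
  next
    case True
    define F where "F y = (\<Sum>g\<in>guesses l. of_bool (run (P g) y) :: real)" for y
    have P0: "run (P g) y = False" if "g \<in> guesses l" "y \<in> PiE {..<k} (disj_args n m)" "\<not> comp_DISJ n f m k y" for g y
      using P that unfolding nondet_computes_def by blast
    have P1: "\<exists>g\<in>guesses l. run (P g) y" if "y \<in> PiE {..<k} (disj_args n m)" "comp_DISJ n f m k y" for y
      using P that unfolding nondet_computes_def by blast
    have ob: "complex_of_real (of_bool r) = of_bool r" for r by (cases r) simp_all
    have "\<epsilon> < 0 + 2 * (real (card (guesses l)) * 2 ^ c) / (4 * x) ^ deg_plus n f \<epsilon>"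
    proof (rule nof_degree_bound[OF k x_def, where F = F])
      have "cyl_bound k (disj_args n m) (real (card (guesses l)) * 2 ^ c) (\<lambda>y. \<Sum>g\<in>guesses l. of_bool (run (P g) y))"
        by (intro cyl_bound_sum cyl_bound_run) (use P c in \<open>auto simp: nondet_computes_def\<close>)
      then show "cyl_bound k (disj_args n m) (real (card (guesses l)) * 2 ^ c) (\<lambda>y. of_real (F y))"
        unfolding F_def of_real_sum ob .
      show "\<bar>F y\<bar> \<le> 0" if "y \<in> PiE {..<k} (disj_args n m)" "\<not> comp_DISJ n f m k y" for y
        using P0 that by (simp add: F_def)
      show "1 \<le> F y" if y: "y \<in> PiE {..<k} (disj_args n m)" "comp_DISJ n f m k y" for y
      proof -
        obtain g where g: "g \<in> guesses l" "run (P g) y" using P1[OF y] by blast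
        have "of_bool (run (P g) y) \<le> F y" unfolding F_def using g(1) guesses(1) by (intro member_le_sum) auto
        then show ?thesis using g(2) by simp
      qed
    qed (use True in \<open>auto simp: D_def\<close>)
    then have "\<epsilon> < 2 ^ (l + c + 1) / (4 * x) ^ D" by (simp add: guesses(2) D_def power_add mult_ac)
    then have "(4 * x) ^ D < (1 / \<epsilon>) * 2 ^ (l + c + 1)"
      using True \<epsilon> by (simp add: field_simps)
    from log_degree_bound[OF _ _ this] have b: "real D * (2 + log 2 x) < log 2 (1 / \<epsilon>) + real (l + c + 1)"
      using True \<epsilon> by simp
    have "0 \<le> log 2 x" using True by simp
    then have "real D / 2 * log 2 x \<le> real D * log 2 x" by (intro mult_right_mono) auto
    \<comment> \<open>The factor 4 in 4 x contributes 2 D, which pays for the additive 1.\<close>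
    moreover have "1 \<le> real D" using True by simp
    moreover have "real D * 2 + real D * log 2 x < log 2 (1 / \<epsilon>) + (real (l + c) + 1)"
      using b by (simp add: distrib_left)
    ultimately show ?thesis unfolding x_def[symmetric] D_def[symmetric] by linarith
  qed
qed

text \<open>Scaled by 3/2, acceptance probabilities are at most 1/2 for all guesses on the zeros and
  at least 1 for some guess on the ones. The power T makes the sum over 2^l guesses small on the
  zeros and keeps it at least 1 on the ones. The exponent of the norm is multiplied by T, which
  itself grows with l; hence the square of the cost.\<close>

lemma ma_lower_bound:
  assumes m: "0 < m" and k: "0 < k" and \<epsilon>: "0 < \<epsilon>" "\<epsilon> \<le> 1/2"
    and P: "ma_computes (1/3) k (disj_args n m) (comp_DISJ n f m k) l R"
    and c: "\<And>g P x. g \<in> guesses l \<Longrightarrow> P \<in> set_pmf (R g) \<Longrightarrow> x \<in> PiE {..<k} (disj_args n m) \<Longrightarrow> bits_sent P x \<le> c"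
  shows "real (deg_plus n f \<epsilon>) / 200 * log 2 (sqrt (real m) / (200 * real k * 2 ^ k)) - (log 2 (2 / \<epsilon>))\<^sup>2 \<le> (real (l + c))\<^sup>2"
proof -
  define x where "x = sqrt (real m) / (200 * real k * 2 ^ k)"
  define D where "D = deg_plus n f \<epsilon>"
  define \<Lambda> where "\<Lambda> = log 2 (2 / \<epsilon>)"
  have "2 = log 2 (2 powr 2)" by (rule log_powr_cancel[symmetric]) auto
  also have "\<dots> \<le> log 2 (2 / \<epsilon>)" using \<epsilon> by (subst log_le_cancel_iff) (auto simp: field_simps)
  finally have \<Lambda>: "2 \<le> \<Lambda>" by (simp only: \<Lambda>_def)
  show ?thesis
  proof (cases "1 < x \<and> 0 < D")
    case False
    have "real D * log 2 x \<le> 0"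
    proof (cases "D = 0")
      case False
      then have "x \<le> 1" using \<open>\<not> (1 < x \<and> 0 < D)\<close> by simp
      moreover have "0 < x" using m k by (simp add: x_def)
      ultimately have "log 2 x \<le> 0" by (subst log_le_zero_cancel_iff) auto
      then show ?thesis by (simp add: mult_nonneg_nonpos)
    qed simp
    then have "real D / 200 * log 2 x \<le> 0" by simp
    moreover have "0 \<le> (real (l + c))\<^sup>2" "0 \<le> \<Lambda>\<^sup>2" by simp_all
    ultimately show ?thesis unfolding x_def[symmetric] D_def[symmetric] \<Lambda>_def[symmetric] by linarith
  next
    case True
    \<comment> \<open>T exceeds l by at least log (2/\<epsilon>), so 2^l (1/2)^T is at most
      \<epsilon>/2 and the other half of \<epsilon> is left for the truncation.\<close>
    define T where "T = l + nat \<lceil>\<Lambda>\<rceil>"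
    define \<Phi> where "\<Phi> g y = measure_pmf.prob (R g) {P. run P y}" for g y
    define F where "F y = (\<Sum>g\<in>guesses l. (3/2 * \<Phi> g y) ^ T)" for y
    define \<delta> :: real where "\<delta> = 2 ^ l * (1/2) ^ T"
    have \<Phi>0: "\<Phi> g y \<le> 1/3" if g: "g \<in> guesses l" and y: "y \<in> PiE {..<k} (disj_args n m)" "\<not> comp_DISJ n f m k y" for g y
    proof -
      have "1 - 1/3 \<le> measure_pmf.prob (R g) {P. run P y = comp_DISJ n f m k y}"
        using P g y unfolding ma_computes_def by blast
      also have "{P. run P y = comp_DISJ n f m k y} = space (measure_pmf (R g)) - {P. run P y}" using y(2) by auto
      also have "measure_pmf.prob (R g) \<dots> = 1 - \<Phi> g y"
        unfolding \<Phi>_def by (rule measure_pmf.prob_compl) simp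
      finally show ?thesis by simp
    qed
    have \<Phi>1: "\<exists>g\<in>guesses l. 2/3 \<le> \<Phi> g y" if y: "y \<in> PiE {..<k} (disj_args n m)" "comp_DISJ n f m k y" for y
    proof -
      obtain g where g: "g \<in> guesses l" "1 - 1/3 \<le> measure_pmf.prob (R g) {P. run P y = comp_DISJ n f m k y}"
        using P y unfolding ma_computes_def by blast
      have "{P. run P y = comp_DISJ n f m k y} = {P. run P y}" using y(2) by auto
      then show ?thesis using g unfolding \<Phi>_def by (intro bexI[of _ g]) simp_all
    qed
    have \<Phi>n: "0 \<le> \<Phi> g y" for g y by (simp add: \<Phi>_def)
    have "\<epsilon> < \<delta> + 2 * (real (card (guesses l)) * (2 ^ (c + 1)) ^ T) / (4 * x) ^ deg_plus n f \<epsilon>"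
    proof (rule nof_degree_bound[OF k x_def, where F = F])
      have "cyl_bound k (disj_args n m) (2 ^ (c + 1)) (\<lambda>y. of_real (3/2) * of_real (\<Phi> g y))" if "g \<in> guesses l" for g
      proof -
        have "cyl_bound k (disj_args n m) (2 ^ c) (\<lambda>y. of_real (\<Phi> g y))"
          unfolding \<Phi>_def
          by (intro cyl_bound_expectation cyl_bound_run) (use P c that in \<open>auto simp: ma_computes_def\<close>)
        from cyl_bound_scale[OF this, of "3/2"] show ?thesis by (rule cyl_bound_mono) simp_all
      qed
      then have "cyl_bound k (disj_args n m) (real (card (guesses l)) * (2 ^ (c + 1)) ^ T)
          (\<lambda>y. \<Sum>g\<in>guesses l. (of_real (3/2) * of_real (\<Phi> g y)) ^ T)"
        by (intro cyl_bound_sum cyl_bound_power) auto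
      then show "cyl_bound k (disj_args n m) (real (card (guesses l)) * (2 ^ (c + 1)) ^ T) (\<lambda>y. of_real (F y))"
        by (simp add: F_def)
      show "\<bar>F y\<bar> \<le> \<delta>" if y: "y \<in> PiE {..<k} (disj_args n m)" "\<not> comp_DISJ n f m k y" for y
      proof -
        have "(3/2 * \<Phi> g y) ^ T \<le> (1/2) ^ T" if "g \<in> guesses l" for g
          using \<Phi>0[OF that y] \<Phi>n[of g y] by (intro power_mono) auto
        then have "F y \<le> (\<Sum>g\<in>guesses l. (1/2) ^ T)" unfolding F_def by (rule sum_mono)
        moreover have "0 \<le> F y" unfolding F_def using \<Phi>n by (intro sum_nonneg) simp
        ultimately show ?thesis by (simp add: guesses(2) \<delta>_def)
      qed
      show "1 \<le> F y" if y: "y \<in> PiE {..<k} (disj_args n m)" "comp_DISJ n f m k y" for y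
      proof -
        obtain g where g: "g \<in> guesses l" "2/3 \<le> \<Phi> g y" using \<Phi>1[OF y] by blast
        have "1 \<le> (3/2 * \<Phi> g y) ^ T" using g(2) by (intro one_le_power) simp
        also have "\<dots> \<le> F y" unfolding F_def using g(1) guesses(1) \<Phi>n by (intro member_le_sum) auto
        finally show ?thesis .
      qed
    qed (use True in \<open>auto simp: D_def \<delta>_def\<close>)
    moreover have "2 * (2 ^ l * (2 ^ (c + 1)) ^ T) = (2 :: real) ^ (1 + l + (c + 1) * T)"
      unfolding power_mult[symmetric] by (simp only: power_add power_one_right mult.assoc)
    ultimately have 1: "\<epsilon> < \<delta> + 2 ^ (1 + l + (c + 1) * T) / (4 * x) ^ D"
      unfolding D_def by (simp only: guesses(2) of_nat_power of_nat_numeral)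
    have "\<delta> \<le> \<epsilon> / 2"
    proof -
      have "2 / \<epsilon> = 2 powr \<Lambda>" using \<epsilon> by (simp add: \<Lambda>_def)
      also have "\<dots> \<le> 2 powr real (nat \<lceil>\<Lambda>\<rceil>)" by (intro powr_mono) linarith+
      also have "\<dots> = 2 ^ nat \<lceil>\<Lambda>\<rceil>" by (simp add: powr_realpow)
      finally have "1 / 2 ^ nat \<lceil>\<Lambda>\<rceil> \<le> \<epsilon> / 2" using \<epsilon> by (simp add: field_simps)
      moreover have "\<delta> = 1 / 2 ^ nat \<lceil>\<Lambda>\<rceil>" by (simp add: \<delta>_def T_def power_add power_one_over)
      ultimately show ?thesis by simp
    qed
    with 1 have "\<epsilon> / 2 < 2 ^ (1 + l + (c + 1) * T) / (4 * x) ^ D" by linarith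
    then have "(4 * x) ^ D < (2 / \<epsilon>) * 2 ^ (1 + l + (c + 1) * T)"
      using True \<epsilon> by (simp add: field_simps)
    from log_degree_bound[OF _ _ this] have b: "real D * (2 + log 2 x) < \<Lambda> + real (1 + l + (c + 1) * T)"
      using True \<epsilon> by (simp add: \<Lambda>_def)
    define M where "M = real (l + c)"
    have M: "0 \<le> M" "real l \<le> M" "real c \<le> M" by (simp_all add: M_def)
    have T: "real T \<le> M + \<Lambda> + 1" unfolding T_def M_def using \<Lambda> by simp linarith
    have "(real c + 1) * real T \<le> (M + 1) * (M + \<Lambda> + 1)" using M T by (intro mult_mono) auto
    have "\<Lambda> + real (1 + l + (c + 1) * T) \<le> \<Lambda> + 1 + M + (M + 1) * (M + \<Lambda> + 1)"
    proof -
      have "real (1 + l + (c + 1) * T) = 1 + real l + (real c + 1) * real T" by (simp add: algebra_simps)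
      then show ?thesis using \<open>(real c + 1) * real T \<le> (M + 1) * (M + \<Lambda> + 1)\<close> M by linarith
    qed
    also have "\<dots> = M\<^sup>2 + M * \<Lambda> + 3 * M + 2 * \<Lambda> + 2" by (simp add: power2_eq_square algebra_simps)
    \<comment> \<open>As \<epsilon> is at most 1/2, \<Lambda> is at least 2, so \<Lambda>^2 absorbs
      the constants and its own linear term; the mixed term is split by 2 M \<Lambda> at most M^2 +
      \<Lambda>^2.\<close>
    also have "\<dots> \<le> 4 * (M\<^sup>2 + \<Lambda>\<^sup>2)"
    proof -
      have "2 * (M * \<Lambda>) \<le> M\<^sup>2 + \<Lambda>\<^sup>2" using zero_le_power2[of "M - \<Lambda>"] by (simp add: power2_eq_square algebra_simps)
      moreover have "2 * M \<le> 1 + M\<^sup>2" using zero_le_power2[of "M - 1"] by (simp add: power2_eq_square algebra_simps)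
      moreover have "2 * \<Lambda> \<le> \<Lambda>\<^sup>2" "4 \<le> \<Lambda>\<^sup>2" using \<Lambda> mult_mono[of 2 \<Lambda> 2 \<Lambda>] by (simp_all add: power2_eq_square)
      moreover have "0 \<le> M\<^sup>2" by simp
      moreover have "a + p + 3 * u + 2 * v + 2 \<le> 4 * (a + b)"
        if "2 * p \<le> a + b" "2 * u \<le> 1 + a" "2 * v \<le> b" "4 \<le> b" "0 \<le> a" for a b p u v :: real
      proof -
        have "p \<le> (a + b) / 2" "3 * u \<le> 3 * ((1 + a) / 2)" using that by simp_all
        then have "a + p + 3 * u + 2 * v + 2 \<le> a + (a + b) / 2 + 3 * ((1 + a) / 2) + b + 2"
          using that(3) by (intro add_mono order_refl)
        also have "\<dots> = 3 * a + 3 / 2 * b + 7 / 2" by (simp add: field_simps)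
        also have "\<dots> \<le> 4 * a + 4 * b" using that(4,5) by (intro order_trans[OF _ add_mono[of "3 * a" "4 * a" "3 / 2 * b + 7 / 2" "4 * b"]]) auto
        finally show ?thesis by simp
      qed
      ultimately show ?thesis by blast
    qed
    finally have b': "real D * (2 + log 2 x) < 4 * (M\<^sup>2 + \<Lambda>\<^sup>2)" using b by (rule order.strict_trans2[rotated])
    have "real D * log 2 x \<le> real D * (2 + log 2 x)" by (simp add: distrib_left)
    also note b'
    also have "4 * (M\<^sup>2 + \<Lambda>\<^sup>2) \<le> 200 * (M\<^sup>2 + \<Lambda>\<^sup>2)" by (intro mult_right_mono) auto
    finally have "real D / 200 * log 2 x - \<Lambda>\<^sup>2 \<le> M\<^sup>2" by (simp add: field_simps)
    then show ?thesis unfolding x_def[symmetric] D_def[symmetric] \<Lambda>_def[symmetric] M_def .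
  qed
qed

lemma Inf_enat_attained: "Inf A = enat M \<Longrightarrow> enat M \<in> A"
  by (auto simp: Inf_enat_def split: if_splits intro: LeastI) (metis LeastI ex_in_conv)

lemma enat_add_eq_enat: "enat l + s = enat M \<Longrightarrow> \<exists>c. s = enat c \<and> M = l + c"
  by (cases s) auto

theorem theorem5p13:
  shows "\<exists>C::real. C \<ge> 1 \<and>
    (\<forall>(n::nat) (f :: (nat \<Rightarrow> bool) \<Rightarrow> bool) (m::nat) (k::nat) (\<epsilon>::real).
       m > 0 \<longrightarrow> k > 0 \<longrightarrow> 0 < \<epsilon> \<longrightarrow> \<epsilon> \<le> 1/2 \<longrightarrow>
       ereal_of_enat (nondet_complexity k (disj_args n m) (comp_DISJ n f m k))
         \<ge> ereal (real (deg_plus n f \<epsilon>) / 2 * log 2 (sqrt (real m) / (C * real k * 2 ^ k))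
                  - log 2 (1 / \<epsilon>)) \<and>
       (ereal_of_enat (ma_complexity (1/3) k (disj_args n m) (comp_DISJ n f m k)))\<^sup>2
         \<ge> ereal (real (deg_plus n f \<epsilon>) / C * log 2 (sqrt (real m) / (C * real k * 2 ^ k))
                  - (log 2 (2 / \<epsilon>))\<^sup>2))"
proof (intro exI[of _ 200] conjI allI impI)
  show "1 \<le> (200 :: real)" by simp
  fix n m k :: nat and f :: "(nat \<Rightarrow> bool) \<Rightarrow> bool" and \<epsilon> :: real
  assume m: "0 < m" and k: "0 < k" and \<epsilon>: "0 < \<epsilon>" "\<epsilon> \<le> 1/2"
  show "ereal (real (deg_plus n f \<epsilon>) / 2 * log 2 (sqrt (real m) / (200 * real k * 2 ^ k)) - log 2 (1 / \<epsilon>))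
      \<le> ereal_of_enat (nondet_complexity k (disj_args n m) (comp_DISJ n f m k))"
  proof (cases "nondet_complexity k (disj_args n m) (comp_DISJ n f m k)")
    \<comment> \<open>A finite infimum of extended naturals is attained, so there is an optimal
      protocol; for infinite complexity the bound is trivial.\<close>
    case (enat M)
    then obtain l P where P: "nondet_computes k (disj_args n m) (comp_DISJ n f m k) l P"
      "nondet_cost k (disj_args n m) l P = enat M"
      using Inf_enat_attained unfolding nondet_complexity_def by fastforce
    obtain c where c: "(SUP g\<in>guesses l. protocol_cost k (disj_args n m) (P g)) = enat c" "M = l + c"
      using enat_add_eq_enat P(2) unfolding nondet_cost_def by blast
    have "bits_sent (P g) x \<le> c" if "g \<in> guesses l" "x \<in> PiE {..<k} (disj_args n m)" for g x
    proof -
      have "enat (bits_sent (P g) x) \<le> protocol_cost k (disj_args n m) (P g)"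
        unfolding protocol_cost_def using that(2) by (rule SUP_upper)
      also have "\<dots> \<le> enat c" unfolding c(1)[symmetric] using that(1) by (rule SUP_upper)
      finally show ?thesis by simp
    qed
    from nondet_lower_bound[OF m k \<epsilon> P(1) this] show ?thesis unfolding enat c(2) by simp
  qed simp
  show "ereal (real (deg_plus n f \<epsilon>) / 200 * log 2 (sqrt (real m) / (200 * real k * 2 ^ k)) - (log 2 (2 / \<epsilon>))\<^sup>2)
      \<le> (ereal_of_enat (ma_complexity (1/3) k (disj_args n m) (comp_DISJ n f m k)))\<^sup>2"
  proof (cases "ma_complexity (1/3) k (disj_args n m) (comp_DISJ n f m k)")
    case (enat M)
    then obtain l R where R: "ma_computes (1/3) k (disj_args n m) (comp_DISJ n f m k) l R"
      "ma_cost k (disj_args n m) l R = enat M"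
      using Inf_enat_attained unfolding ma_complexity_def by fastforce
    obtain c where c: "(SUP g\<in>guesses l. SUP P\<in>set_pmf (R g). protocol_cost k (disj_args n m) P) = enat c" "M = l + c"
      using enat_add_eq_enat R(2) unfolding ma_cost_def by blast
    have "bits_sent P x \<le> c" if "g \<in> guesses l" "P \<in> set_pmf (R g)" "x \<in> PiE {..<k} (disj_args n m)" for g P x
    proof -
      have "enat (bits_sent P x) \<le> protocol_cost k (disj_args n m) P"
        unfolding protocol_cost_def using that(3) by (rule SUP_upper)
      also have "\<dots> \<le> (SUP P\<in>set_pmf (R g). protocol_cost k (disj_args n m) P)" using that(2) by (rule SUP_upper)
      also have "\<dots> \<le> enat c" unfolding c(1)[symmetric] using that(1) by (rule SUP_upper)
      finally show ?thesis by simp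
    qed
    from ma_lower_bound[OF m k \<epsilon> R(1) this] show ?thesis unfolding enat c(2) by simp
  qed (simp add: power2_eq_square)
qed

end
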